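(* Let $\Bbbk$ be a countable totally ordered division ring, let $E$ be a countable $\Bbbk$-vector lattice, let $L$ be a countable completely normal distributive $0$-lattice, and let $\varphi\colon \operatorname{Id_c}E\to L$ be a closed $0$-lattice homomorphism. Then there are a countable $\Bbbk$-vector lattice $F$, a $\Bbbk$-vector lattice homomorphism $f\colon E\to F$, and a lattice isomorphism $\iota\colon\operatorname{Id_c}F\to L$ such that $\varphi=\iota\circ\operatorname{Id_c}f$.
   Context: "Countable" means "at most countable". A $\Bbbk$-vector lattice, for a totally ordered division ring $\Bbbk$, is a left $\Bbbk$-vector space $E$ endowed with a translation-invariant lattice order such that $\Bbbk^+E^+\subseteq E^+$, where $G^+=\{x\in G\mid 0\le x\}$. A $\Bbbk$-vector lattice homomorphism is a map that is both $\Bbbk$-linear and a lattice homomorphism. Write $|x|=x\vee(-x)$. For $a\in E$ the principal $\ell$-ideal generated by $a$ is $\langle a\rangle_E=\{x\in E\mid (\exists\lambda\in\Bbbk^+)\ |x|\le\lambda|a|\}$. $\operatorname{Id_c}E=\{\langle a\rangle_E\mid a\in E^+\}$, ordered by inclusion; it is a distributive lattice with least element $\{0\}$, with $\langle a\rangle\vee\langle b\rangle=\langle a\vee b\rangle=\langle a+b\rangle$ and $\langle a\rangle\wedge\langle b\rangle=\langle a\wedge b\rangle$ for $a,b\in E^+$. For a $\Bbbk$-vector lattice homomorphism $f\colon E\to F$, $\operatorname{Id_c}f\colon\operatorname{Id_c}E\to\operatorname{Id_c}F$ is the map $\langle x\rangle_E\mapsto\langle f(x)\rangle_F$; it is a lattice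 homomorphism preserving the least element. A distributive $0$-lattice is a distributive lattice with a least element $0$; a $0$-lattice homomorphism is a lattice homomorphism preserving $0$. A distributive $0$-lattice $L$ is completely normal if for all $a,b\in L$ there are $x,y\in L$ such that $a\vee b=a\vee y=x\vee b$ and $x\wedge y=0$. A lattice homomorphism $f\colon K\to L$ is closed if for all $a,b\in K$ and all $x\in L$ with $f(a)\le f(b)\vee x$ there exists $u\in K$ such that $a\le b\vee u$ and $f(u)\le x$. *)

theory Defs
  imports "HOL-Algebra.Module" "HOL-Algebra.Lattice" "HOL-Library.Countable_Set"
begin

section \<open>Distributive lattices with zero\<close>

text \<open>
  Lattices are those of \<^theory>\<open>HOL-Algebra.Lattice\<close>: joins, meets and the zero are determined
  by the order on the carrier. Maps are only looked at on carriers.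
\<close>

locale distributive_zero_lattice = lattice L + weak_partial_order_bottom L for L (structure) +
  assumes meet_join_distrib:
    "\<lbrakk>x \<in> carrier L; y \<in> carrier L; z \<in> carrier L\<rbrakk>
      \<Longrightarrow> x \<sqinter> (y \<squnion> z) = (x \<sqinter> y) \<squnion> (x \<sqinter> z)"

definition completely_normal :: "('a, 'm) gorder_scheme \<Rightarrow> bool" where
  "completely_normal L \<longleftrightarrow>
     (\<forall>a\<in>carrier L. \<forall>b\<in>carrier L. \<exists>x\<in>carrier L. \<exists>y\<in>carrier L.
        a \<squnion>\<^bsub>L\<^esub> b = a \<squnion>\<^bsub>L\<^esub> y \<and> a \<squnion>\<^bsub>L\<^esub> b = x \<squnion>\<^bsub>L\<^esub> b \<and> x \<sqinter>\<^bsub>L\<^esub> y = \<bottom>\<^bsub>L\<^esub>)"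

definition lattice_hom ::
  "('a, 'm) gorder_scheme \<Rightarrow> ('b, 'n) gorder_scheme \<Rightarrow> ('a \<Rightarrow> 'b) \<Rightarrow> bool" where
  "lattice_hom K L f \<longleftrightarrow>
     f \<in> carrier K \<rightarrow> carrier L \<and>
     (\<forall>x\<in>carrier K. \<forall>y\<in>carrier K.
        f (x \<squnion>\<^bsub>K\<^esub> y) = f x \<squnion>\<^bsub>L\<^esub> f y \<and> f (x \<sqinter>\<^bsub>K\<^esub> y) = f x \<sqinter>\<^bsub>L\<^esub> f y)"

definition zero_lattice_hom ::
  "('a, 'm) gorder_scheme \<Rightarrow> ('b, 'n) gorder_scheme \<Rightarrow> ('a \<Rightarrow> 'b) \<Rightarrow> bool" where
  "zero_lattice_hom K L f \<longleftrightarrow> lattice_hom K L f \<and> f \<bottom>\<^bsub>K\<^esub> = \<bottom>\<^bsub>L\<^esub>"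

definition lattice_iso ::
  "('a, 'm) gorder_scheme \<Rightarrow> ('b, 'n) gorder_scheme \<Rightarrow> ('a \<Rightarrow> 'b) \<Rightarrow> bool" where
  "lattice_iso K L f \<longleftrightarrow> lattice_hom K L f \<and> bij_betw f (carrier K) (carrier L)"

definition closed_map ::
  "('a, 'm) gorder_scheme \<Rightarrow> ('b, 'n) gorder_scheme \<Rightarrow> ('a \<Rightarrow> 'b) \<Rightarrow> bool" where
  "closed_map K L f \<longleftrightarrow>
     (\<forall>a\<in>carrier K. \<forall>b\<in>carrier K. \<forall>x\<in>carrier L.
        f a \<sqsubseteq>\<^bsub>L\<^esub> f b \<squnion>\<^bsub>L\<^esub> x \<longrightarrow> (\<exists>u\<in>carrier K. a \<sqsubseteq>\<^bsub>K\<^esub> b \<squnion>\<^bsub>K\<^esub> u \<and> f u \<sqsubseteq>\<^bsub>L\<^esub> x))"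


section \<open>Vector lattices over a totally ordered division ring\<close>

text \<open>
  The scalars form a type of sort \<open>{division_ring, linordered_ring_strict}\<close>, which does not
  impose commutativity; strict monotonicity of multiplication by positive elements is automatic
  in an ordered ring without zero divisors. The library's vector space locales have commutative
  scalars, so the axioms of a left vector space are spelled out. As usual for modules in
  \<open>HOL-Algebra\<close>, the record fields \<open>mult\<close> and \<open>one\<close> inherited from rings are not used.
  A vector lattice lives on a carrier set rather than on a whole type, so that a countable one
  whose existence is claimed can be sought with carrier in \<open>nat\<close> without loss of generality.
\<close>

record ('k, 'e) ordered_module = "('k, 'e) module" +
  vle :: "['e, 'e] \<Rightarrow> bool" (infixl \<open>\<preceq>\<index>\<close> 50)

definition order_of :: "('k, 'e, 'm) ordered_module_scheme \<Rightarrow> 'e gorder" where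
  "order_of E = \<lparr>carrier = carrier E, eq = (=), le = vle E\<rparr>"

locale vector_lattice = abelian_group E + order: lattice "order_of E"
  for E :: "('k::{division_ring, linordered_ring_strict}, 'e, 'm) ordered_module_scheme"
    (structure) +
  assumes smult_closed: "x \<in> carrier E \<Longrightarrow> c \<odot> x \<in> carrier E"
    and smult_l_distr: "x \<in> carrier E \<Longrightarrow> (c + d) \<odot> x = c \<odot> x \<oplus> d \<odot> x"
    and smult_r_distr: "\<lbrakk>x \<in> carrier E; y \<in> carrier E\<rbrakk> \<Longrightarrow> c \<odot> (x \<oplus> y) = c \<odot> x \<oplus> c \<odot> y"
    and smult_assoc: "x \<in> carrier E \<Longrightarrow> (c * d) \<odot> x = c \<odot> (d \<odot> x)"
    and smult_one: "x \<in> carrier E \<Longrightarrow> 1 \<odot> x = x"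
    and vle_translate:
      "\<lbrakk>x \<in> carrier E; y \<in> carrier E; z \<in> carrier E; x \<preceq> y\<rbrakk> \<Longrightarrow> x \<oplus> z \<preceq> y \<oplus> z"
    and smult_nonneg: "\<lbrakk>x \<in> carrier E; 0 \<le> c; \<zero> \<preceq> x\<rbrakk> \<Longrightarrow> \<zero> \<preceq> c \<odot> x"

definition vector_lattice_hom ::
  "('k, 'e, 'm) ordered_module_scheme \<Rightarrow> ('k, 'f, 'n) ordered_module_scheme \<Rightarrow> ('e \<Rightarrow> 'f) \<Rightarrow> bool"
  where
  "vector_lattice_hom E F f \<longleftrightarrow>
     f \<in> carrier E \<rightarrow> carrier F \<and>
     (\<forall>x\<in>carrier E. \<forall>y\<in>carrier E. f (x \<oplus>\<^bsub>E\<^esub> y) = f x \<oplus>\<^bsub>F\<^esub> f y) \<and>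
     (\<forall>c. \<forall>x\<in>carrier E. f (c \<odot>\<^bsub>E\<^esub> x) = c \<odot>\<^bsub>F\<^esub> f x) \<and>
     lattice_hom (order_of E) (order_of F) f"

definition pos_cone :: "('k, 'e, 'm) ordered_module_scheme \<Rightarrow> 'e set" where
  "pos_cone E = {x \<in> carrier E. \<zero>\<^bsub>E\<^esub> \<preceq>\<^bsub>E\<^esub> x}"

definition vabs :: "('k, 'e, 'm) ordered_module_scheme \<Rightarrow> 'e \<Rightarrow> 'e" where
  "vabs E x = x \<squnion>\<^bsub>order_of E\<^esub> (\<ominus>\<^bsub>E\<^esub> x)"

definition principal_ideal ::
  "('k::{division_ring, linordered_ring_strict}, 'e, 'm) ordered_module_scheme \<Rightarrow> 'e \<Rightarrow> 'e set"
  where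
  "principal_ideal E a = {x \<in> carrier E. \<exists>c\<ge>0. vabs E x \<preceq>\<^bsub>E\<^esub> c \<odot>\<^bsub>E\<^esub> vabs E a}"

definition Idc ::
  "('k::{division_ring, linordered_ring_strict}, 'e, 'm) ordered_module_scheme \<Rightarrow> 'e set gorder"
  where
  "Idc E = \<lparr>carrier = principal_ideal E ` pos_cone E, eq = (=), le = (\<subseteq>)\<rparr>"

text \<open>The map sending the ideal of \<open>x\<close> to the ideal of \<open>f x\<close>; independence of the choice of the
  generator is shown in \<open>Idc_map_principal_ideal\<close> below.\<close>

definition Idc_map ::
  "('k::{division_ring, linordered_ring_strict}, 'e, 'm) ordered_module_scheme \<Rightarrow>
   ('k, 'f, 'n) ordered_module_scheme \<Rightarrow> ('e \<Rightarrow> 'f) \<Rightarrow> 'e set \<Rightarrow> 'f set"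
  where
  "Idc_map E F f I =
     (THE J. \<exists>x\<in>pos_cone E. I = principal_ideal E x \<and> J = principal_ideal F (f x))"

lemma (in vector_lattice) vabs_pos_cone:
  assumes "x \<in> pos_cone E"
  shows "vabs E x = x"
proof -
  have x: "x \<in> carrier E" "\<zero> \<preceq> x"
    using assms by (auto simp: pos_cone_def)
  have "\<ominus> x \<preceq> \<zero>"
    using vle_translate[of \<zero> x "\<ominus> x"] x by (simp add: r_neg)
  then have le: "\<ominus> x \<sqsubseteq>\<^bsub>order_of E\<^esub> x"
    using order.le_trans[of "\<ominus> x" \<zero> x] x by (simp add: order_of_def)
  show ?thesis
    unfolding vabs_def
    using order.join_le[of x x "\<ominus> x"] order.join_left[of x "\<ominus> x"]
      order.le_antisym[of "x \<squnion>\<^bsub>order_of E\<^esub> (\<ominus> x)" x] order.join_closed[of x "\<ominus> x"] order.le_refl[of x] x le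
    by (simp add: order_of_def)
qed

lemma vector_lattice_hom_zero:
  assumes "vector_lattice E" "vector_lattice F" "vector_lattice_hom E F f"
  shows "f \<zero>\<^bsub>E\<^esub> = \<zero>\<^bsub>F\<^esub>"
proof -
  interpret E: vector_lattice E by fact
  interpret F: vector_lattice F by fact
  have c: "f \<zero>\<^bsub>E\<^esub> \<in> carrier F"
    using assms(3) by (auto simp: vector_lattice_hom_def)
  have "f (\<zero>\<^bsub>E\<^esub> \<oplus>\<^bsub>E\<^esub> \<zero>\<^bsub>E\<^esub>) = f \<zero>\<^bsub>E\<^esub> \<oplus>\<^bsub>F\<^esub> f \<zero>\<^bsub>E\<^esub>"
    using assms(3) E.zero_closed unfolding vector_lattice_hom_def by blast
  then have "f \<zero>\<^bsub>E\<^esub> \<oplus>\<^bsub>F\<^esub> f \<zero>\<^bsub>E\<^esub> = f \<zero>\<^bsub>E\<^esub>"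
    by simp
  then show ?thesis
    using c by (metis F.add.l_cancel_one)
qed

lemma vector_lattice_hom_mono:
  assumes "vector_lattice E" "vector_lattice F" "vector_lattice_hom E F f"
    and x: "x \<in> carrier E" and y: "y \<in> carrier E" and xy: "x \<preceq>\<^bsub>E\<^esub> y"
  shows "f x \<preceq>\<^bsub>F\<^esub> f y"
proof -
  interpret E: vector_lattice E by fact
  interpret F: vector_lattice F by fact
  have c: "f x \<in> carrier F" "f y \<in> carrier F"
    using assms(3) x y by (auto simp: vector_lattice_hom_def)
  have "x \<squnion>\<^bsub>order_of E\<^esub> y = y"
    using E.order.join_le[of x y y] E.order.join_right[of x y]
      E.order.le_antisym[of "x \<squnion>\<^bsub>order_of E\<^esub> y" y] E.order.join_closed[of x y] E.order.le_refl[of y] x y xy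
    by (simp add: order_of_def)
  then have "f x \<squnion>\<^bsub>order_of F\<^esub> f y = f y"
    using assms(3) x y unfolding vector_lattice_hom_def lattice_hom_def
    by (metis order_of_def partial_object.select_convs(1))
  then show ?thesis
    using F.order.join_left[of "f x" "f y"] c by (simp add: order_of_def)
qed

lemma vector_lattice_hom_pos_cone:
  assumes "vector_lattice E" "vector_lattice F" "vector_lattice_hom E F f" "x \<in> pos_cone E"
  shows "f x \<in> pos_cone F"
proof -
  interpret E: vector_lattice E by fact
  show ?thesis
    using vector_lattice_hom_mono[OF assms(1-3), of "\<zero>\<^bsub>E\<^esub>" x] vector_lattice_hom_zero[OF assms(1-3)]
      assms(3,4)
    by (auto simp: pos_cone_def vector_lattice_hom_def)
qed

lemma (in vector_lattice) principal_ideal_mono_iff: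
  assumes "x \<in> pos_cone E" "y \<in> pos_cone E"
  shows "principal_ideal E x \<subseteq> principal_ideal E y \<longleftrightarrow> (\<exists>c\<ge>0. x \<preceq> c \<odot> y)"
proof
  have xy: "x \<in> carrier E" "y \<in> carrier E"
    using assms by (auto simp: pos_cone_def)
  have self: "x \<in> principal_ideal E x"
    unfolding principal_ideal_def using xy order.le_refl[of x] zero_le_square[of "1::'k"]
    by (auto intro!: exI[of _ 1] simp: vabs_pos_cone[OF assms(1)] smult_one order_of_def)
  show "\<exists>c\<ge>0. x \<preceq> c \<odot> y" if "principal_ideal E x \<subseteq> principal_ideal E y"
    using subsetD[OF that self] vabs_pos_cone[OF assms(1)] vabs_pos_cone[OF assms(2)]
    by (simp add: principal_ideal_def)
  show "principal_ideal E x \<subseteq> principal_ideal E y" if ex: "\<exists>c\<ge>0. x \<preceq> c \<odot> y"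
  proof
    fix z assume "z \<in> principal_ideal E x"
    then obtain d where z: "z \<in> carrier E" and d: "d \<ge> 0" "vabs E z \<preceq> d \<odot> x"
      using vabs_pos_cone assms by (auto simp: principal_ideal_def)
    obtain c where c: "c \<ge> 0" "x \<preceq> c \<odot> y"
      using ex by blast
    have vz: "vabs E z \<in> carrier E"
      using order.join_closed[of z "\<ominus> z"] z by (simp add: vabs_def order_of_def)
    have cl: "d \<odot> x \<in> carrier E" "c \<odot> y \<in> carrier E" "d \<odot> (c \<odot> y) \<in> carrier E"
      using xy by (auto intro: smult_closed)
    have "\<zero> \<preceq> c \<odot> y \<ominus> x"
      using vle_translate[of x "c \<odot> y" "\<ominus> x"] xy cl c by (simp add: r_neg a_minus_def)
    then have "\<zero> \<preceq> d \<odot> (c \<odot> y \<ominus> x)"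
      using smult_nonneg d xy cl by simp
    then have "\<zero> \<oplus> d \<odot> x \<preceq> d \<odot> (c \<odot> y \<ominus> x) \<oplus> d \<odot> x"
      using vle_translate[of \<zero> "d \<odot> (c \<odot> y \<ominus> x)" "d \<odot> x"] xy cl smult_closed by simp
    then have "d \<odot> x \<preceq> d \<odot> (c \<odot> y \<ominus> x \<oplus> x)"
      using cl xy by (simp add: smult_r_distr)
    moreover have "c \<odot> y \<ominus> x \<oplus> x = c \<odot> y"
      using cl xy by (simp add: a_minus_def a_assoc l_neg)
    ultimately have "d \<odot> x \<preceq> d \<odot> (c \<odot> y)"
      by simp
    then have "vabs E z \<preceq> (d * c) \<odot> y"
      using order.le_trans[of "vabs E z" "d \<odot> x" "d \<odot> (c \<odot> y)"] d vz cl xy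
      by (simp add: order_of_def smult_assoc)
    then show "z \<in> principal_ideal E y"
      unfolding principal_ideal_def vabs_pos_cone[OF assms(2)]
      using z mult_nonneg_nonneg[OF d(1) c(1)] by blast
  qed
qed

lemma Idc_map_principal_ideal:
  assumes "vector_lattice E" "vector_lattice F" "vector_lattice_hom E F f" "x \<in> pos_cone E"
  shows "Idc_map E F f (principal_ideal E x) = principal_ideal F (f x)"
proof -
  interpret E: vector_lattice E by fact
  interpret F: vector_lattice F by fact
  have le: "principal_ideal F (f a) \<subseteq> principal_ideal F (f b)"
    if ab: "a \<in> pos_cone E" "b \<in> pos_cone E" "principal_ideal E a \<subseteq> principal_ideal E b" for a b
  proof -
    obtain c where c: "c \<ge> 0" "a \<preceq>\<^bsub>E\<^esub> c \<odot>\<^bsub>E\<^esub> b"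
      using E.principal_ideal_mono_iff[of a b] ab by auto
    have cr: "a \<in> carrier E" "b \<in> carrier E"
      using ab by (auto simp: pos_cone_def)
    have "f (c \<odot>\<^bsub>E\<^esub> b) = c \<odot>\<^bsub>F\<^esub> f b"
      using assms(3) cr by (simp add: vector_lattice_hom_def)
    then have "f a \<preceq>\<^bsub>F\<^esub> c \<odot>\<^bsub>F\<^esub> f b"
      using vector_lattice_hom_mono[OF assms(1-3), of a "c \<odot>\<^bsub>E\<^esub> b"] c cr
        E.smult_closed[of b c] by simp
    then show ?thesis
      using F.principal_ideal_mono_iff[of "f a" "f b"] vector_lattice_hom_pos_cone[OF assms(1-3)]
        ab c by auto
  qed
  show ?thesis
    unfolding Idc_map_def
  proof (intro the_equality)
    show "\<exists>y\<in>pos_cone E. principal_ideal E x = principal_ideal E y \<and>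
        principal_ideal F (f x) = principal_ideal F (f y)"
      using assms(4) by blast
  next
    fix J assume "\<exists>y\<in>pos_cone E. principal_ideal E x = principal_ideal E y \<and>
        J = principal_ideal F (f y)"
    then obtain y where "y \<in> pos_cone E" "principal_ideal E x = principal_ideal E y"
      and J: "J = principal_ideal F (f y)"
      by blast
    then show "J = principal_ideal F (f x)"
      using le[of x y] le[of y x] assms(4) by simp
  qed
qed

end

theory Submission
  imports Defs "HOL-Library.Poly_Mapping"
begin

text \<open>
  Points are prime filters of \<open>L\<close>, and elements of \<open>L\<close> are identified with the sets of points
  containing them. A vector lattice \<open>F\<close> with \<open>Id\<^sub>c F \<cong> L\<close> amounts to a vector space \<open>V\<close> with a map
  \<open>\<mu>\<close> from \<open>V\<close> to \<open>L\<close>, where \<open>\<mu> x\<close> is to be read as the set of points at which \<open>x\<close> is positive.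
  Every point then totally preorders \<open>V\<close>, and \<open>F\<close> is \<open>V\<close> modulo the vectors that vanish at all
  points. Start with a vector space \<open>V0\<close> mapped onto \<open>E\<close> and with the map \<open>\<mu>0\<close> induced by \<open>\<phi>\<close>, and
  adjoin countably many free generators. The map is extended to the larger space in countably many
  steps, each of which decides finitely many vectors. What is decided at a point \<open>p\<close> generates a
  cone \<open>C\<^sub>p\<close> of vectors known to be nonnegative at \<open>p\<close>.

  A new vector \<open>v\<close> can be decided since \<open>N = {p. v \<notin> C\<^sub>p}\<close> and \<open>N' = {p. - v \<notin> C\<^sub>p}\<close> belong to \<open>L\<close>
  (it suffices to consider the finitely many representations of \<open>v\<close> whose generators are
  independent modulo \<open>V0\<close>), so that complete normality, applied to \<open>N\<close> and \<open>N'\<close>, yields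
  disjoint values for \<open>\<mu> v\<close> and \<open>\<mu> (- v)\<close>. Fresh generators realize positive parts and all elements
  of \<open>L\<close>. If \<open>\<mu> a \<subseteq> \<mu> b\<close> with \<open>a, b \<ge> 0\<close>, closedness of \<open>\<phi>\<close> bounds the scalars \<open>e\<close> for which \<open>a - e b\<close>
  is known to be nonnegative at some point of \<open>\<mu> b\<close>, so that \<open>a \<le> e b\<close> can be imposed for a large
  \<open>e\<close>; this makes \<open>Id\<^sub>c F \<rightarrow> L\<close> injective.
\<close>

section \<open>Cones in vector spaces over ordered division rings\<close>

lemma one_pos: "(0::'k::{division_ring,linordered_ring_strict}) < 1"
  using zero_le_square[of "1::'k"] by (simp add: order_less_le)

lemma inverse_pos:
  fixes c :: "'k::{division_ring,linordered_ring_strict}"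
  assumes "0 < c"
  shows "0 < inverse c"
proof (rule ccontr)
  assume "\<not> 0 < inverse c"
  then have "c * inverse c \<le> 0"
    using assms by (intro mult_nonneg_nonpos) auto
  then show False
    using assms one_pos[where ?'k='k] by (simp add: leD)
qed

locale left_vector_space =
  fixes scale :: "'k::{division_ring,linordered_ring_strict} \<Rightarrow> 'v::ab_group_add \<Rightarrow> 'v"
    (infixr \<open>\<cdot>\<close> 75)
  assumes scale_add_right: "c \<cdot> (x + y) = c \<cdot> x + c \<cdot> y"
    and scale_add_left: "(c + d) \<cdot> x = c \<cdot> x + d \<cdot> x"
    and scale_scale: "c \<cdot> d \<cdot> x = (c * d) \<cdot> x"
    and scale_one [simp]: "1 \<cdot> x = x"
begin

lemma scale_zero_left [simp]: "0 \<cdot> x = 0"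
  using scale_add_left[of 0 0 x] by simp

lemma scale_zero_right [simp]: "c \<cdot> 0 = 0"
  using scale_add_right[of c 0 0] by simp

lemma scale_minus_left [simp]: "(- c) \<cdot> x = - (c \<cdot> x)"
  using scale_add_left[of "- c" c x] by (simp add: eq_neg_iff_add_eq_0)

lemma scale_minus_right [simp]: "c \<cdot> (- x) = - (c \<cdot> x)"
  using scale_add_right[of c "- x" x] by (simp add: eq_neg_iff_add_eq_0)

lemma scale_diff_right: "c \<cdot> (x - y) = c \<cdot> x - c \<cdot> y"
  using scale_add_right[of c x "- y"] by simp

lemma scale_diff_left: "(c - d) \<cdot> x = c \<cdot> x - d \<cdot> x"
  using scale_add_left[of c "- d" x] by simp

lemma scale_sum: "c \<cdot> (\<Sum>i\<in>I. f i) = (\<Sum>i\<in>I. c \<cdot> f i)"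
  by (induction I rule: infinite_finite_induct) (simp_all add: scale_add_right)

lemma inverse_scale: "c \<noteq> 0 \<Longrightarrow> inverse c \<cdot> c \<cdot> x = x"
  by (simp add: scale_scale)

text \<open>An ordered division ring has characteristic zero. This keeps the two simultaneous
  updates of a measure at \<open>v\<close> and \<open>- v\<close> from colliding.\<close>

lemma neq_uminus:
  fixes x :: 'v
  assumes "x \<noteq> 0"
  shows "x \<noteq> - x"
proof
  assume "x = - x"
  then have "(1 + 1) \<cdot> x = 0"
    by (metis scale_add_left scale_one add.right_inverse)
  moreover have "(1 + 1 :: 'k) \<noteq> 0"
    using one_pos[where ?'k='k] by (metis add_pos_pos less_irrefl)
  ultimately show False
    using assms inverse_scale[of "1 + 1" x] by simp
qed

inductive_set cone :: "'v set \<Rightarrow> 'v set" for S where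
  cone_zero: "0 \<in> cone S"
| cone_step: "x \<in> cone S \<Longrightarrow> g \<in> S \<Longrightarrow> 0 \<le> c \<Longrightarrow> x + c \<cdot> g \<in> cone S"

lemma cone_base: "g \<in> S \<Longrightarrow> g \<in> cone S"
  using cone_step[OF cone_zero, of g S 1] one_pos[where ?'k='k] by (simp add: less_imp_le)

lemma cone_add:
  assumes "x \<in> cone S" "y \<in> cone S"
  shows "x + y \<in> cone S"
  using assms(2)
proof induction
  case cone_zero
  then show ?case using assms(1) by simp
next
  case (cone_step y g c)
  then show ?case using cone.cone_step[of "x + y" S g c] by (simp add: add.assoc)
qed

lemma cone_scale:
  assumes "x \<in> cone S" "0 \<le> d"
  shows "d \<cdot> x \<in> cone S"
  using assms(1)
proof induction
  case cone_zero
  then show ?case by (simp add: cone.cone_zero)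
next
  case (cone_step y g c)
  then show ?case
    using cone.cone_step[of "d \<cdot> y" S g "d * c"] assms(2)
    by (simp add: scale_add_right scale_scale)
qed

lemma cone_scale_cancel: "d \<cdot> x \<in> cone S \<Longrightarrow> 0 < d \<Longrightarrow> x \<in> cone S"
  using cone_scale[of "d \<cdot> x" S "inverse d"] inverse_pos[of d]
  by (simp add: inverse_scale less_imp_le)

lemma cone_sum: "(\<And>i. i \<in> I \<Longrightarrow> f i \<in> cone S) \<Longrightarrow> (\<Sum>i\<in>I. f i) \<in> cone S"
  by (induction I rule: infinite_finite_induct) (simp_all add: cone_zero cone_add)

lemma cone_mono: "S \<subseteq> T \<Longrightarrow> cone S \<subseteq> cone T"
proof
  fix x assume "S \<subseteq> T" "x \<in> cone S"
  from this(2,1) show "x \<in> cone T"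
    by induction (auto intro: cone.intros)
qed

lemma cone_insertE:
  assumes "x \<in> cone (insert v S)"
  obtains m d where "m \<in> cone S" "0 \<le> d" "x = m + d \<cdot> v"
proof -
  from assms have "\<exists>m d. m \<in> cone S \<and> 0 \<le> d \<and> x = m + d \<cdot> v"
  proof induction
    case cone_zero
    then show ?case using cone.cone_zero by (intro exI[of _ 0]) auto
  next
    case (cone_step x g c)
    then obtain m d where m: "m \<in> cone S" "0 \<le> d" "x = m + d \<cdot> v" by blast
    show ?case
    proof (cases "g = v")
      case True
      then show ?thesis
        using m cone_step by (intro exI[of _ m] exI[of _ "d + c"]) (simp add: scale_add_left)
    next
      case False
      then show ?thesis
        using m cone_step cone.cone_step[of m S g c]
        by (intro exI[of _ "m + c \<cdot> g"] exI[of _ d]) simp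
    qed
  qed
  then show ?thesis using that by blast
qed

text \<open>Left linear functionals. One that vanishes on all decided vectors certifies that a fresh
  vector lies in none of the cones, and it reads off the coefficient of that vector in a
  combination.\<close>

definition functional :: "('v \<Rightarrow> 'k) \<Rightarrow> bool" where
  "functional f \<longleftrightarrow> (\<forall>x y. f (x + y) = f x + f y) \<and> (\<forall>c x. f (c \<cdot> x) = c * f x)"

lemma functional_simps:
  assumes "functional f"
  shows "f (x + y) = f x + f y" "f (c \<cdot> x) = c * f x" "f 0 = 0" "f (- x) = - f x" "f (x - y) = f x - f y"
proof -
  show 1: "f (x + y) = f x + f y" "f (c \<cdot> x) = c * f x" for x y c
    using assms by (auto simp: functional_def)
  show "f 0 = 0"
    using 1(2)[of 0 0] by simp
  show 2: "f (- x) = - f x" for x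
    using 1(2)[of "- 1" x] by simp
  show "f (x - y) = f x - f y"
    using 1(1)[of x "- y"] 2[of y] by simp
qed

lemma functional_cone_zero:
  assumes f: "functional f" and S: "\<And>x. x \<in> S \<Longrightarrow> f x = 0" and x: "x \<in> cone S"
  shows "f x = 0"
  using x by induction (simp_all add: functional_simps[OF f] S)

text \<open>If \<open>- x = m + d \<cdot> v\<close> with \<open>d > 0\<close>, then
  \<open>d \<cdot> (- v) = m + x\<close> lies in the cone, and dividing by \<open>d\<close> puts
  \<open>- v\<close> there as well.\<close>

lemma neg_notin_cone_insert:
  assumes "- v \<notin> cone S" "x \<in> cone S" "- x \<notin> cone S"
  shows "- x \<notin> cone (insert v S)"
proof
  assume "- x \<in> cone (insert v S)"
  then obtain m d where m: "m \<in> cone S" "0 \<le> d" "- x = m + d \<cdot> v"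
    by (rule cone_insertE)
  show False
  proof (cases "d = 0")
    case True
    then show False using m assms by simp
  next
    case False
    have "d \<cdot> (- v) = m + x"
      using m(3) by (simp add: algebra_simps eq_neg_iff_add_eq_0 neg_eq_iff_add_eq_0)
    then have "d \<cdot> (- v) \<in> cone S"
      using cone_add[OF m(1) assms(2)] by simp
    then show False
      using cone_scale_cancel assms(1) False m(2) by force
  qed
qed

text \<open>From \<open>- v = m + d \<cdot> v\<close> follows
  \<open>(1 + d) \<cdot> (- v) = m\<close>, and \<open>1 + d\<close> is positive.\<close>

lemma neg_notin_cone_insert_self:
  assumes "- v \<notin> cone S"
  shows "- v \<notin> cone (insert v S)"
proof
  assume "- v \<in> cone (insert v S)"
  then obtain m d where m: "m \<in> cone S" "0 \<le> d" "- v = m + d \<cdot> v"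
    by (rule cone_insertE)
  have "m = - v - d \<cdot> v"
    using m(3) by simp
  then have "(1 + d) \<cdot> (- v) = m"
    by (simp add: scale_add_left)
  moreover have "0 < 1 + d"
    using m(2) one_pos[where ?'k='k] by (simp add: add_pos_nonneg)
  ultimately show False
    using cone_scale_cancel m(1) assms by metis
qed

text \<open>The case in which \<open>v\<close> is declared to vanish. If both signs of
  \<open>v\<close> are in the cone, nothing new is generated; if neither is, only the sign of the
  net coefficient \<open>d - d'\<close> matters, which reduces to inserting a single vector.\<close>

lemma neg_notin_cone_insert_both:
  assumes "v \<in> cone S \<longleftrightarrow> - v \<in> cone S" "x \<in> cone S" "- x \<notin> cone S"
  shows "- x \<notin> cone (insert v (insert (- v) S))"
proof (cases "v \<in> cone S")
  case True
  show ?thesis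
  proof
    assume "- x \<in> cone (insert v (insert (- v) S))"
    then obtain m d where m: "m \<in> cone (insert (- v) S)" "0 \<le> d" "- x = m + d \<cdot> v"
      by (rule cone_insertE)
    from m(1) obtain m' d' where m': "m' \<in> cone S" "0 \<le> d'" "m = m' + d' \<cdot> (- v)"
      by (rule cone_insertE)
    have "- x = m' + d' \<cdot> (- v) + d \<cdot> v"
      using m m' by simp
    then show False
      using assms True m m' by (metis cone_add cone_scale)
  qed
next
  case False
  with assms have n: "- v \<notin> cone S" by simp
  have *: "- x \<notin> cone (insert (- v) S)"
    using neg_notin_cone_insert[of "- v" S x] False assms by simp
  show ?thesis
  proof
    assume "- x \<in> cone (insert v (insert (- v) S))"
    then obtain m d where m: "m \<in> cone (insert (- v) S)" "0 \<le> d" "- x = m + d \<cdot> v"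
      by (rule cone_insertE)
    from m(1) obtain m' d' where m': "m' \<in> cone S" "0 \<le> d'" "m = m' + d' \<cdot> (- v)"
      by (rule cone_insertE)
    have eq: "- x = m' + (d - d') \<cdot> v"
      using m m' by (simp add: scale_diff_left)
    show False
    proof (cases "d' \<le> d")
      case True
      then have "- x \<in> cone (insert v S)"
        unfolding eq using m'(1) cone_mono[of S "insert v S"]
        by (intro cone_step) auto
      then show False
        using neg_notin_cone_insert[OF n assms(2,3)] by simp
    next
      case False
      have "- x = m' + (d' - d) \<cdot> (- v)"
        unfolding eq by (simp add: scale_diff_left)
      then have "- x \<in> cone (insert (- v) S)"
        using m'(1) cone_mono[of S "insert (- v) S"] False
        by (metis cone_step subsetD subset_insertI insertI1 diff_ge_0_iff_ge less_imp_le not_le)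
      then show False using * by simp
    qed
  qed
qed

section \<open>Sign decisions at a point\<close>

text \<open>A vector \<open>x\<close> of \<open>D\<close> is positive at \<open>p\<close> if \<open>p \<in> \<mu> x\<close>, and nonnegative at \<open>p\<close> if \<open>p \<notin> \<mu> (- x)\<close>.\<close>

definition nonneg_cone :: "'v set \<Rightarrow> ('v \<Rightarrow> 'p set) \<Rightarrow> 'p \<Rightarrow> 'v set" where
  "nonneg_cone D \<mu> p = cone {w \<in> D. p \<notin> \<mu> (- w)}"

text \<open>The last clause excludes that a vector declared positive at \<open>p\<close> is forced
  to be nonpositive there by the decisions made at \<open>p\<close>.\<close>

definition consistent :: "'v set \<Rightarrow> ('v \<Rightarrow> 'p set) \<Rightarrow> bool" where
  "consistent D \<mu> \<longleftrightarrow> 0 \<in> D \<and> (\<forall>x\<in>D. - x \<in> D) \<and> (\<forall>x\<in>D. \<mu> x \<inter> \<mu> (- x) = {}) \<and>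
     (\<forall>x\<in>D. \<forall>p\<in>\<mu> x. - x \<notin> nonneg_cone D \<mu> p)"

text \<open>By consistency at \<open>- x\<close>, generating the cone changes no sign that was
  already decided.\<close>

lemma nonneg_cone_iff:
  assumes "consistent D \<mu>" "x \<in> D"
  shows "x \<in> nonneg_cone D \<mu> p \<longleftrightarrow> p \<notin> \<mu> (- x)"
proof
  assume "x \<in> nonneg_cone D \<mu> p"
  then show "p \<notin> \<mu> (- x)"
    using assms unfolding consistent_def by (metis add.inverse_inverse)
qed (auto simp: nonneg_cone_def assms intro: cone_base)

lemma nonneg_cone_insert:
  assumes "consistent D \<mu>" "v \<notin> D" 
  shows "nonneg_cone (insert v (insert (- v) D)) (\<mu>(v := q, - v := r)) p =
    cone ((if p \<in> r then {} else {v}) \<union> (if p \<in> q then {} else {- v}) \<union> {w \<in> D. p \<notin> \<mu> (- w)})"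
proof -
  have sym: "\<And>x. x \<in> D \<Longrightarrow> - x \<in> D"
    using assms(1) by (auto simp: consistent_def)
  have "v \<noteq> 0"
    using assms by (auto simp: consistent_def)
  then have v: "v \<noteq> - v"
    by (rule neq_uminus)
  have neq: "- w \<noteq> v \<and> w \<noteq> v" if "w \<in> D" for w
    using that sym assms(2) by auto
  show ?thesis
    unfolding nonneg_cone_def
    by (rule arg_cong[where f = cone]) (use v neq in auto)
qed

text \<open>\<open>q\<close> and \<open>r\<close> are the points where \<open>v\<close> becomes
  positive and negative; everywhere else it becomes zero. The hypotheses on \<open>q\<close>,
  \<open>r\<close> and their complement are those under which inserting \<open>v\<close>,
  \<open>- v\<close> or both into the cone keeps the earlier strict signs.\<close>

lemma consistent_insert:
  assumes D: "consistent D \<mu>" and v: "v \<notin> D" and disj: "q \<inter> r = {}"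
    and q: "\<And>p. p \<in> q \<Longrightarrow> - v \<notin> nonneg_cone D \<mu> p"
    and r: "\<And>p. p \<in> r \<Longrightarrow> v \<notin> nonneg_cone D \<mu> p"
    and qr: "\<And>p. p \<notin> q \<Longrightarrow> p \<notin> r \<Longrightarrow>
      v \<in> nonneg_cone D \<mu> p \<longleftrightarrow> - v \<in> nonneg_cone D \<mu> p"
  shows "consistent (insert v (insert (- v) D)) (\<mu>(v := q, - v := r))"
proof -
  let ?D = "insert v (insert (- v) D)" and ?\<mu> = "\<mu>(v := q, - v := r)"
  have sym: "\<And>x. x \<in> D \<Longrightarrow> - x \<in> D" and z: "0 \<in> D"
    using D by (auto simp: consistent_def)
  have "v \<noteq> 0" using v z by auto
  then have vv: "v \<noteq> - v"
    by (rule neq_uminus)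
  have nv: "- v \<notin> D" using sym[of "- v"] v by auto
  have neq: "- w \<noteq> v \<and> w \<noteq> v \<and> w \<noteq> - v" if "w \<in> D" for w
    using that sym v nv by auto
  have "- x \<notin> nonneg_cone ?D ?\<mu> p" if x: "x \<in> ?D" and p: "p \<in> ?\<mu> x" for x p
  proof -
    let ?S = "{w \<in> D. p \<notin> \<mu> (- w)}"
    have C: "nonneg_cone D \<mu> p = cone ?S"
      by (simp add: nonneg_cone_def)
    have D': "x \<in> cone ?S \<and> - x \<notin> cone ?S" if "x \<in> D"
    proof -
      have "p \<in> \<mu> x" using p neq[OF that] by (simp add: fun_upd_def split: if_splits)
      then show ?thesis
        using D that nonneg_cone_iff[OF D that, of p] unfolding consistent_def C[symmetric] by auto
    qed
    note eq = nonneg_cone_insert[OF D v, of q r p]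
    \<comment> \<open>The point sees \<open>v\<close> as positive, negative or zero, and its cone
      gains \<open>v\<close>, \<open>- v\<close> or both.\<close>
    consider "p \<in> q" "p \<notin> r" | "p \<in> r" "p \<notin> q" | "p \<notin> q" "p \<notin> r"
      using disj by auto
    then show ?thesis
    proof cases
      case 1
      have c: "nonneg_cone ?D ?\<mu> p = cone (insert v ?S)"
        unfolding eq using 1 by simp
      have n: "- v \<notin> cone ?S" using q 1 C by auto
      have "x \<noteq> - v" using p 1 by auto
      then consider "x = v" | "x \<in> D" using x by auto
      then show ?thesis
        unfolding c using neg_notin_cone_insert_self[OF n] neg_notin_cone_insert[OF n] D' by cases auto
    next
      case 2
      have c: "nonneg_cone ?D ?\<mu> p = cone (insert (- v) ?S)"
        unfolding eq using 2 by simp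
      have n: "- (- v) \<notin> cone ?S" using r 2 C by auto
      have "x \<noteq> v" using p 2 vv by auto
      then consider "x = - v" | "x \<in> D" using x by auto
      then show ?thesis
        unfolding c using neg_notin_cone_insert_self[OF n] neg_notin_cone_insert[OF n] D' by cases auto
    next
      case 3
      have c: "nonneg_cone ?D ?\<mu> p = cone (insert v (insert (- v) ?S))"
        unfolding eq using 3 by (simp add: insert_commute)
      have "x \<in> D" using x p 3 vv by (auto split: if_splits)
      then show ?thesis
        unfolding c using neg_notin_cone_insert_both[of v ?S x] qr[of p] 3 D' C by simp
    qed
  qed
  moreover have "?\<mu> x \<inter> ?\<mu> (- x) = {}" if "x \<in> ?D" for x
  proof -
    have "\<mu> x \<inter> \<mu> (- x) = {}" if "x \<in> D"
      using D that by (auto simp: consistent_def)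
    then show ?thesis using that disj vv neq[of x] by auto
  qed
  ultimately show ?thesis
    unfolding consistent_def using sym z by auto
qed

end

section \<open>Extending a measure one vector at a time\<close>

text \<open>The argument of Rasiowa and Sikorski: enumerate the goals and meet the n-th one when
  passing to stage n + 1.\<close>

lemma chain_meeting_countably_many_goals:
  assumes "countable T" and refl: "\<And>s. R s s" and s0: "P s0"
    and dense: "\<And>Q s. Q \<in> T \<Longrightarrow> P s \<Longrightarrow> \<exists>s'. P s' \<and> R s s' \<and> Q s'"
  shows "\<exists>S. (\<forall>n::nat. P (S n) \<and> R (S n) (S (Suc n))) \<and> (\<forall>Q\<in>T. \<exists>n. Q (S n))"
proof -
  \<comment> \<open>The guard covers an empty \<open>T\<close>, whose enumeration returns an
    arbitrary predicate; then the state is kept, by reflexivity.\<close>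
  have "\<exists>s'. P s' \<and> (R s s' \<and> (from_nat_into T n \<in> T \<longrightarrow> from_nat_into T n s'))" if "P s" for s n
    using dense[OF _ that, of "from_nat_into T n"] refl[of s] that by blast
  then obtain S where S: "\<And>n. P (S n)" "\<And>n. R (S n) (S (Suc n))"
    "\<And>n. from_nat_into T n \<in> T \<longrightarrow> from_nat_into T n (S (Suc n))"
    using dependent_nat_choice[of "\<lambda>_. P" "\<lambda>n s s'. R s s' \<and> (from_nat_into T n \<in> T \<longrightarrow> from_nat_into T n s')"] s0
    by metis
  have "\<exists>n. Q (S n)" if "Q \<in> T" for Q
    using S(3)[of "to_nat_on T Q"] that assms(1) by auto
  then show ?thesis using S by blast
qed

text \<open>\<open>\<mu>0_closed\<close> is what closedness of \<open>\<phi>\<close> becomes on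
  \<open>V0\<close>, \<open>Lat_normal\<close> is complete normality, and \<open>fresh\<close> says
  that \<open>V0\<close> has infinite codimension.\<close>

locale measured_extension = left_vector_space scale
  for scale :: "'k::{division_ring,linordered_ring_strict} \<Rightarrow> 'v::ab_group_add \<Rightarrow> 'v" (infixr \<open>\<cdot>\<close> 75) +
  fixes V0 :: "'v set" and \<mu>0 :: "'v \<Rightarrow> 'p set" and Lat :: "'p set set"
  assumes V0_zero: "0 \<in> V0"
    and V0_add: "x \<in> V0 \<Longrightarrow> y \<in> V0 \<Longrightarrow> x + y \<in> V0"
    and V0_scale: "x \<in> V0 \<Longrightarrow> c \<cdot> x \<in> V0"
    and \<mu>0_Lat: "x \<in> V0 \<Longrightarrow> \<mu>0 x \<in> Lat"
    and \<mu>0_add: "x \<in> V0 \<Longrightarrow> y \<in> V0 \<Longrightarrow> \<mu>0 (x + y) \<subseteq> \<mu>0 x \<union> \<mu>0 y"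
    and \<mu>0_scale: "x \<in> V0 \<Longrightarrow> 0 < c \<Longrightarrow> \<mu>0 (c \<cdot> x) \<subseteq> \<mu>0 x"
    and \<mu>0_disjoint: "x \<in> V0 \<Longrightarrow> \<mu>0 x \<inter> \<mu>0 (- x) = {}"
    and \<mu>0_closed: "x \<in> V0 \<Longrightarrow> y \<in> V0 \<Longrightarrow> X \<in> Lat \<Longrightarrow> \<mu>0 x \<subseteq> \<mu>0 y \<union> X \<Longrightarrow>
      \<exists>c\<ge>0. \<mu>0 (x - c \<cdot> y) \<inter> \<mu>0 y \<subseteq> X"
    and Lat_empty: "{} \<in> Lat"
    and Lat_Un: "A \<in> Lat \<Longrightarrow> B \<in> Lat \<Longrightarrow> A \<union> B \<in> Lat"
    and Lat_Int: "A \<in> Lat \<Longrightarrow> B \<in> Lat \<Longrightarrow> A \<inter> B \<in> Lat"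
    and Lat_normal: "A \<in> Lat \<Longrightarrow> B \<in> Lat \<Longrightarrow>
      \<exists>X\<in>Lat. \<exists>Y\<in>Lat. A \<union> B = A \<union> Y \<and> A \<union> B = X \<union> B \<and> X \<inter> Y = {}"
    and fresh: "finite G \<Longrightarrow> \<exists>t f. functional f \<and> f t = 1 \<and> (\<forall>x\<in>V0 \<union> G. f x = 0)"
begin

lemma V0_minus: "x \<in> V0 \<Longrightarrow> - x \<in> V0"
  using V0_scale[of x "- 1"] by simp

lemma V0_diff: "x \<in> V0 \<Longrightarrow> y \<in> V0 \<Longrightarrow> x - y \<in> V0"
  using V0_add[OF _ V0_minus] by force

lemma Lat_UN: "finite I \<Longrightarrow> (\<And>i. i \<in> I \<Longrightarrow> A i \<in> Lat) \<Longrightarrow> (\<Union>i\<in>I. A i) \<in> Lat"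
  by (induction I rule: finite_induct) (auto simp: Lat_empty Lat_Un)

lemma Lat_INT: "finite I \<Longrightarrow> I \<noteq> {} \<Longrightarrow> (\<And>i. i \<in> I \<Longrightarrow> A i \<in> Lat) \<Longrightarrow> (\<Inter>i\<in>I. A i) \<in> Lat"
  by (induction I rule: finite_ne_induct) (auto simp: Lat_Int)

text \<open>Finiteness of \<open>G\<close> is what makes the sets attached to a new vector finite
  lattice expressions in members of \<open>Lat\<close>.\<close>

definition state :: "'v set \<Rightarrow> ('v \<Rightarrow> 'p set) \<Rightarrow> bool" where
  "state G \<mu> \<longleftrightarrow> finite G \<and> consistent (V0 \<union> G) \<mu> \<and> (\<forall>x\<in>V0 \<union> G. \<mu> x \<in> Lat) \<and> (\<forall>x\<in>V0. \<mu> x = \<mu>0 x)"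

definition extends :: "'v set \<times> ('v \<Rightarrow> 'p set) \<Rightarrow> 'v set \<times> ('v \<Rightarrow> 'p set) \<Rightarrow> bool" where
  "extends s s' \<longleftrightarrow> fst s \<subseteq> fst s' \<and> (\<forall>x\<in>V0 \<union> fst s. snd s' x = snd s x)"

lemma stateD:
  assumes "state G \<mu>"
  shows "finite G" "consistent (V0 \<union> G) \<mu>" "\<And>x. x \<in> V0 \<union> G \<Longrightarrow> \<mu> x \<in> Lat" "\<And>x. x \<in> V0 \<Longrightarrow> \<mu> x = \<mu>0 x"
    "\<And>x. x \<in> V0 \<union> G \<Longrightarrow> - x \<in> V0 \<union> G" "\<And>x. x \<in> V0 \<union> G \<Longrightarrow> \<mu> x \<inter> \<mu> (- x) = {}"
    "\<And>x p. x \<in> V0 \<union> G \<Longrightarrow> x \<in> nonneg_cone (V0 \<union> G) \<mu> p \<longleftrightarrow> p \<notin> \<mu> (- x)"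
  using assms nonneg_cone_iff[of "V0 \<union> G" \<mu>] unfolding state_def consistent_def by blast+

text \<open>Subadditivity and positive homogeneity of \<open>\<mu>0\<close> make the vectors of
  \<open>V0\<close> that are nonnegative at \<open>p\<close> a cone already, so that generating the
  cone adds nothing.\<close>

lemma initial_state: "state {} \<mu>0"
proof -
  have z: "\<mu>0 0 = {}"
    using \<mu>0_disjoint[OF V0_zero] by simp
  have c: "x \<in> V0 \<and> p \<notin> \<mu>0 (- x)" if "x \<in> nonneg_cone V0 \<mu>0 p" for x p
    using that unfolding nonneg_cone_def
  proof induction
    case cone_zero
    then show ?case using V0_zero z by simp
  next
    case (cone_step x g c)
    have "\<mu>0 (c \<cdot> (- g)) \<subseteq> \<mu>0 (- g)"
    proof (cases "c = 0")
      case True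
      then show ?thesis using z by simp
    next
      case False
      then show ?thesis using cone_step \<mu>0_scale[of "- g" c] V0_minus by (simp add: less_le)
    qed
    moreover have "\<mu>0 (- x + c \<cdot> (- g)) \<subseteq> \<mu>0 (- x) \<union> \<mu>0 (c \<cdot> (- g))"
      using cone_step by (intro \<mu>0_add V0_minus V0_scale) auto
    ultimately show ?case
      using cone_step by (auto simp: V0_add V0_scale)
  qed
  show ?thesis
    unfolding state_def consistent_def
    using V0_zero V0_minus \<mu>0_disjoint \<mu>0_Lat c by fastforce
qed

lemma state_insert:
  assumes s: "state G \<mu>" and v: "v \<notin> V0 \<union> G" and Lat: "q \<in> Lat" "r \<in> Lat" and disj: "q \<inter> r = {}"
    and q: "\<And>p. p \<in> q \<Longrightarrow> - v \<notin> nonneg_cone (V0 \<union> G) \<mu> p"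
    and r: "\<And>p. p \<in> r \<Longrightarrow> v \<notin> nonneg_cone (V0 \<union> G) \<mu> p"
    and qr: "\<And>p. p \<notin> q \<Longrightarrow> p \<notin> r \<Longrightarrow>
      v \<in> nonneg_cone (V0 \<union> G) \<mu> p \<longleftrightarrow> - v \<in> nonneg_cone (V0 \<union> G) \<mu> p"
  shows "state (insert v (insert (- v) G)) (\<mu>(v := q, - v := r))"
    and "extends (G, \<mu>) (insert v (insert (- v) G), \<mu>(v := q, - v := r))"
proof -
  have nv: "- v \<notin> V0 \<union> G" using stateD(5)[OF s, of "- v"] v by auto
  have "v \<noteq> 0" using v V0_zero by auto
  then have vv: "v \<noteq> - v" by (rule neq_uminus)
  show "extends (G, \<mu>) (insert v (insert (- v) G), \<mu>(v := q, - v := r))"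
    using v nv by (auto simp: extends_def)
  show "state (insert v (insert (- v) G)) (\<mu>(v := q, - v := r))"
    using consistent_insert[OF stateD(2)[OF s] v disj q r qr] stateD(1,3,4)[OF s] v nv Lat
    unfolding state_def by auto
qed

section \<open>Representations of vectors in the cones\<close>

lemma nonneg_cone_add:
  "x \<in> nonneg_cone D \<mu> p \<Longrightarrow> y \<in> nonneg_cone D \<mu> p \<Longrightarrow> x + y \<in> nonneg_cone D \<mu> p"
  by (simp add: nonneg_cone_def cone_add)

lemma nonneg_cone_scale: "x \<in> nonneg_cone D \<mu> p \<Longrightarrow> 0 \<le> c \<Longrightarrow> c \<cdot> x \<in> nonneg_cone D \<mu> p"
  by (simp add: nonneg_cone_def cone_scale)

text \<open>Since \<open>A\<close> is closed under the cone operations, all contributions from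
  \<open>A\<close> merge into one remainder, and only the coefficients on the finite set
  \<open>H\<close> have to be recorded.\<close>

lemma cone_Un_representation:
  assumes "finite H" and A: "0 \<in> A" "\<And>x y. x \<in> A \<Longrightarrow> y \<in> A \<Longrightarrow> x + y \<in> A"
    "\<And>c x. x \<in> A \<Longrightarrow> 0 \<le> c \<Longrightarrow> c \<cdot> x \<in> A"
    and "x \<in> cone (A \<union> H)"
  shows "\<exists>c. (\<forall>g\<in>H. 0 \<le> c g) \<and> x - (\<Sum>g\<in>H. c g \<cdot> g) \<in> A"
  using assms(5)
proof induction
  case cone_zero
  show ?case
    by (rule exI[of _ "\<lambda>_. 0"]) (simp add: A)
next
  case (cone_step x g d)
  obtain c where c: "\<forall>g\<in>H. 0 \<le> c g" "x - (\<Sum>g\<in>H. c g \<cdot> g) \<in> A"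
    using cone_step by auto
  show ?case
  proof (cases "g \<in> H")
    case True
    let ?c = "\<lambda>h. c h + (if h = g then d else 0)"
    have "(\<Sum>h\<in>H. ?c h \<cdot> h) = (\<Sum>h\<in>H. c h \<cdot> h) + (\<Sum>h\<in>H. if h = g then d \<cdot> g else 0)"
      unfolding sum.distrib[symmetric] by (rule sum.cong) (auto simp: scale_add_left)
    also have "(\<Sum>h\<in>H. if h = g then d \<cdot> g else 0) = d \<cdot> g"
      using True assms(1) by (subst sum.delta) auto
    finally have eq: "x + d \<cdot> g - (\<Sum>h\<in>H. ?c h \<cdot> h) = x - (\<Sum>h\<in>H. c h \<cdot> h)"
      by simp
    have "\<forall>h\<in>H. 0 \<le> ?c h"
      using c cone_step by auto
    then show ?thesis
      using c(2) unfolding eq[symmetric] by (intro exI[of _ ?c]) (rule conjI)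
  next
    case False
    then have "d \<cdot> g + (x - (\<Sum>h\<in>H. c h \<cdot> h)) \<in> A"
      using c cone_step by (auto intro: A)
    then show ?thesis
      using c by (intro exI[of _ c]) (simp add: algebra_simps)
  qed
qed

lemma nonneg_cone_representation:
  assumes "state G \<mu>" "x \<in> nonneg_cone (V0 \<union> G) \<mu> p"
  shows "\<exists>c. (\<forall>g\<in>{g \<in> G. p \<notin> \<mu> (- g)}. 0 \<le> c g) \<and>
    x - (\<Sum>g | g \<in> G \<and> p \<notin> \<mu> (- g). c g \<cdot> g) \<in> V0 \<inter> nonneg_cone (V0 \<union> G) \<mu> p"
proof (rule cone_Un_representation)
  have "{w \<in> V0 \<union> G. p \<notin> \<mu> (- w)} \<subseteq> V0 \<inter> nonneg_cone (V0 \<union> G) \<mu> p \<union> {g \<in> G. p \<notin> \<mu> (- g)}"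
    by (auto simp: nonneg_cone_def intro: cone_base)
  then show "x \<in> cone (V0 \<inter> nonneg_cone (V0 \<union> G) \<mu> p \<union> {g \<in> G. p \<notin> \<mu> (- g)})"
    using assms(2) cone_mono unfolding nonneg_cone_def by blast
  show "finite {g \<in> G. p \<notin> \<mu> (- g)}"
    using stateD(1)[OF assms(1)] by simp
qed (auto intro: V0_zero V0_add V0_scale nonneg_cone_add nonneg_cone_scale cone_zero
    simp: nonneg_cone_def[of _ _ p] cone_add cone_scale)

text \<open>Linear independence in the quotient by \<open>V0\<close>.\<close>

definition independent :: "'v set \<Rightarrow> bool" where
  "independent H \<longleftrightarrow> (\<forall>d. (\<Sum>g\<in>H. d g \<cdot> g) \<in> V0 \<longrightarrow> (\<forall>g\<in>H. d g = 0))"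

lemma independent_unique:
  assumes "independent H" "x - (\<Sum>g\<in>H. c g \<cdot> g) \<in> V0" "x - (\<Sum>g\<in>H. d g \<cdot> g) \<in> V0" "g \<in> H"
  shows "c g = d g"
proof -
  have "(x - (\<Sum>g\<in>H. d g \<cdot> g)) - (x - (\<Sum>g\<in>H. c g \<cdot> g)) \<in> V0"
    by (rule V0_diff[OF assms(3,2)])
  then have "(\<Sum>g\<in>H. (c g - d g) \<cdot> g) \<in> V0"
    by (simp add: scale_diff_left sum_subtractf)
  from assms(1)[unfolded independent_def, rule_format, OF this assms(4)]
  show ?thesis by simp
qed

lemma nonneg_cone_sumI:
  assumes "state G \<mu>" "H \<subseteq> {g \<in> G. p \<notin> \<mu> (- g)}" "\<forall>g\<in>H. 0 \<le> c g"
  shows "(\<Sum>g\<in>H. c g \<cdot> g) \<in> nonneg_cone (V0 \<union> G) \<mu> p"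
  unfolding nonneg_cone_def using assms by (intro cone_sum cone_scale cone_base) auto

text \<open>A dependence among the generators can be given a sign that keeps the remainder in \<open>V0\<close>
  nonnegative at \<open>p\<close>, so that subtracting the right multiple of it kills a coefficient.\<close>

lemma nonneg_cone_basic_representation:
  assumes s: "state G \<mu>" and x: "x \<in> nonneg_cone (V0 \<union> G) \<mu> p"
  shows "\<exists>H c. H \<subseteq> {g \<in> G. p \<notin> \<mu> (- g)} \<and> independent H \<and> (\<forall>g\<in>H. 0 \<le> c g) \<and>
    x - (\<Sum>g\<in>H. c g \<cdot> g) \<in> V0 \<inter> nonneg_cone (V0 \<union> G) \<mu> p"
proof -
  let ?C = "nonneg_cone (V0 \<union> G) \<mu> p" and ?M = "{g \<in> G. p \<notin> \<mu> (- g)}"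
  have add: "\<And>x y. x \<in> ?C \<Longrightarrow> y \<in> ?C \<Longrightarrow> x + y \<in> ?C"
    and scl: "\<And>c x. x \<in> ?C \<Longrightarrow> 0 \<le> c \<Longrightarrow> c \<cdot> x \<in> ?C"
    by (simp_all add: nonneg_cone_def cone_add cone_scale)
  have MC: "g \<in> ?C" if "g \<in> ?M" for g
    using that by (auto simp: nonneg_cone_def intro: cone_base)
  have main: "\<exists>H c. H \<subseteq> ?M \<and> independent H \<and> (\<forall>g\<in>H. 0 \<le> c g) \<and> x - (\<Sum>g\<in>H. c g \<cdot> g) \<in> V0 \<inter> ?C"
    if "finite H" "H \<subseteq> ?M" "\<forall>g\<in>H. 0 \<le> c g" "x - (\<Sum>g\<in>H. c g \<cdot> g) \<in> V0 \<inter> ?C" for H c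
    using that
  \<comment> \<open>A dependent set of generators is traded for a proper subset, as in
    Caratheodory's theorem on cones.\<close>
  proof (induction H arbitrary: c rule: finite_psubset_induct)
    case (psubset H)
    show ?case
    proof (cases "independent H")
      case True
      then show ?thesis using psubset by blast
    next
      case False
      then obtain d0 where d0: "(\<Sum>g\<in>H. d0 g \<cdot> g) \<in> V0" "\<exists>g\<in>H. d0 g \<noteq> 0"
        by (auto simp: independent_def)
      have sumC: "(\<Sum>g\<in>H. d g \<cdot> g) \<in> ?C" if "\<forall>g\<in>H. 0 \<le> d g" for d
        using nonneg_cone_sumI[OF s psubset(3) that] .
      \<comment> \<open>Since \<open>\<mu> e\<close> and \<open>\<mu> (- e)\<close> are disjoint,
        each point totally preorders \<open>V0\<close>.\<close>
      have tot: "e \<in> ?C \<or> - e \<in> ?C" if "e \<in> V0" for e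
      proof -
        have "p \<notin> \<mu> (- e) \<or> p \<notin> \<mu> e"
          using stateD(6)[OF s, of e] that by blast
        then show ?thesis
          using stateD(7)[OF s, of e p] stateD(7)[OF s, of "- e" p] V0_minus[OF that] that by simp
      qed
      \<comment> \<open>The dependence \<open>d0\<close> or its negative has its sum in the cone. If
        the one that does has no positive coefficient, then the opposite combination is a
        nonnegative one, hence also in the cone, and has a positive coefficient.\<close>
      have "\<exists>d. (\<Sum>g\<in>H. d g \<cdot> g) \<in> V0 \<inter> ?C \<and> (\<exists>g\<in>H. 0 < d g)"
      proof -
        let ?e = "\<Sum>g\<in>H. d0 g \<cdot> g"
        have neg: "(\<Sum>g\<in>H. (- d0 g) \<cdot> g) = - ?e"
          by (simp add: sum_negf)
        have 1: "?e \<in> ?C" if "\<forall>g\<in>H. 0 \<le> d0 g"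
          using sumC that by simp
        have 2: "- ?e \<in> ?C" if "\<forall>g\<in>H. d0 g \<le> 0"
          using sumC[of "\<lambda>g. - d0 g"] that neg by simp
        consider "?e \<in> ?C" "\<exists>g\<in>H. 0 < d0 g" | "- ?e \<in> ?C" "\<exists>g\<in>H. 0 < - d0 g"
        proof (cases "?e \<in> ?C")
          case True
          show ?thesis
          proof (cases "\<exists>g\<in>H. 0 < d0 g")
            case False
            then have "- ?e \<in> ?C" "\<exists>g\<in>H. 0 < - d0 g"
              using 2 d0(2) by (metis not_less, metis neg_0_less_iff_less linorder_neqE)
            then show ?thesis using that(2) by blast
          qed (use True that(1) in blast)
        next
          case False
          then have "- ?e \<in> ?C" using tot[OF d0(1)] by blast
          moreover have "\<exists>g\<in>H. d0 g < 0" using False 1 by (metis not_less)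
          ultimately show ?thesis using that(2) by (metis neg_0_less_iff_less)
        qed
        then show ?thesis
        proof cases
          case 1
          then show ?thesis using d0 by (intro exI[of _ d0]) auto
        next
          case 2
          then show ?thesis using d0 neg V0_minus by (intro exI[of _ "\<lambda>g. - d0 g"]) auto
        qed
      qed
      then obtain d where d: "(\<Sum>g\<in>H. d g \<cdot> g) \<in> V0 \<inter> ?C" "\<exists>g\<in>H. 0 < d g"
        by blast
      let ?P = "{g \<in> H. 0 < d g}" and ?t = "\<lambda>g. c g * inverse (d g)"
      have P: "finite ?P" "?P \<noteq> {}" using d psubset by auto
      \<comment> \<open>The minimum ratio rule: \<open>t\<close> is the largest multiple of the
        dependence that can be subtracted with all coefficients staying nonnegative, and it
        annihilates the coefficient of \<open>g0\<close>.\<close>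
      define g0 where "g0 = arg_min_on ?t ?P"
      have g0: "g0 \<in> ?P" "\<And>g. g \<in> ?P \<Longrightarrow> ?t g0 \<le> ?t g"
        using arg_min_if_finite[OF P, of ?t] unfolding g0_def by (auto simp: not_less)
      define t where "t = ?t g0"
      have t0: "0 \<le> t"
        using g0 psubset inverse_pos[of "d g0"] unfolding t_def by (auto intro!: mult_nonneg_nonneg less_imp_le)
      let ?c = "\<lambda>g. c g - t * d g"
      have c_ge: "0 \<le> ?c g" if "g \<in> H" for g
      proof (cases "0 < d g")
        case True
        then have "t * d g \<le> ?t g * d g"
          using g0(2)[of g] that unfolding t_def by (intro mult_right_mono) auto
        then show ?thesis using True by (simp add: mult.assoc)
      next
        case False
        then have "t * d g \<le> 0" using t0 by (simp add: mult_nonneg_nonpos)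
        moreover have "0 \<le> c g" using psubset that by auto
        ultimately show ?thesis by (simp add: le_diff_eq order_trans)
      qed
      have c_g0: "?c g0 = 0"
        using g0(1) by (auto simp: t_def mult.assoc dest: less_imp_neq)
      have eq: "x - (\<Sum>g\<in>H. ?c g \<cdot> g) = (x - (\<Sum>g\<in>H. c g \<cdot> g)) + t \<cdot> (\<Sum>g\<in>H. d g \<cdot> g)"
        by (simp add: scale_diff_left sum_subtractf scale_sum scale_scale)
      then have "x - (\<Sum>g\<in>H. ?c g \<cdot> g) \<in> V0 \<inter> ?C"
        unfolding eq using psubset(5) d(1) t0 V0_add[OF _ V0_scale] add[OF _ scl] by simp
      moreover have "(\<Sum>g\<in>H. ?c g \<cdot> g) = (\<Sum>g\<in>H - {g0}. ?c g \<cdot> g)"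
        using sum.remove[OF psubset(1), of g0 "\<lambda>g. ?c g \<cdot> g"] g0(1) c_g0 by auto
      moreover have "H - {g0} \<subset> H" "H - {g0} \<subseteq> ?M" "\<forall>g\<in>H - {g0}. 0 \<le> ?c g"
        using g0(1) psubset(3) c_ge by auto
      ultimately show ?thesis
        using psubset.IH[of "H - {g0}" ?c] by simp
    qed
  qed
  have "finite ?M" using stateD(1)[OF s] by simp
  then show ?thesis
    using main[of ?M] nonneg_cone_representation[OF s x] by blast
qed

text \<open>Outside the cone generated by all decided vectors, the set below consists of all points, and \<open>Lat\<close> need
  not have a greatest element.\<close>

lemma not_nonneg_in_Lat:
  assumes s: "state G \<mu>" and x: "x \<in> cone (V0 \<union> G)"
  shows "{p. x \<notin> nonneg_cone (V0 \<union> G) \<mu> p} \<in> Lat"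
proof -
  define F where "F H c \<longleftrightarrow> (\<forall>g\<in>H. 0 \<le> c g) \<and> x - (\<Sum>g\<in>H. c g \<cdot> g) \<in> V0" for H and c :: "'v \<Rightarrow> 'k"
  define \<H> where "\<H> = {H. H \<subseteq> G \<and> (\<exists>c. F H c)}"
  \<comment> \<open>One choice of coefficients per \<open>H\<close> suffices: the sets
    \<open>H\<close> that matter are independent, and for those the coefficients are unique.\<close>
  define cc where "cc H = (SOME c. F H c)" for H
  define z where "z H = x - (\<Sum>g\<in>H. cc H g \<cdot> g)" for H
  have cc: "F H (cc H)" if "H \<in> \<H>" for H
    using that someI_ex[of "F H"] unfolding \<H>_def cc_def by auto
  then have zV: "z H \<in> V0" if "H \<in> \<H>" for H
    using that unfolding z_def F_def by auto
  have "\<exists>c. F G c"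
    unfolding F_def using stateD(1)[OF s] x
    by (intro cone_Un_representation) (auto intro: V0_zero V0_add V0_scale)
  then have fin: "finite \<H>" "\<H> \<noteq> {}"
    using stateD(1)[OF s] unfolding \<H>_def by auto
  \<comment> \<open>\<open>x\<close> is nonnegative at \<open>p\<close> exactly when, for some
    \<open>H\<close>, all elements of \<open>H\<close> and the remainder \<open>z H\<close> are;
    negating this gives a finite intersection of finite unions.\<close>
  have "{p. x \<notin> nonneg_cone (V0 \<union> G) \<mu> p} = (\<Inter>H\<in>\<H>. \<mu> (- z H) \<union> (\<Union>g\<in>H. \<mu> (- g)))" (is "?l = ?r")
  proof (intro equalityI subsetI)
    fix p assume p: "p \<in> ?l"
    show "p \<in> ?r"
    proof (rule ccontr)
      assume "p \<notin> ?r"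
      then obtain H where H: "H \<in> \<H>" "p \<notin> \<mu> (- z H)" "\<forall>g\<in>H. p \<notin> \<mu> (- g)" by auto
      have "z H \<in> nonneg_cone (V0 \<union> G) \<mu> p"
        using H(2) zV[OF H(1)] stateD(7)[OF s] by auto
      moreover have "(\<Sum>g\<in>H. cc H g \<cdot> g) \<in> nonneg_cone (V0 \<union> G) \<mu> p"
        using H cc[OF H(1)] by (intro nonneg_cone_sumI[OF s]) (auto simp: \<H>_def F_def)
      ultimately have "z H + (\<Sum>g\<in>H. cc H g \<cdot> g) \<in> nonneg_cone (V0 \<union> G) \<mu> p"
        by (rule nonneg_cone_add)
      then show False using p by (simp add: z_def)
    qed
  next
    fix p assume p: "p \<in> ?r"
    show "p \<in> ?l"
    proof (rule ccontr)
      assume "p \<notin> ?l"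
      then have "x \<in> nonneg_cone (V0 \<union> G) \<mu> p" by simp
      from nonneg_cone_basic_representation[OF s this] obtain H c where
        H: "H \<subseteq> {g \<in> G. p \<notin> \<mu> (- g)}" "independent H" "\<forall>g\<in>H. 0 \<le> c g"
          "x - (\<Sum>g\<in>H. c g \<cdot> g) \<in> V0 \<inter> nonneg_cone (V0 \<union> G) \<mu> p" by blast
      have HH: "H \<in> \<H>" using H unfolding \<H>_def F_def by blast
      have "c g = cc H g" if "g \<in> H" for g
        using independent_unique[OF H(2) _ _ that, of x c "cc H"] H(4) zV[OF HH] by (simp add: z_def)
      then have "z H = x - (\<Sum>g\<in>H. c g \<cdot> g)"
        unfolding z_def by (simp cong: sum.cong)
      then have "p \<notin> \<mu> (- z H)"
        using H(4) stateD(7)[OF s, of "z H" p] by auto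
      then show False using p HH H(1) by auto
    qed
  qed
  also have "\<dots> \<in> Lat"
  proof (intro Lat_INT fin Lat_Un Lat_UN)
    fix H assume H: "H \<in> \<H>"
    show "\<mu> (- z H) \<in> Lat" using zV[OF H] V0_minus stateD(3)[OF s] by auto
    show "finite H" using H stateD(1)[OF s] finite_subset by (auto simp: \<H>_def)
    show "\<mu> (- g) \<in> Lat" if "g \<in> H" for g
      using that H stateD(3)[OF s, of "- g"] stateD(5)[OF s, of g] by (auto simp: \<H>_def)
  qed
  finally show ?thesis .
qed

section \<open>Deciding a vector and adjoining fresh vectors\<close>

lemma decide:
  assumes s: "state G \<mu>"
  shows "\<exists>G' \<mu>'. state G' \<mu>' \<and> extends (G, \<mu>) (G', \<mu>') \<and> v \<in> V0 \<union> G'"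
proof (cases "v \<in> V0 \<union> G")
  case True
  then show ?thesis using s by (intro exI[of _ G] exI[of _ \<mu>]) (simp add: extends_def)
next
  case False
  let ?C = "nonneg_cone (V0 \<union> G) \<mu>"
  have neg: "- x \<in> cone (V0 \<union> G)" if "x \<in> cone (V0 \<union> G)" for x
    using that
  proof induction
    case (cone_step x g c)
    then have "- x + c \<cdot> (- g) \<in> cone (V0 \<union> G)"
      using stateD(5)[OF s] by (intro cone.cone_step)
    then show ?case by simp
  qed (simp add: cone.cone_zero)
  \<comment> \<open>On \<open>?N'\<close> nothing forces \<open>- v\<close> to be nonnegative, so
    \<open>v\<close> may be positive there, and dually on \<open>?N\<close>. The last two inclusions
    below say that outside \<open>q \<union> r\<close> both signs of \<open>v\<close> are known to
    be nonnegative or neither is.\<close>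
  let ?N = "{p. v \<notin> ?C p}" and ?N' = "{p. - v \<notin> ?C p}"
  have "\<exists>q\<in>Lat. \<exists>r\<in>Lat. q \<inter> r = {} \<and> q \<subseteq> ?N' \<and> r \<subseteq> ?N \<and> ?N' \<subseteq> ?N \<union> q \<and> ?N \<subseteq> ?N' \<union> r"
  proof (cases "v \<in> cone (V0 \<union> G)")
    case True
    then have N: "?N \<in> Lat" "?N' \<in> Lat"
      using not_nonneg_in_Lat[OF s] neg by auto
    from Lat_normal[OF this] obtain X Y where XY: "X \<in> Lat" "Y \<in> Lat"
      "?N \<union> ?N' = ?N \<union> Y" "?N \<union> ?N' = X \<union> ?N'" "X \<inter> Y = {}" by auto
    \<comment> \<open>Normality yields disjoint \<open>X\<close> and \<open>Y\<close>; cutting them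
      down to \<open>?N\<close> and \<open>?N'\<close> makes the prescribed signs admissible and
      keeps the covering inclusions.\<close>
    show ?thesis
    proof (rule bexI[of _ "Y \<inter> ?N'"], rule bexI[of _ "X \<inter> ?N"], intro conjI)
      show "Y \<inter> ?N' \<in> Lat" "X \<inter> ?N \<in> Lat" using XY N by (auto intro: Lat_Int)
      show "?N' \<subseteq> ?N \<union> Y \<inter> ?N'" using XY(3) by blast
      show "?N \<subseteq> ?N' \<union> X \<inter> ?N" using XY(4) by blast
    qed (use XY(5) in auto)
  next
    case False
    \<comment> \<open>Here \<open>v\<close> lies outside the span of the decided vectors: both sets
      are everything, no sign is known at any point, and \<open>q = r = {}\<close> is
      admissible.\<close>
    have "?C p \<subseteq> cone (V0 \<union> G)" for p
      unfolding nonneg_cone_def by (rule cone_mono) auto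
    then have "v \<notin> ?C p" "- v \<notin> ?C p" for p
      using False neg[of "- v"] by auto
    then have "?N = UNIV" "?N' = UNIV" by auto
    then show ?thesis using Lat_empty by auto
  qed
  then obtain q r where qr: "q \<in> Lat" "r \<in> Lat" "q \<inter> r = {}" "q \<subseteq> ?N'" "r \<subseteq> ?N"
    "?N' \<subseteq> ?N \<union> q" "?N \<subseteq> ?N' \<union> r" by blast
  have "p \<in> q \<Longrightarrow> - v \<notin> ?C p" "p \<in> r \<Longrightarrow> v \<notin> ?C p"
    "p \<notin> q \<Longrightarrow> p \<notin> r \<Longrightarrow> v \<in> ?C p \<longleftrightarrow> - v \<in> ?C p" for p
    using qr(4-7) by blast+
  note state_insert[OF s False qr(1-3) this]
  then show ?thesis by blast
qed

text \<open>The functional vanishes on every cone but not at \<open>t\<close>, so neither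
  \<open>t\<close> nor \<open>- t\<close> is known to be nonnegative anywhere. Hence
  \<open>t\<close> can be made positive on any prescribed \<open>q\<close> and zero
  elsewhere.\<close>

lemma insert_fresh:
  assumes s: "state G \<mu>" and q: "q \<in> Lat"
  shows "\<exists>t f. functional f \<and> f t = 1 \<and> (\<forall>x\<in>V0 \<union> G. f x = 0) \<and>
    state (insert t (insert (- t) G)) (\<mu>(t := q, - t := {})) \<and>
    extends (G, \<mu>) (insert t (insert (- t) G), \<mu>(t := q, - t := {}))"
proof -
  obtain t f where f: "functional f" "f t = 1" "\<forall>x\<in>V0 \<union> G. f x = 0"
    using fresh[OF stateD(1)[OF s]] by blast
  have C: "f x = 0" if "x \<in> nonneg_cone (V0 \<union> G) \<mu> p" for x p
    by (rule functional_cone_zero[OF f(1) _ that[unfolded nonneg_cone_def]]) (use f(3) in simp)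
  have t: "t \<notin> V0 \<union> G" "\<And>p. t \<notin> nonneg_cone (V0 \<union> G) \<mu> p" "\<And>p. - t \<notin> nonneg_cone (V0 \<union> G) \<mu> p"
    using f(2) f(3) C[of t] C[of "- t"] functional_simps(4)[OF f(1), of t] by force+
  have "state (insert t (insert (- t) G)) (\<mu>(t := q, - t := {}))"
    "extends (G, \<mu>) (insert t (insert (- t) G), \<mu>(t := q, - t := {}))"
    by (rule state_insert[OF s t(1) q Lat_empty]; use t in blast)+
  then show ?thesis
    using f by blast
qed

lemma realize:
  assumes s: "state G \<mu>" and q: "q \<in> Lat"
  shows "\<exists>G' \<mu>'. state G' \<mu>' \<and> extends (G, \<mu>) (G', \<mu>') \<and>
    (\<exists>t\<in>G'. - t \<in> G' \<and> \<mu>' t = q \<and> \<mu>' (- t) = {})"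
proof -
  obtain t f where f: "functional f" "f t = 1"
    and s': "state (insert t (insert (- t) G)) (\<mu>(t := q, - t := {}))"
    and e: "extends (G, \<mu>) (insert t (insert (- t) G), \<mu>(t := q, - t := {}))"
    using insert_fresh[OF assms] by blast
  have "t \<noteq> 0"
    using f functional_simps(3)[OF f(1)] by auto
  then have "t \<noteq> - t"
    by (rule neq_uminus)
  then have u: "\<exists>u\<in>insert t (insert (- t) G). - u \<in> insert t (insert (- t) G) \<and>
      (\<mu>(t := q, - t := {})) u = q \<and> (\<mu>(t := q, - t := {})) (- u) = {}"
    by auto
  show ?thesis
    by (rule exI, rule exI, rule conjI[OF s' conjI[OF e u]])
qed

lemma extends_trans: "extends r s \<Longrightarrow> extends s t \<Longrightarrow> extends r t"
  unfolding extends_def by auto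

text \<open>Adjoin a fresh \<open>t\<close> that is positive on \<open>\<mu> x\<close> and zero
  elsewhere, then decide \<open>t - x\<close> so that \<open>t\<close> equals \<open>x\<close>
  wherever \<open>x\<close> is positive. The conclusion says that \<open>t\<close> is above
  \<open>0\<close> and \<open>x\<close> and at no point strictly above both.\<close>

lemma positive_part:
  assumes s: "state G \<mu>" and x: "x \<in> V0 \<union> G"
  shows "\<exists>G' \<mu>'. state G' \<mu>' \<and> extends (G, \<mu>) (G', \<mu>') \<and>
    (\<exists>t. {t, - t, x - t, t - x} \<subseteq> V0 \<union> G' \<and> \<mu>' (- t) = {} \<and> \<mu>' (x - t) = {} \<and> \<mu>' t \<inter> \<mu>' (t - x) = {})"
proof (cases "x = 0")
  \<comment> \<open>For \<open>x = 0\<close> the vector \<open>t - x\<close> would be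
    \<open>t\<close> itself, already decided; but \<open>0\<close> is its own positive part.\<close>
  case True
  have "\<mu> 0 = {}" using stateD(6)[OF s, of 0] V0_zero by simp
  then show ?thesis
    using True V0_zero s by (intro exI[of _ G] exI[of _ \<mu>]) (auto simp: extends_def intro!: exI[of _ 0])
next
  case False
  obtain t f where f: "functional f" "f t = 1" and f0: "\<forall>x\<in>V0 \<union> G. f x = 0"
    and s1: "state (insert t (insert (- t) G)) (\<mu>(t := \<mu> x, - t := {}))"
    and e1: "extends (G, \<mu>) (insert t (insert (- t) G), \<mu>(t := \<mu> x, - t := {}))"
    using insert_fresh[OF s stateD(3)[OF s x]] by blast
  note fs = functional_simps[OF f(1)]
  have fx: "f x = 0" using f0 x by blast
  define G1 where "G1 = insert t (insert (- t) G)"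
  define \<mu>1 where "\<mu>1 = \<mu>(t := \<mu> x, - t := {})"
  have tD: "t \<notin> V0 \<union> G" using f(2) f0 by force
  have t0: "t \<noteq> 0" using tD V0_zero by auto
  have tt: "t \<noteq> - t" using neq_uminus[OF t0] .
  have v: "t - x \<notin> V0 \<union> G1"
  proof
    assume "t - x \<in> V0 \<union> G1"
    then consider "t - x \<in> V0 \<union> G" | "t - x = t" | "t - x = - t" by (auto simp: G1_def)
    then show False
    proof cases
      case 1
      then show False using f(2) f0 fx 1 fs(5)[of t x] by simp
    next
      case 2
      then show False using False by simp
    next
      case 3
      then have "f (t - x) = f (- t)" by simp
      then have "(1::'k) = - 1" using f(2) fx by (simp add: fs)
      then show False using one_pos[where ?'k='k] by (metis neg_less_0_iff_less order_less_asym)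
    qed
  qed
  have C1: "nonneg_cone (V0 \<union> G1) \<mu>1 p =
    cone ((if p \<in> \<mu> x then {} else {- t}) \<union> {t} \<union> {w \<in> V0 \<union> G. p \<notin> \<mu> (- w)})" for p
    using nonneg_cone_insert[OF stateD(2)[OF s] tD, of "\<mu> x" "{}" p]
    unfolding G1_def \<mu>1_def by (simp add: Un_commute)
  let ?C = "nonneg_cone (V0 \<union> G) \<mu>" and ?C1 = "nonneg_cone (V0 \<union> G1) \<mu>1"
  have fC: "f y = 0" if "y \<in> ?C p" for y p
    by (rule functional_cone_zero[OF f(1) _ that[unfolded nonneg_cone_def]]) (use f0 in simp)
  \<comment> \<open>The functional compares the coefficients of \<open>t\<close>: in
    \<open>t - x = m + d \<cdot> t\<close> it forces \<open>d = 1\<close>, hence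
    \<open>- x = m\<close>, against positivity of \<open>x\<close>; for \<open>x - t\<close> it
    forces \<open>d = - 1\<close>, which is negative. So \<open>t = x\<close> may be imposed at
    \<open>p\<close>.\<close>
  have pos: "t - x \<notin> ?C1 p \<and> x - t \<notin> ?C1 p" if p: "p \<in> \<mu> x" for p
  proof -
    have nx: "- x \<notin> ?C p" using stateD(7)[OF s, of "- x" p] stateD(5)[OF s x] p by simp
    have C: "?C1 p = cone (insert t {w \<in> V0 \<union> G. p \<notin> \<mu> (- w)})"
      using C1[of p] p by simp
    have R: "\<exists>m d. m \<in> ?C p \<and> 0 \<le> d \<and> y = m + d \<cdot> t" if "y \<in> ?C1 p" for y
      using that unfolding C by (elim cone_insertE) (auto simp: nonneg_cone_def)
    have "t - x \<notin> ?C1 p"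
    proof
      assume "t - x \<in> ?C1 p"
      from R[OF this] obtain m d where m: "m \<in> ?C p" "0 \<le> d" "t - x = m + d \<cdot> t" by blast
      have "f (t - x) = f (m + d \<cdot> t)" using m by simp
      then have "d = 1" using f(2) fx fC[OF m(1)] by (simp add: fs)
      then show False using m nx by simp
    qed
    moreover have "x - t \<notin> ?C1 p"
    proof
      assume "x - t \<in> ?C1 p"
      from R[OF this] obtain m d where m: "m \<in> ?C p" "0 \<le> d" "x - t = m + d \<cdot> t" by blast
      have "f (x - t) = f (m + d \<cdot> t)" using m by simp
      then have "d = - 1" using f(2) fx fC[OF m(1)] by (simp add: fs)
      then show False using m one_pos[where ?'k='k] by simp
    qed
    ultimately show ?thesis ..
  qed
  \<comment> \<open>Here \<open>t\<close> is zero at \<open>p\<close>, so \<open>t - x\<close> has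
    the sign of \<open>- x\<close>; that membership of \<open>x - t\<close> forces that of
    \<open>x\<close> is again seen by applying \<open>f\<close>.\<close>
  have npos: "(t - x \<in> ?C1 p) \<and> (x - t \<in> ?C1 p \<longleftrightarrow> p \<notin> \<mu> (- x))" if p: "p \<notin> \<mu> x" for p
  proof -
    have C: "?C1 p = cone (insert (- t) (insert t {w \<in> V0 \<union> G. p \<notin> \<mu> (- w)}))"
      using C1[of p] p by (simp add: insert_commute)
    have sub: "y \<in> ?C1 p" if "y \<in> ?C p" for y
      using that unfolding C unfolding nonneg_cone_def by (rule subsetD[OF cone_mono, rotated]) auto
    have ts: "t \<in> ?C1 p" "- t \<in> ?C1 p"
      unfolding C by (auto intro: cone_base)
    have "- x \<in> ?C p" using stateD(7)[OF s, of "- x" p] stateD(5)[OF s x] p by simp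
    then have "t + (- x) \<in> ?C1 p" by (intro nonneg_cone_add ts sub)
    moreover have "x - t \<in> ?C1 p" if "p \<notin> \<mu> (- x)"
    proof -
      have "x \<in> ?C p" using stateD(7)[OF s x] that by simp
      then have "x + (- t) \<in> ?C1 p" by (intro nonneg_cone_add ts sub)
      then show ?thesis by simp
    qed
    moreover have "p \<notin> \<mu> (- x)" if "x - t \<in> ?C1 p"
    proof -
      from that[unfolded C] obtain m' d' where m': "m' \<in> cone (insert t {w \<in> V0 \<union> G. p \<notin> \<mu> (- w)})"
        "0 \<le> d'" "x - t = m' + d' \<cdot> (- t)"
        by (rule cone_insertE)
      from m'(1) obtain m d where mS: "m \<in> cone {w \<in> V0 \<union> G. p \<notin> \<mu> (- w)}" "0 \<le> d" "m' = m + d \<cdot> t"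
        by (rule cone_insertE)
      have m: "m \<in> ?C p" using mS(1) by (simp add: nonneg_cone_def)
      have eq: "x - t = m + (d - d') \<cdot> t" using mS(3) m'(3) by (simp add: scale_diff_left)
      then have "f (x - t) = f (m + (d - d') \<cdot> t)" by simp
      then have "d - d' = - 1" using f(2) fx fC[OF m] by (simp add: fs)
      then have "x = m" using eq by simp
      then show ?thesis using m stateD(7)[OF s x] by simp
    qed
    ultimately show ?thesis by auto
  qed
  \<comment> \<open>Accordingly \<open>t - x\<close> is made positive exactly where \<open>x\<close>
    is negative, and zero elsewhere.\<close>
  let ?q = "\<mu> (- x)"
  have dis: "p \<in> \<mu> (- x) \<Longrightarrow> p \<notin> \<mu> x" for p
    using stateD(6)[OF s x] by auto
  have q1: "p \<in> ?q \<Longrightarrow> - (t - x) \<notin> ?C1 p" for p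
    using npos[of p] dis[of p] by simp
  have q2: "p \<notin> ?q \<Longrightarrow> p \<notin> {} \<Longrightarrow> t - x \<in> ?C1 p \<longleftrightarrow> - (t - x) \<in> ?C1 p" for p
    using npos[of p] pos[of p] by (cases "p \<in> \<mu> x") simp_all
  note s2 = state_insert[OF s1[folded G1_def \<mu>1_def] v _ Lat_empty _ q1 _ q2]
  let ?G2 = "insert (t - x) (insert (- (t - x)) G1)" and ?\<mu>2 = "\<mu>1(t - x := ?q, - (t - x) := {})"
  have qL: "?q \<in> Lat" using stateD(3)[OF s] stateD(5)[OF s x] by blast
  have s2: "state ?G2 ?\<mu>2" "extends (G1, \<mu>1) (?G2, ?\<mu>2)"
    by (rule s2; use qL in simp)+
  have vv: "t - x \<noteq> - (t - x)" by (rule neq_uminus) (use v V0_zero in auto)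
  have "\<mu>1 t = \<mu> x" "\<mu>1 (- t) = {}" using tt by (auto simp: \<mu>1_def)
  then have t2: "?\<mu>2 t = \<mu> x" "?\<mu>2 (- t) = {}"
    using s2(2) by (auto simp: extends_def G1_def simp del: fun_upd_apply)
  have v2: "?\<mu>2 (t - x) = ?q" "?\<mu>2 (x - t) = {}"
    using vv by auto
  show ?thesis
  proof (intro exI conjI)
    show "state ?G2 ?\<mu>2" by (rule s2)
    show "extends (G, \<mu>) (?G2, ?\<mu>2)"
      using extends_trans[OF e1[folded G1_def \<mu>1_def] s2(2)] .
    show "{t, - t, x - t, t - x} \<subseteq> V0 \<union> ?G2" by (auto simp: G1_def)
    show "?\<mu>2 (- t) = {}" "?\<mu>2 (x - t) = {}" by (rule t2 v2)+
    show "?\<mu>2 t \<inter> ?\<mu>2 (t - x) = {}"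
      unfolding t2 v2 using dis by auto
  qed
qed

section \<open>Bounding one nonnegative vector by a multiple of another\<close>

lemma sum_scale_minus: "(\<Sum>g\<in>H. (c g - a * d g) \<cdot> g) = (\<Sum>g\<in>H. c g \<cdot> g) - a \<cdot> (\<Sum>g\<in>H. d g \<cdot> g)"
  by (simp add: scale_diff_left sum_subtractf scale_sum scale_scale)

text \<open>If \<open>e\<close> is unbounded among the representations below, uniqueness of the coefficients yields
  \<open>b = b0 + \<Sum> \<beta> g \<cdot> g\<close> with \<open>\<beta> \<le> 0\<close>, and the remainder in \<open>V0\<close> is \<open>z1 - (e - e1) \<cdot> b0\<close>; closedness
  shows that \<open>z1 \<le> N \<cdot> b0\<close> wherever all generators in \<open>H\<close> are nonnegative.\<close>

lemma independent_bound:
  assumes s: "state G \<mu>" and H: "H \<subseteq> G" "independent H"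
    and a: "a \<in> V0 \<union> G" and b: "b \<in> V0 \<union> G" "\<mu> (- b) = {}" and ab: "\<mu> a \<subseteq> \<mu> b"
  shows "\<exists>\<Lambda>\<ge>0. \<forall>e\<ge>\<Lambda>. \<forall>p\<in>\<mu> b. \<forall>c. (\<forall>g\<in>H. p \<notin> \<mu> (- g) \<and> 0 \<le> c g) \<longrightarrow>
    a - e \<cdot> b - (\<Sum>g\<in>H. c g \<cdot> g) \<notin> V0 \<inter> nonneg_cone (V0 \<union> G) \<mu> p"
proof -
  let ?C = "nonneg_cone (V0 \<union> G) \<mu>"
  define lc where "lc c = (\<Sum>g\<in>H. c g \<cdot> g)" for c :: "'v \<Rightarrow> 'k"
  define F where "F e c \<longleftrightarrow> (\<forall>g\<in>H. 0 \<le> c g) \<and> a - e \<cdot> b - lc c \<in> V0" for e c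
  have lc_minus: "lc (\<lambda>g. c g - e * d g) = lc c - e \<cdot> lc d" for c d e
    unfolding lc_def by (rule sum_scale_minus)
  show ?thesis
  \<comment> \<open>If from some \<open>e\<close> on no representation with nonnegative coefficients
    exists, that \<open>e\<close> is the bound; otherwise they exist for arbitrarily large
    \<open>e\<close>.\<close>
  proof (cases "\<exists>\<Lambda>\<ge>0. \<forall>e\<ge>\<Lambda>. \<not> (\<exists>c. F e c)")
    case True
    then obtain \<Lambda> where "0 \<le> \<Lambda>" "\<forall>e\<ge>\<Lambda>. \<not> (\<exists>c. F e c)" by blast
    then show ?thesis unfolding F_def lc_def by blast
  next
    case False
    then have unb: "\<exists>e\<ge>\<Lambda>. \<exists>c. F e c" if "0 \<le> \<Lambda>" for \<Lambda>
      using that by blast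
    obtain e1 c1 where e1: "0 \<le> e1" "F e1 c1" using unb[of 0] by auto
    \<comment> \<open>The gap of \<open>1\<close> between \<open>e1\<close> and \<open>e2\<close>
      guarantees \<open>d > 0\<close> below.\<close>
    have "0 \<le> e1 + 1" using e1 one_pos[where ?'k='k] by (simp add: less_imp_le)
    then obtain e2 c2 where e2: "e1 + 1 \<le> e2" "F e2 c2" using unb[of "e1 + 1"] by auto
    define d where "d = e2 - e1"
    have d: "0 < d" using e2(1) one_pos[where ?'k='k] unfolding d_def
      by (metis add_le_same_cancel1 diff_gt_0_iff_gt le_less_trans less_le_not_le linorder_le_less_linear order_trans)
    define z1 where "z1 = a - e1 \<cdot> b - lc c1"
    define z2 where "z2 = a - e2 \<cdot> b - lc c2"
    have z: "z1 \<in> V0" "z2 \<in> V0" using e1 e2 by (auto simp: F_def z1_def z2_def)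
    \<comment> \<open>Subtracting the two representations gives
      \<open>d \<cdot> b = (z1 - z2) + (lc c1 - lc c2)\<close>; dividing by \<open>d\<close>
      expresses \<open>b\<close> through a vector \<open>b0\<close> of \<open>V0\<close> and the
      elements of \<open>H\<close>.\<close>
    define b0 where "b0 = inverse d \<cdot> (z1 - z2)"
    define \<beta> where "\<beta> g = inverse d * (c1 g - c2 g)" for g
    have b0: "b0 \<in> V0" unfolding b0_def using z by (intro V0_scale V0_diff)
    have "lc \<beta> = inverse d \<cdot> (lc c1 - lc c2)"
      unfolding lc_def \<beta>_def sum_subtractf[symmetric] scale_diff_left[symmetric] scale_sum scale_scale ..
    moreover have "d \<cdot> b = (z1 - z2) + (lc c1 - lc c2)"
      unfolding z1_def z2_def d_def by (simp add: scale_diff_left)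
    then have "inverse d \<cdot> d \<cdot> b = b0 + inverse d \<cdot> (lc c1 - lc c2)"
      unfolding b0_def scale_add_right[symmetric] by simp
    ultimately have beq: "b = b0 + lc \<beta>"
      using d by (simp add: inverse_scale)
    \<comment> \<open>This representation for an arbitrary \<open>e\<close> is affine in
      \<open>e\<close>; the next step shows that its coefficients are the only possible
      ones.\<close>
    have rel: "a - e \<cdot> b - lc (\<lambda>g. c1 g - (e - e1) * \<beta> g) = z1 - (e - e1) \<cdot> b0" for e
    proof -
      have "e \<cdot> b = e1 \<cdot> b + (e - e1) \<cdot> (b0 + lc \<beta>)"
        unfolding beq[symmetric] by (simp add: scale_diff_left)
      then show ?thesis
        unfolding lc_minus z1_def by (simp add: scale_add_right algebra_simps)
    qed
    have uniq: "c g = c1 g - (e - e1) * \<beta> g" if "a - e \<cdot> b - lc c \<in> V0" "g \<in> H" for e c g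
    proof -
      have "a - e \<cdot> b - lc (\<lambda>g. c1 g - (e - e1) * \<beta> g) \<in> V0"
        unfolding rel using z b0 by (intro V0_diff V0_scale)
      then show ?thesis
        using independent_unique[OF H(2) _ _ that(2), of "a - e \<cdot> b" c "\<lambda>g. c1 g - (e - e1) * \<beta> g"] that(1)
        unfolding lc_def by blast
    qed
    \<comment> \<open>A positive \<open>\<beta> g\<close> would make the coefficient of
      \<open>g\<close> negative once \<open>e - e1\<close> exceeds
      \<open>c1 g * inverse (\<beta> g)\<close>; the summand \<open>1\<close> in \<open>?m\<close>
      makes this strict.\<close>
    have \<beta>: "\<beta> g \<le> 0" if g: "g \<in> H" for g
    proof (rule ccontr)
      assume "\<not> \<beta> g \<le> 0"
      then have pos: "0 < \<beta> g" by simp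
      let ?m = "c1 g * inverse (\<beta> g) + 1"
      have c1: "0 \<le> c1 g" using e1 g by (simp add: F_def)
      have "0 \<le> c1 g * inverse (\<beta> g)"
        using c1 inverse_pos[OF pos] by (simp add: mult_nonneg_nonneg less_imp_le)
      then have "0 \<le> e1 + ?m" using e1(1) one_pos[where ?'k='k]
        by (intro add_nonneg_nonneg) (auto simp: less_imp_le)
      then obtain e c where e: "e1 + ?m \<le> e" "F e c" using unb by blast
      have "c1 g < ?m * \<beta> g"
        using pos by (simp add: distrib_right mult.assoc less_imp_neq[symmetric])
      also have "\<dots> \<le> (e - e1) * \<beta> g"
        using pos e(1) by (intro mult_right_mono) (simp_all add: le_diff_eq add.commute)
      finally have "c1 g - (e - e1) * \<beta> g < 0" by simp
      moreover have "c g = c1 g - (e - e1) * \<beta> g" using uniq[OF _ g] e(2) by (simp add: F_def)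
      ultimately show False using e(2) g by (auto simp: F_def)
    qed
    let ?X = "\<Union>g\<in>H. \<mu> (- g)"
    have X: "?X \<in> Lat"
    proof (rule Lat_UN)
      show "finite H" using H(1) stateD(1)[OF s] finite_subset by blast
      show "\<mu> (- g) \<in> Lat" if "g \<in> H" for g
        using that H(1) stateD(3)[OF s, of "- g"] stateD(5)[OF s, of g] by blast
    qed
    have HM: "H \<subseteq> {g \<in> G. p \<notin> \<mu> (- g)}" if "p \<notin> ?X" for p
      using that H(1) by blast
    have bC: "b \<in> ?C p" for p
      using stateD(7)[OF s b(1)] b(2) by simp
    \<comment> \<open>Since \<open>\<beta>\<close> is nonpositive, \<open>b0\<close> is
      \<open>b\<close> plus a nonnegative combination of \<open>H\<close>, so it is positive
      wherever \<open>b\<close> is positive and \<open>H\<close> is nonnegative.\<close>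
    have b0pos: "- b0 \<notin> ?C p" if "p \<in> \<mu> b" "p \<notin> ?X" for p
    proof
      assume "- b0 \<in> ?C p"
      moreover have "lc (\<lambda>g. - \<beta> g) \<in> ?C p"
        unfolding lc_def using \<beta> by (intro nonneg_cone_sumI[OF s HM[OF that(2)]]) simp
      ultimately have "- b0 + lc (\<lambda>g. - \<beta> g) \<in> ?C p" by (rule nonneg_cone_add)
      moreover have "lc (\<lambda>g. - \<beta> g) = - lc \<beta>"
        unfolding lc_def by (simp add: sum_negf)
      ultimately have "- b \<in> ?C p" unfolding beq by simp
      then show False using stateD(7)[OF s stateD(5)[OF s b(1)]] that(1) by simp
    qed
    have b0V: "p \<in> \<mu>0 b0" if "p \<in> \<mu> b" "p \<notin> ?X" for p
      using b0pos[OF that] stateD(7)[OF s, of "- b0" p] stateD(4)[OF s b0] V0_minus[OF b0] by auto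
    \<comment> \<open>Off \<open>?X\<close>, where \<open>b0\<close> is not positive neither is
      \<open>b\<close>, hence neither is \<open>a\<close>, and \<open>z1\<close> arises from
      \<open>a\<close> by subtracting nonnegative vectors.\<close>
    have "\<mu>0 z1 \<subseteq> \<mu>0 b0 \<union> ?X"
    proof
      fix p assume p: "p \<in> \<mu>0 z1"
      show "p \<in> \<mu>0 b0 \<union> ?X"
      proof (rule ccontr)
        assume n: "p \<notin> \<mu>0 b0 \<union> ?X"
        then have "p \<notin> \<mu> b" using b0V by blast
        then have "p \<notin> \<mu> a" using ab by blast
        then have "- a \<in> ?C p" using stateD(7)[OF s stateD(5)[OF s a], of p] by simp
        moreover have "lc c1 \<in> ?C p"
          unfolding lc_def using e1(2) n by (intro nonneg_cone_sumI[OF s HM]) (auto simp: F_def)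
        ultimately have "- a + (e1 \<cdot> b + lc c1) \<in> ?C p"
          using bC e1(1) by (intro nonneg_cone_add nonneg_cone_scale)
        then have "- z1 \<in> ?C p" unfolding z1_def by (simp add: algebra_simps)
        then show False
          using stateD(7)[OF s, of "- z1" p] stateD(4)[OF s z(1)] V0_minus[OF z(1)] p by simp
      qed
    qed
    then obtain N where N: "0 \<le> N" "\<mu>0 (z1 - N \<cdot> b0) \<inter> \<mu>0 b0 \<subseteq> ?X"
      using \<mu>0_closed[OF z(1) b0 X] by blast
    show ?thesis
    \<comment> \<open>For \<open>e\<close> beyond this bound, \<open>N \<cdot> b0 - z1\<close> and
      the assumed \<open>z1 - (e - e1) \<cdot> b0\<close> would add up to a strictly negative
      multiple of \<open>b0\<close> in the cone.\<close>
    proof (intro exI[of _ "e1 + N + 1"] conjI allI ballI impI)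
      show "0 \<le> e1 + N + 1"
        using e1(1) N(1) one_pos[where ?'k='k] by (intro add_nonneg_nonneg) (auto simp: less_imp_le)
      fix e :: 'k and p and c :: "'v \<Rightarrow> 'k"
      assume e: "e1 + N + 1 \<le> e" and p: "p \<in> \<mu> b" and c: "\<forall>g\<in>H. p \<notin> \<mu> (- g) \<and> 0 \<le> c g"
      show "a - e \<cdot> b - (\<Sum>g\<in>H. c g \<cdot> g) \<notin> V0 \<inter> ?C p"
      proof
        assume "a - e \<cdot> b - (\<Sum>g\<in>H. c g \<cdot> g) \<in> V0 \<inter> ?C p"
        then have w: "a - e \<cdot> b - lc c \<in> V0" "a - e \<cdot> b - lc c \<in> ?C p" by (simp_all add: lc_def)
        have "lc c = lc (\<lambda>g. c1 g - (e - e1) * \<beta> g)"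
          unfolding lc_def by (rule sum.cong) (auto simp: uniq[OF w(1)])
        then have zC: "z1 - (e - e1) \<cdot> b0 \<in> ?C p" using w(2) rel[of e] by simp
        have pX: "p \<notin> ?X" using c by auto
        have "p \<notin> \<mu>0 (z1 - N \<cdot> b0)" using N(2) b0V[OF p pX] pX by blast
        moreover have V: "z1 - N \<cdot> b0 \<in> V0" "- (z1 - N \<cdot> b0) \<in> V0"
          using z b0 by (auto intro: V0_diff V0_scale V0_minus)
        ultimately have "- (z1 - N \<cdot> b0) \<in> ?C p"
          using stateD(7)[OF s, of "- (z1 - N \<cdot> b0)" p] stateD(4)[OF s V(1)] by simp
        then have "- (z1 - N \<cdot> b0) + (z1 - (e - e1) \<cdot> b0) \<in> ?C p"
          using zC by (intro nonneg_cone_add)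
        moreover have "- (z1 - N \<cdot> b0) + (z1 - (e - e1) \<cdot> b0) = (e - e1 - N) \<cdot> (- b0)"
          by (simp add: scale_diff_left)
        moreover have "0 < e - e1 - N"
        proof -
          have "0 < (e - e1 - N - 1) + 1"
            using e one_pos[where ?'k='k] by (intro add_nonneg_pos) (auto simp: algebra_simps)
          then show ?thesis by simp
        qed
        ultimately have "- b0 \<in> ?C p" using cone_scale_cancel unfolding nonneg_cone_def by metis
        then show False using b0pos[OF p pX] by simp
      qed
    qed
  qed
qed

text \<open>By the basic representations only independent subsets of the finite set \<open>G\<close>
  have to be considered, and the maximum of their finitely many bounds serves for all.\<close>

lemma archimedean_bound:
  assumes s: "state G \<mu>"
    and a: "a \<in> V0 \<union> G" and b: "b \<in> V0 \<union> G" "\<mu> (- b) = {}" and ab: "\<mu> a \<subseteq> \<mu> b"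
  shows "\<exists>e\<ge>0. \<forall>p\<in>\<mu> b. a - e \<cdot> b \<notin> nonneg_cone (V0 \<union> G) \<mu> p"
proof -
  define Q where "Q H e \<longleftrightarrow> (\<forall>p\<in>\<mu> b. \<forall>c. (\<forall>g\<in>H. p \<notin> \<mu> (- g) \<and> 0 \<le> c g) \<longrightarrow>
    a - e \<cdot> b - (\<Sum>g\<in>H. c g \<cdot> g) \<notin> V0 \<inter> nonneg_cone (V0 \<union> G) \<mu> p)" for H and e :: 'k
  have "\<exists>\<Lambda>\<ge>0. \<forall>e\<ge>\<Lambda>. \<forall>H\<in>\<H>. Q H e" if "finite \<H>" "\<H> \<subseteq> {H. H \<subseteq> G \<and> independent H}" for \<H>
    using that
  proof (induction \<H> rule: finite_induct)
    case empty
    then show ?case by auto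
  next
    case (insert H \<H>)
    obtain \<Lambda> where \<Lambda>: "0 \<le> \<Lambda>" "\<forall>e\<ge>\<Lambda>. \<forall>H\<in>\<H>. Q H e" using insert by auto
    obtain \<Lambda>' where \<Lambda>': "0 \<le> \<Lambda>'" "\<forall>e\<ge>\<Lambda>'. Q H e"
      using independent_bound[OF s _ _ a b ab, of H] insert(4) unfolding Q_def by blast
    show ?case
      using \<Lambda> \<Lambda>' by (intro exI[of _ "max \<Lambda> \<Lambda>'"]) (auto simp: le_max_iff_disj)
  qed
  from this[of "{H. H \<subseteq> G \<and> independent H}"] obtain e where e: "0 \<le> e" "\<And>H. H \<subseteq> G \<Longrightarrow> independent H \<Longrightarrow> Q H e"
    using stateD(1)[OF s] by auto
  have "a - e \<cdot> b \<notin> nonneg_cone (V0 \<union> G) \<mu> p" if p: "p \<in> \<mu> b" for p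
  proof
    assume "a - e \<cdot> b \<in> nonneg_cone (V0 \<union> G) \<mu> p"
    from nonneg_cone_basic_representation[OF s this] obtain H c where H: "H \<subseteq> {g \<in> G. p \<notin> \<mu> (- g)}"
      "independent H" "\<forall>g\<in>H. 0 \<le> c g"
      "a - e \<cdot> b - (\<Sum>g\<in>H. c g \<cdot> g) \<in> V0 \<inter> nonneg_cone (V0 \<union> G) \<mu> p" by blast
    then have "Q H e" using e(2)[of H] by blast
    moreover have "\<forall>g\<in>H. p \<notin> \<mu> (- g) \<and> 0 \<le> c g" using H by blast
    ultimately show False using H(4) p unfolding Q_def by blast
  qed
  then show ?thesis using e(1) by blast
qed

text \<open>For the scalar \<open>e\<close> of the preceding bound, \<open>e \<cdot> b - a\<close>
  may be declared positive on \<open>\<mu> b\<close>; outside it \<open>a\<close> and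
  \<open>b\<close> both vanish, and so does this vector.\<close>

lemma archimedean:
  assumes s: "state G \<mu>"
    and a: "a \<in> V0 \<union> G" "\<mu> (- a) = {}" and b: "b \<in> V0 \<union> G" "\<mu> (- b) = {}" and ab: "\<mu> a \<subseteq> \<mu> b"
  shows "\<exists>G' \<mu>'. state G' \<mu>' \<and> extends (G, \<mu>) (G', \<mu>') \<and>
    (\<exists>e\<ge>0. a - e \<cdot> b \<in> V0 \<union> G' \<and> \<mu>' (a - e \<cdot> b) = {})"
proof -
  let ?C = "nonneg_cone (V0 \<union> G) \<mu>"
  obtain e where e: "0 \<le> e" "\<And>p. p \<in> \<mu> b \<Longrightarrow> a - e \<cdot> b \<notin> ?C p"
    using archimedean_bound[OF s a(1) b ab] by blast
  define v where "v = e \<cdot> b - a"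
  have v_neg: "- v = a - e \<cdot> b" by (simp add: v_def)
  have aC: "a \<in> ?C p" for p using stateD(7)[OF s a(1)] a(2) by simp
  have bC: "b \<in> ?C p" for p using stateD(7)[OF s b(1)] b(2) by simp
  have out: "v \<in> ?C p \<and> - v \<in> ?C p" if "p \<notin> \<mu> b" for p
  proof -
    have n: "- a \<in> ?C p" "- b \<in> ?C p"
      using that ab stateD(7)[OF s stateD(5)[OF s a(1)], of p] stateD(7)[OF s stateD(5)[OF s b(1)], of p]
      by auto
    have "e \<cdot> b + - a \<in> ?C p" "a + e \<cdot> (- b) \<in> ?C p"
      by (rule nonneg_cone_add[OF nonneg_cone_scale[OF bC e(1)] n(1)]
          nonneg_cone_add[OF aC nonneg_cone_scale[OF n(2) e(1)]])+
    then show ?thesis by (simp add: v_def)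
  qed
  show ?thesis
  proof (cases "v \<in> V0 \<union> G")
    case True
    \<comment> \<open>If \<open>v\<close> was decided before, the required sign holds automatically:
      a point of \<open>\<mu> (- v)\<close> would lie in \<open>\<mu> b\<close>, where
      \<open>- v\<close> is not in the cone.\<close>
    have "\<mu> (- v) = {}"
    proof (rule ccontr)
      assume "\<mu> (- v) \<noteq> {}"
      then obtain p where p: "p \<in> \<mu> (- v)" by blast
      then have "v \<notin> ?C p" using stateD(7)[OF s True] by simp
      then have "p \<in> \<mu> b" using out by blast
      then have "- v \<notin> ?C p" using e(2) v_neg by simp
      moreover have "- v \<in> ?C p"
        using p stateD(6)[OF s True] stateD(7)[OF s stateD(5)[OF s True], of p] by auto
      ultimately show False by simp
    qed
    then show ?thesis
      using s e(1) stateD(5)[OF s True] v_neg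
      by (intro exI[of _ G] exI[of _ \<mu>]) (auto simp: extends_def)
  next
    case False
    have "v \<noteq> 0" using False V0_zero by auto
    then have vv: "v \<noteq> - v" by (rule neq_uminus)
    have "p \<in> \<mu> b \<Longrightarrow> - v \<notin> ?C p" "p \<in> {} \<Longrightarrow> v \<notin> ?C p"
      "p \<notin> \<mu> b \<Longrightarrow> p \<notin> {} \<Longrightarrow> v \<in> ?C p \<longleftrightarrow> - v \<in> ?C p" for p
      using e(2) v_neg out by auto
    note st = state_insert[OF s False stateD(3)[OF s b(1)] Lat_empty Int_empty_right this]
    have "\<exists>e\<ge>0. a - e \<cdot> b \<in> V0 \<union> insert v (insert (- v) G) \<and> (\<mu>(v := \<mu> b, - v := {})) (a - e \<cdot> b) = {}"
      using e(1) v_neg vv by (intro exI[of _ e]) simp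
    with st show ?thesis by blast
  qed
qed

section \<open>The limit of a chain of states\<close>

lemma total_extension:
  assumes "countable (UNIV :: 'v set)" and "countable Lat"
  obtains \<nu> where "\<And>x. x \<in> V0 \<Longrightarrow> \<nu> x = \<mu>0 x" "\<And>x. \<nu> x \<in> Lat"
    "\<And>x y. \<nu> (x + y) \<subseteq> \<nu> x \<union> \<nu> y" "\<And>c x. 0 < c \<Longrightarrow> \<nu> (c \<cdot> x) \<subseteq> \<nu> x"
    "\<And>x. \<nu> x \<inter> \<nu> (- x) = {}"
    "\<And>x. \<exists>t. \<nu> (- t) = {} \<and> \<nu> (x - t) = {} \<and> \<nu> t \<inter> \<nu> (t - x) = {}"
    "\<And>q. q \<in> Lat \<Longrightarrow> \<exists>t. \<nu> t = q \<and> \<nu> (- t) = {}"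
    "\<And>a b. \<nu> (- a) = {} \<Longrightarrow> \<nu> (- b) = {} \<Longrightarrow> \<nu> a \<subseteq> \<nu> b \<Longrightarrow> \<exists>e\<ge>0. \<nu> (a - e \<cdot> b) = {}"
proof -
  define D where "D s = V0 \<union> fst s" for s :: "'v set \<times> ('v \<Rightarrow> 'p set)"
  define P where "P s \<longleftrightarrow> state (fst s) (snd s)" for s
  define Q1 where "Q1 v s \<longleftrightarrow> v \<in> D s" for v s
  define Q2 where "Q2 x s \<longleftrightarrow> (\<exists>t. {t, - t, x - t, t - x} \<subseteq> D s \<and> snd s (- t) = {} \<and>
    snd s (x - t) = {} \<and> snd s t \<inter> snd s (t - x) = {})" for x s
  define Q3 where "Q3 q s \<longleftrightarrow> (\<exists>t\<in>D s. - t \<in> D s \<and> snd s t = q \<and> snd s (- t) = {})" for q s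
  \<comment> \<open>The premises are part of the goal because goals are fixed before the values at
    \<open>a\<close> and \<open>b\<close> are known. Once both vectors are decided, extensions no
    longer change whether the premises hold.\<close>
  define Q4 where "Q4 a b s \<longleftrightarrow> a \<in> D s \<and> b \<in> D s \<and> (snd s (- a) = {} \<longrightarrow> snd s (- b) = {} \<longrightarrow>
    snd s a \<subseteq> snd s b \<longrightarrow> (\<exists>e\<ge>0. a - e \<cdot> b \<in> D s \<and> snd s (a - e \<cdot> b) = {}))" for a b s
  define T where "T = range Q1 \<union> range Q2 \<union> Q3 ` Lat \<union> range (\<lambda>(a, b). Q4 a b)"
  have D: "\<exists>s'. P s' \<and> extends s s' \<and> v \<in> D s'" if "P s" for s v
    using decide[of "fst s" "snd s" v] that unfolding P_def D_def by force
  have ext_D: "x \<in> D s' \<and> snd s' x = snd s x" if "extends s s'" "x \<in> D s" for s s' x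
    using that unfolding extends_def D_def by auto
  have T: "\<exists>s'. P s' \<and> extends s s' \<and> Q s'" if Q: "Q \<in> T" and s: "P s" for Q s
  proof -
    consider v where "Q = Q1 v" | x where "Q = Q2 x" | q where "q \<in> Lat" "Q = Q3 q" | a b where "Q = Q4 a b"
      using Q unfolding T_def by auto
    then show ?thesis
    proof cases
      case 1
      then show ?thesis using D[OF s] unfolding Q1_def by blast
    next
      case 2
      obtain s1 where s1: "P s1" "extends s s1" "x \<in> D s1" using D[OF s] by blast
      then obtain G' \<mu>' where s': "state G' \<mu>'" "extends s1 (G', \<mu>')" "\<exists>t. {t, - t, x - t, t - x} \<subseteq> V0 \<union> G' \<and>
          \<mu>' (- t) = {} \<and> \<mu>' (x - t) = {} \<and> \<mu>' t \<inter> \<mu>' (t - x) = {}"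
        using positive_part[of "fst s1" "snd s1" x] unfolding P_def D_def by auto
      then have "P (G', \<mu>')" "Q2 x (G', \<mu>')" unfolding P_def Q2_def D_def by simp_all
      then show ?thesis using extends_trans[OF s1(2) s'(2)] 2 by blast
    next
      case 3
      obtain G' \<mu>' where s': "state G' \<mu>'" "extends s (G', \<mu>')" "\<exists>t\<in>G'. - t \<in> G' \<and> \<mu>' t = q \<and> \<mu>' (- t) = {}"
        using realize[OF s[unfolded P_def] 3(1)] by auto
      then have "P (G', \<mu>')" "Q3 q (G', \<mu>')" unfolding P_def Q3_def D_def by auto
      then show ?thesis using s'(2) 3 by blast
    next
      case 4
      obtain s1 where s1: "P s1" "extends s s1" "a \<in> D s1" using D[OF s] by blast
      obtain s2 where s2: "P s2" "extends s1 s2" "b \<in> D s2" using D[OF s1(1)] by blast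
      have e2: "extends s s2" using extends_trans s1 s2 by blast
      have a2: "a \<in> D s2" using ext_D[OF s2(2) s1(3)] by simp
      show ?thesis
      proof (cases "snd s2 (- a) = {} \<and> snd s2 (- b) = {} \<and> snd s2 a \<subseteq> snd s2 b")
        case False
        then have "Q4 a b s2" using a2 s2(3) unfolding Q4_def by blast
        then show ?thesis using s2(1) e2 4 by blast
      next
        case True
        then obtain G' \<mu>' where s': "state G' \<mu>'" "extends s2 (G', \<mu>')"
            "\<exists>e\<ge>0. a - e \<cdot> b \<in> V0 \<union> G' \<and> \<mu>' (a - e \<cdot> b) = {}"
          using archimedean[of "fst s2" "snd s2" a b] s2 a2 unfolding P_def D_def by auto
        have "Q4 a b (G', \<mu>')"
          using s'(3) ext_D[OF s'(2) a2] ext_D[OF s'(2) s2(3)] unfolding Q4_def D_def by simp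
        moreover have "P (G', \<mu>')" using s' by (simp add: P_def)
        ultimately show ?thesis using extends_trans[OF e2 s'(2)] 4 by blast
      qed
    qed
  qed
  have "countable (UNIV :: ('v \<times> 'v) set)"
    using countable_SIGMA[of "UNIV :: 'v set" "\<lambda>_. UNIV :: 'v set"] assms(1) by simp
  then have "countable T"
    unfolding T_def using assms by (intro countable_Un countable_image) auto
  moreover have "P ({}, \<mu>0)" using initial_state by (simp add: P_def)
  ultimately obtain S where S: "\<And>n. P (S n)" "\<And>n. extends (S n) (S (Suc n))" "\<And>Q. Q \<in> T \<Longrightarrow> \<exists>n. Q (S n)"
    using chain_meeting_countably_many_goals[of T extends P "({}, \<mu>0)"] T
    by (metis (no_types, lifting) extends_def order_refl)
  have mono: "extends (S m) (S n)" if "m \<le> n" for m n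
    using that
  proof (induction n rule: dec_induct)
    case base
    then show ?case by (simp add: extends_def)
  next
    case (step n)
    then show ?case using extends_trans S(2) by blast
  qed
  have "\<exists>n. v \<in> D (S n)" for v
    using S(3)[of "Q1 v"] unfolding T_def Q1_def by auto
  then obtain N where N: "\<And>v. v \<in> D (S (N v))" by metis
  \<comment> \<open>The choice of the stage \<open>N v\<close> is immaterial, since extensions never
    revise a value.\<close>
  define \<nu> where "\<nu> v = snd (S (N v)) v" for v
  have DN: "v \<in> D (S n)" if "N v \<le> n" for v n
    using ext_D[OF mono[OF that] N] by simp
  have \<nu>: "\<nu> v = snd (S n) v" if "v \<in> D (S n)" for v n
    using ext_D[OF mono[of n "max n (N v)"] that] ext_D[OF mono[of "N v" "max n (N v)"] N]
    unfolding \<nu>_def by simp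
  note st = stateD[OF S(1)[unfolded P_def], folded D_def]
  have cone: "x \<in> nonneg_cone (D (S n)) (snd (S n)) p \<longleftrightarrow> p \<notin> \<nu> (- x)" if "x \<in> D (S n)" for x p n
    using st(7)[OF that] \<nu>[OF st(5)[OF that]] by simp
  show ?thesis
  proof
    show "\<nu> x = \<mu>0 x" if "x \<in> V0" for x
      unfolding \<nu>_def using st(4)[OF that] .
    show "\<nu> x \<in> Lat" for x
      unfolding \<nu>_def using st(3)[OF N] .
    show "\<nu> (x + y) \<subseteq> \<nu> x \<union> \<nu> y" for x y
    proof
      fix p assume p: "p \<in> \<nu> (x + y)"
      \<comment> \<open>All vectors involved are decided at this stage, so the claim reduces to
        closure of the cone at stage \<open>n\<close> under addition.\<close>
      define n where "n = max (N x) (max (N y) (N (x + y)))"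
      have n: "- x \<in> D (S n)" "- y \<in> D (S n)" "- (x + y) \<in> D (S n)"
        by (rule st(5), rule DN, simp add: n_def)+
      show "p \<in> \<nu> x \<union> \<nu> y"
      proof (rule ccontr)
        assume "p \<notin> \<nu> x \<union> \<nu> y"
        then have "- x + - y \<in> nonneg_cone (D (S n)) (snd (S n)) p"
          using cone[OF n(1)] cone[OF n(2)] by (intro nonneg_cone_add) auto
        moreover have "- x + - y = - (x + y)" by simp
        ultimately show False using cone[OF n(3), of p] p unfolding minus_minus by metis
      qed
    qed
    show "\<nu> (c \<cdot> x) \<subseteq> \<nu> x" if "0 < c" for c x
    proof
      fix p assume p: "p \<in> \<nu> (c \<cdot> x)"
      define n where "n = max (N x) (N (c \<cdot> x))"
      have n: "- x \<in> D (S n)" "- (c \<cdot> x) \<in> D (S n)"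
        by (rule st(5), rule DN, simp add: n_def)+
      show "p \<in> \<nu> x"
      proof (rule ccontr)
        assume "p \<notin> \<nu> x"
        then have "c \<cdot> (- x) \<in> nonneg_cone (D (S n)) (snd (S n)) p"
          using cone[OF n(1)] that by (intro nonneg_cone_scale) auto
        then show False using cone[OF n(2)] p by simp
      qed
    qed
    show "\<nu> x \<inter> \<nu> (- x) = {}" for x
      using st(6)[OF N] \<nu>[OF st(5)[OF N], of x] unfolding \<nu>_def by simp
    show "\<exists>t. \<nu> (- t) = {} \<and> \<nu> (x - t) = {} \<and> \<nu> t \<inter> \<nu> (t - x) = {}" for x
    proof -
      obtain n where "Q2 x (S n)" using S(3)[of "Q2 x"] unfolding T_def by auto
      then obtain t where t: "{t, - t, x - t, t - x} \<subseteq> D (S n)" "snd (S n) (- t) = {} \<and>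
        snd (S n) (x - t) = {} \<and> snd (S n) t \<inter> snd (S n) (t - x) = {}" unfolding Q2_def by blast
      then show ?thesis using \<nu> by (intro exI[of _ t]) auto
    qed
    show "\<exists>t. \<nu> t = q \<and> \<nu> (- t) = {}" if "q \<in> Lat" for q
    proof -
      have "Q3 q \<in> T" using that unfolding T_def by blast
      then obtain n where "Q3 q (S n)" using S(3) by blast
      then obtain t where "t \<in> D (S n)" "- t \<in> D (S n)" "snd (S n) t = q" "snd (S n) (- t) = {}"
        unfolding Q3_def by blast
      then show ?thesis using \<nu> by (intro exI[of _ t]) auto
    qed
    show "\<exists>e\<ge>0. \<nu> (a - e \<cdot> b) = {}" if ab: "\<nu> (- a) = {}" "\<nu> (- b) = {}" "\<nu> a \<subseteq> \<nu> b" for a b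
    proof -
      have "Q4 a b \<in> T" unfolding T_def by auto
      then obtain n where n: "Q4 a b (S n)" using S(3) by blast
      then have "a \<in> D (S n)" "b \<in> D (S n)" unfolding Q4_def by auto
      then have "snd (S n) (- a) = {}" "snd (S n) (- b) = {}" "snd (S n) a \<subseteq> snd (S n) b"
        using ab \<nu> st(5) by metis+
      then obtain e where "0 \<le> e" "a - e \<cdot> b \<in> D (S n)" "snd (S n) (a - e \<cdot> b) = {}"
        using n unfolding Q4_def by blast
      then show ?thesis using \<nu> by blast
    qed
  qed
qed

end

section \<open>Prime filters\<close>

definition prime_filter :: "('l, 'm) gorder_scheme \<Rightarrow> 'l set \<Rightarrow> bool" where
  "prime_filter L F \<longleftrightarrow> F \<subseteq> carrier L \<and> \<bottom>\<^bsub>L\<^esub> \<notin> F \<and>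
     (\<forall>x\<in>carrier L. \<forall>y\<in>carrier L. x \<sqinter>\<^bsub>L\<^esub> y \<in> F \<longleftrightarrow> x \<in> F \<and> y \<in> F) \<and>
     (\<forall>x\<in>carrier L. \<forall>y\<in>carrier L. x \<squnion>\<^bsub>L\<^esub> y \<in> F \<longleftrightarrow> x \<in> F \<or> y \<in> F)"

text \<open>The Stone representation map; its image serves as \<open>Lat\<close>.\<close>

definition prime_filters_of :: "('l, 'm) gorder_scheme \<Rightarrow> 'l \<Rightarrow> 'l set set" where
  "prime_filters_of L x = {F. prime_filter L F \<and> x \<in> F}"

context distributive_zero_lattice
begin

lemma meet_mono_left:
  assumes "m \<in> carrier L" "n \<in> carrier L" "x \<in> carrier L"
  shows "(m \<sqinter> n) \<sqinter> x \<sqsubseteq> m \<sqinter> x"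
  using assms le_trans[OF meet_left[of "m \<sqinter> n" x] meet_left[of m n]] meet_right[of "m \<sqinter> n" x]
  by (intro meet_le) simp_all

lemma meet_mono_right:
  assumes "m \<in> carrier L" "n \<in> carrier L" "x \<in> carrier L"
  shows "(m \<sqinter> n) \<sqinter> x \<sqsubseteq> n \<sqinter> x"
  using assms le_trans[OF meet_left[of "m \<sqinter> n" x] meet_right[of m n]] meet_right[of "m \<sqinter> n" x]
  by (intro meet_le) simp_all

text \<open>A filter that is maximal among those containing \<open>a\<close> and omitting
  \<open>b\<close> is prime: if it omits \<open>x\<close> and \<open>y\<close>, then some
  \<open>m \<sqinter> x\<close> and \<open>n \<sqinter> y\<close> with \<open>m\<close> and
  \<open>n\<close> in it lie below \<open>b\<close>, and by distributivity so does
  \<open>(m \<sqinter> n) \<sqinter> (x \<squnion> y)\<close>.\<close>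

lemma prime_filter_separation:
  assumes a: "a \<in> carrier L" and b: "b \<in> carrier L" and ab: "\<not> a \<sqsubseteq> b"
  shows "\<exists>F. prime_filter L F \<and> a \<in> F \<and> b \<notin> F"
proof -
  define filt where "filt F \<longleftrightarrow> F \<subseteq> carrier L \<and> (\<forall>x\<in>F. \<forall>y\<in>F. x \<sqinter> y \<in> F) \<and>
    (\<forall>x\<in>F. \<forall>y\<in>carrier L. x \<sqsubseteq> y \<longrightarrow> y \<in> F)" for F
  define \<F> where "\<F> = {F. filt F \<and> a \<in> F \<and> b \<notin> F}"
  have "filt {x \<in> carrier L. a \<sqsubseteq> x}"
    unfolding filt_def using a meet_le[of a] le_trans[of a] by simp blast
  then have ne: "{x \<in> carrier L. a \<sqsubseteq> x} \<in> \<F>"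
    using a ab by (auto simp: \<F>_def)
  have "\<exists>M\<in>\<F>. \<forall>X\<in>\<F>. M \<subseteq> X \<longrightarrow> X = M"
  proof (rule subset_Zorn_nonempty)
    show "\<F> \<noteq> {}" using ne by blast
    fix \<C> assume "\<C> \<noteq> {}" and C: "subset.chain \<F> \<C>"
    have "x \<sqinter> y \<in> \<Union>\<C>" if xy: "x \<in> \<Union>\<C>" "y \<in> \<Union>\<C>" for x y
    proof -
      obtain X Y where "X \<in> \<C>" "Y \<in> \<C>" "x \<in> X" "y \<in> Y" using xy by blast
      moreover have "X \<subseteq> Y \<or> Y \<subseteq> X" using C calculation unfolding subset.chain_def by blast
      ultimately obtain Z where Z: "Z \<in> \<C>" "x \<in> Z" "y \<in> Z" by blast
      then have "filt Z" using C unfolding subset.chain_def \<F>_def by blast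
      then show ?thesis using Z unfolding filt_def by blast
    qed
    moreover have CF: "filt X" "a \<in> X" "b \<notin> X" if "X \<in> \<C>" for X
      using C that unfolding subset.chain_def \<F>_def by blast+
    have "\<Union>\<C> \<subseteq> carrier L" using CF(1) unfolding filt_def by blast
    moreover have "y \<in> \<Union>\<C>" if "x \<in> \<Union>\<C>" "y \<in> carrier L" "x \<sqsubseteq> y" for x y
      using that CF(1) unfolding filt_def by blast
    ultimately have "filt (\<Union>\<C>)" unfolding filt_def by blast
    moreover have "a \<in> \<Union>\<C>" "b \<notin> \<Union>\<C>" using \<open>\<C> \<noteq> {}\<close> CF by blast+
    ultimately show "\<Union>\<C> \<in> \<F>" unfolding \<F>_def by blast
  qed
  then obtain M where M: "filt M" "a \<in> M" "b \<notin> M" and max: "\<And>X. filt X \<Longrightarrow> a \<in> X \<Longrightarrow> b \<notin> X \<Longrightarrow> M \<subseteq> X \<Longrightarrow> X = M"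
    unfolding \<F>_def by blast
  have Mc: "M \<subseteq> carrier L" and Mm: "\<And>x y. x \<in> M \<Longrightarrow> y \<in> M \<Longrightarrow> x \<sqinter> y \<in> M"
    and Mu: "\<And>x y. x \<in> M \<Longrightarrow> y \<in> carrier L \<Longrightarrow> x \<sqsubseteq> y \<Longrightarrow> y \<in> M"
    using M(1) unfolding filt_def by blast+
  \<comment> \<open>Otherwise the filter generated by \<open>M\<close> and \<open>x\<close> still
    omits \<open>b\<close>, against maximality.\<close>
  have gen: "\<exists>m\<in>M. m \<sqinter> x \<sqsubseteq> b" if x: "x \<in> carrier L" "x \<notin> M" for x
  proof (rule ccontr)
    assume n: "\<not> ?thesis"
    let ?X = "{y \<in> carrier L. \<exists>m\<in>M. m \<sqinter> x \<sqsubseteq> y}"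
    have "filt ?X"
      unfolding filt_def
    proof (intro conjI ballI impI)
      fix y z assume "y \<in> ?X" "z \<in> ?X"
      then obtain m n where *: "m \<in> M" "n \<in> M" "m \<sqinter> x \<sqsubseteq> y" "n \<sqinter> x \<sqsubseteq> z" "y \<in> carrier L" "z \<in> carrier L" by blast
      have c: "m \<in> carrier L" "n \<in> carrier L" using * Mc by auto
      have "(m \<sqinter> n) \<sqinter> x \<sqsubseteq> y" "(m \<sqinter> n) \<sqinter> x \<sqsubseteq> z"
        using le_trans[OF meet_mono_left[of m n x] *(3)] le_trans[OF meet_mono_right[of m n x] *(4)] c x * by simp_all
      then have "(m \<sqinter> n) \<sqinter> x \<sqsubseteq> y \<sqinter> z"
        using * c x by (intro meet_le) simp_all
      then show "y \<sqinter> z \<in> ?X" using * Mm by auto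
    next
      fix y z assume "y \<in> ?X" "z \<in> carrier L" "y \<sqsubseteq> z"
      then obtain m where m: "m \<in> M" "m \<sqinter> x \<sqsubseteq> y" "y \<in> carrier L" by blast
      then have "m \<sqinter> x \<sqsubseteq> z"
        using le_trans[OF m(2) \<open>y \<sqsubseteq> z\<close>] Mc x \<open>z \<in> carrier L\<close> by auto
      then show "z \<in> ?X" using m(1) \<open>z \<in> carrier L\<close> by blast
    qed auto
    moreover have "M \<subseteq> ?X"
    proof
      fix m assume m: "m \<in> M"
      then have "m \<in> carrier L" using Mc by blast
      moreover from this have "m \<sqinter> x \<sqsubseteq> m" using x(1) by (rule meet_left)
      ultimately show "m \<in> ?X" using m by blast
    qed
    moreover have "b \<notin> ?X" using n by blast
    ultimately have "?X = M" using max[of ?X] M(2) by blast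
    moreover have "a \<sqinter> x \<sqsubseteq> x" using x a by (intro meet_right)
    then have "x \<in> ?X" using x M(2) by blast
    ultimately show False using x by simp
  qed
  have "x \<in> M \<or> y \<in> M" if xy: "x \<in> carrier L" "y \<in> carrier L" "x \<squnion> y \<in> M" for x y
  proof (rule ccontr)
    assume "\<not> (x \<in> M \<or> y \<in> M)"
    then obtain m n where mn: "m \<in> M" "n \<in> M" "m \<sqinter> x \<sqsubseteq> b" "n \<sqinter> y \<sqsubseteq> b"
      using gen[OF xy(1)] gen[OF xy(2)] by blast
    have c: "m \<in> carrier L" "n \<in> carrier L" using mn Mc by auto
    have "(m \<sqinter> n) \<sqinter> x \<sqsubseteq> b" "(m \<sqinter> n) \<sqinter> y \<sqsubseteq> b"
      using le_trans[OF meet_mono_left[of m n x] mn(3)] le_trans[OF meet_mono_right[of m n y] mn(4)] c xy b by simp_all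
    then have "((m \<sqinter> n) \<sqinter> x) \<squnion> ((m \<sqinter> n) \<sqinter> y) \<sqsubseteq> b" using c xy b by (intro join_le) auto
    then have "(m \<sqinter> n) \<sqinter> (x \<squnion> y) \<sqsubseteq> b" using meet_join_distrib[of "m \<sqinter> n" x y] c xy by simp
    moreover have "(m \<sqinter> n) \<sqinter> (x \<squnion> y) \<in> M" using Mm mn xy by blast
    ultimately show False using Mu b M(3) by blast
  qed
  moreover have "\<bottom> \<notin> M" using Mu M(3) b bottom_lower by blast
  moreover have "x \<in> M" "y \<in> M" if "x \<in> carrier L" "y \<in> carrier L" "x \<sqinter> y \<in> M" for x y
    using Mu[OF that(3) that(1) meet_left[OF that(1,2)]] Mu[OF that(3) that(2) meet_right[OF that(1,2)]] .
  moreover have "x \<squnion> y \<in> M" if "x \<in> carrier L" "y \<in> carrier L" "x \<in> M \<or> y \<in> M" for x y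
    using Mu[of x "x \<squnion> y"] Mu[of y "x \<squnion> y"] join_left[OF that(1,2)] join_right[OF that(1,2)]
      join_closed[OF that(1,2)] that(3) by blast
  ultimately have "prime_filter L M"
    unfolding prime_filter_def using Mc Mm by (intro conjI ballI iffI) metis+
  then show ?thesis using M by blast
qed

lemma prime_filters_of_join:
  "x \<in> carrier L \<Longrightarrow> y \<in> carrier L \<Longrightarrow>
    prime_filters_of L (x \<squnion> y) = prime_filters_of L x \<union> prime_filters_of L y"
  by (auto simp: prime_filters_of_def prime_filter_def)

lemma prime_filters_of_meet:
  "x \<in> carrier L \<Longrightarrow> y \<in> carrier L \<Longrightarrow>
    prime_filters_of L (x \<sqinter> y) = prime_filters_of L x \<inter> prime_filters_of L y"
  by (auto simp: prime_filters_of_def prime_filter_def)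

lemma prime_filters_of_bottom: "prime_filters_of L \<bottom> = {}"
  by (auto simp: prime_filters_of_def prime_filter_def)

lemma prime_filters_of_subset_iff:
  assumes "x \<in> carrier L" "y \<in> carrier L"
  shows "prime_filters_of L x \<subseteq> prime_filters_of L y \<longleftrightarrow> x \<sqsubseteq> y"
proof
  show "x \<sqsubseteq> y" if "prime_filters_of L x \<subseteq> prime_filters_of L y"
    using prime_filter_separation[OF assms] that by (auto simp: prime_filters_of_def)
  show "prime_filters_of L x \<subseteq> prime_filters_of L y" if "x \<sqsubseteq> y"
    using prime_filters_of_join[OF assms] le_iff_meet[OF assms] that by auto
qed

lemma inj_on_prime_filters_of: "inj_on (prime_filters_of L) (carrier L)"
proof (rule inj_onI)
  fix x y assume "x \<in> carrier L" "y \<in> carrier L" "prime_filters_of L x = prime_filters_of L y"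
  then show "x = y"
    using prime_filters_of_subset_iff[of x y] prime_filters_of_subset_iff[of y x] le_antisym[of x y] by simp
qed

end

section \<open>Positive parts and principal ideals\<close>

lemma (in partial_order) join_eqI:
  assumes "x \<in> carrier L" "y \<in> carrier L" "s \<in> carrier L" "x \<sqsubseteq> s" "y \<sqsubseteq> s"
    and "\<And>z. z \<in> carrier L \<Longrightarrow> x \<sqsubseteq> z \<Longrightarrow> y \<sqsubseteq> z \<Longrightarrow> s \<sqsubseteq> z"
  shows "x \<squnion> y = s"
proof -
  have "least L s (Upper L {x, y})"
    using assms by (auto simp: least_def Upper_def)
  then show ?thesis
    unfolding join_def sup_def by (intro some_equality) (use least_unique in blast)+
qed

lemma (in partial_order) meet_eqI:
  assumes "x \<in> carrier L" "y \<in> carrier L" "s \<in> carrier L" "s \<sqsubseteq> x" "s \<sqsubseteq> y"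
    and "\<And>z. z \<in> carrier L \<Longrightarrow> z \<sqsubseteq> x \<Longrightarrow> z \<sqsubseteq> y \<Longrightarrow> z \<sqsubseteq> s"
  shows "x \<sqinter> y = s"
proof -
  have "greatest L s (Lower L {x, y})"
    using assms by (auto simp: greatest_def Lower_def)
  then show ?thesis
    unfolding meet_def inf_def by (intro some_equality) (use greatest_unique in blast)+
qed

lemma (in partial_order) bottom_eqI:
  assumes "least L s (carrier L)"
  shows "\<bottom> = s"
  unfolding bottom_def
  by (rule some_equality) (use assms least_unique in blast)+

context vector_lattice
begin

lemma vle_refl: "x \<in> carrier E \<Longrightarrow> x \<preceq> x"
  using order.le_refl[of x] by (simp add: order_of_def)

lemma vle_trans: "x \<preceq> y \<Longrightarrow> y \<preceq> z \<Longrightarrow> x \<in> carrier E \<Longrightarrow> y \<in> carrier E \<Longrightarrow> z \<in> carrier E \<Longrightarrow> x \<preceq> z"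
  using order.le_trans[of x y z] by (simp add: order_of_def)

lemma vle_antisym: "x \<preceq> y \<Longrightarrow> y \<preceq> x \<Longrightarrow> x \<in> carrier E \<Longrightarrow> y \<in> carrier E \<Longrightarrow> x = y"
  using order.le_antisym[of x y] by (simp add: order_of_def)

lemma vle_add_mono:
  assumes "x \<preceq> y" "z \<preceq> w" "x \<in> carrier E" "y \<in> carrier E" "z \<in> carrier E" "w \<in> carrier E"
  shows "x \<oplus> z \<preceq> y \<oplus> w"
  using vle_trans[of "x \<oplus> z" "y \<oplus> z" "y \<oplus> w"] vle_translate[of x y z] vle_translate[of z w y] assms
  by (simp add: a_comm)

lemma vle_iff_diff:
  assumes "x \<in> carrier E" "y \<in> carrier E"
  shows "x \<preceq> y \<longleftrightarrow> \<zero> \<preceq> y \<ominus> x"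
proof
  show "\<zero> \<preceq> y \<ominus> x" if "x \<preceq> y"
    using vle_translate[of x y "\<ominus> x"] assms that by (simp add: r_neg a_minus_def)
  show "x \<preceq> y" if "\<zero> \<preceq> y \<ominus> x"
    using vle_translate[of \<zero> "y \<ominus> x" x] assms that by (simp add: l_neg a_minus_def a_assoc)
qed

lemma vle_minus: "x \<preceq> y \<Longrightarrow> x \<in> carrier E \<Longrightarrow> y \<in> carrier E \<Longrightarrow> \<ominus> y \<preceq> \<ominus> x"
  using vle_iff_diff[of x y] vle_iff_diff[of "\<ominus> y" "\<ominus> x"] by (simp add: a_minus_def a_comm)

lemma minus_nonpos: "\<zero> \<preceq> x \<Longrightarrow> x \<in> carrier E \<Longrightarrow> \<ominus> x \<preceq> \<zero>"
  using vle_translate[of \<zero> x "\<ominus> x"] by (simp add: r_neg)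

lemma add_diff_cancel: "x \<in> carrier E \<Longrightarrow> y \<in> carrier E \<Longrightarrow> y \<oplus> (x \<ominus> y) = x"
  by (simp add: a_minus_def a_lcomm[of y x] r_neg)

lemma smult_zero_right: "c \<odot> \<zero> = \<zero>"
  using smult_r_distr[of \<zero> \<zero> c] smult_closed[of \<zero> c] by (simp add: add.l_cancel_one')

lemma smult_zero_left: "x \<in> carrier E \<Longrightarrow> 0 \<odot> x = \<zero>"
  using smult_l_distr[of x 0 0] smult_closed[of x 0] by (simp add: add.l_cancel_one')

lemma smult_minus_right: "x \<in> carrier E \<Longrightarrow> c \<odot> (\<ominus> x) = \<ominus> (c \<odot> x)"
  using smult_r_distr[of x "\<ominus> x" c] smult_closed[of x c] smult_closed[of "\<ominus> x" c]
  by (metis a_inv_closed minus_equality r_neg smult_zero_right a_comm)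

lemma smult_diff_right:
  "x \<in> carrier E \<Longrightarrow> y \<in> carrier E \<Longrightarrow> c \<odot> (x \<ominus> y) = c \<odot> x \<ominus> c \<odot> y"
  by (simp add: a_minus_def smult_r_distr smult_minus_right)

lemma smult_mono:
  assumes "x \<preceq> y" "0 \<le> c" "x \<in> carrier E" "y \<in> carrier E"
  shows "c \<odot> x \<preceq> c \<odot> y"
  using assms smult_nonneg[of "y \<ominus> x" c] vle_iff_diff[of x y] vle_iff_diff[of "c \<odot> x" "c \<odot> y"]
  by (simp add: smult_closed smult_diff_right)

lemma smult_mono_left:
  assumes "c \<le> d" "\<zero> \<preceq> x" "x \<in> carrier E"
  shows "c \<odot> x \<preceq> d \<odot> x"
proof -
  have "(d - c) \<odot> x \<oplus> c \<odot> x = d \<odot> x"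
    using smult_l_distr[of x "d - c" c] assms by simp
  moreover have "\<zero> \<oplus> c \<odot> x \<preceq> (d - c) \<odot> x \<oplus> c \<odot> x"
    using assms smult_nonneg[of x "d - c"] by (intro vle_translate) (auto intro: smult_closed)
  ultimately show ?thesis
    using assms smult_closed[of x c] by simp
qed

section \<open>Arithmetic of positive parts\<close>

definition ppart :: "'e \<Rightarrow> 'e" where
  "ppart x = x \<squnion>\<^bsub>order_of E\<^esub> \<zero>"

lemma ppart:
  assumes "x \<in> carrier E"
  shows "ppart x \<in> carrier E" "\<zero> \<preceq> ppart x" "x \<preceq> ppart x"
    "\<And>z. z \<in> carrier E \<Longrightarrow> x \<preceq> z \<Longrightarrow> \<zero> \<preceq> z \<Longrightarrow> ppart x \<preceq> z"
  using assms order.join_closed[of x \<zero>] order.join_left[of x \<zero>] order.join_right[of x \<zero>]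
    order.join_le[of x _ \<zero>]
  by (auto simp: ppart_def order_of_def)

lemma ppart_pos_cone: "x \<in> carrier E \<Longrightarrow> ppart x \<in> pos_cone E"
  using ppart by (simp add: pos_cone_def)

lemma ppart_nonneg: "x \<in> carrier E \<Longrightarrow> \<zero> \<preceq> x \<Longrightarrow> ppart x = x"
  by (intro vle_antisym ppart vle_refl) auto

lemma ppart_nonpos: "x \<in> carrier E \<Longrightarrow> x \<preceq> \<zero> \<Longrightarrow> ppart x = \<zero>"
  by (intro vle_antisym ppart vle_refl) auto

lemma ppart_add:
  assumes "x \<in> carrier E" "y \<in> carrier E"
  shows "ppart (x \<oplus> y) \<preceq> ppart x \<oplus> ppart y"
  using assms ppart vle_add_mono[of \<zero> "ppart x" \<zero> "ppart y"]
  by (intro ppart vle_add_mono) auto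

lemma ppart_smult:
  assumes "x \<in> carrier E" "0 \<le> c"
  shows "ppart (c \<odot> x) \<preceq> c \<odot> ppart x"
  using assms ppart[OF assms(1)] by (intro ppart smult_mono smult_nonneg smult_closed) auto

text \<open>Write u for \<open>ppart x\<close>. Then u - x lies above \<open>\<ominus> x\<close> and
  \<open>\<zero>\<close>, hence above \<open>ppart (\<ominus> x)\<close> and above \<open>z\<close>.
  So u - z lies above \<open>x\<close> and \<open>\<zero>\<close>, hence above u.\<close>

lemma ppart_disjoint:
  assumes "x \<in> carrier E" "z \<in> carrier E" "z \<preceq> ppart x" "z \<preceq> ppart (\<ominus> x)"
  shows "z \<preceq> \<zero>"
proof -
  note p = ppart[OF assms(1)]
  have "ppart (\<ominus> x) \<preceq> ppart x \<ominus> x"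
  proof (rule ppart(4))
    show "\<ominus> x \<preceq> ppart x \<ominus> x"
      using vle_translate[of \<zero> "ppart x" "\<ominus> x"] p assms by (simp add: a_minus_def)
    show "\<zero> \<preceq> ppart x \<ominus> x" using vle_iff_diff p assms by blast
  qed (use p assms in auto)
  then have "z \<preceq> ppart x \<ominus> x"
    using assms p ppart(1)[of "\<ominus> x"] by (intro vle_trans[OF assms(4)]) auto
  then have "z \<oplus> (x \<ominus> z) \<preceq> (ppart x \<ominus> x) \<oplus> (x \<ominus> z)"
    using assms p by (intro vle_translate) auto
  moreover have "z \<oplus> (x \<ominus> z) = x" "(ppart x \<ominus> x) \<oplus> (x \<ominus> z) = ppart x \<ominus> z"
    using assms p by (simp_all add: a_minus_def a_ac r_neg r_neg1 r_neg2)
  ultimately have "x \<preceq> ppart x \<ominus> z" by simp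
  moreover have "\<zero> \<preceq> ppart x \<ominus> z" using assms p vle_iff_diff by blast
  ultimately have "ppart x \<preceq> ppart x \<ominus> z" using p assms by (intro p(4)) auto
  then have "ppart x \<oplus> (z \<ominus> ppart x) \<preceq> ppart x \<ominus> z \<oplus> (z \<ominus> ppart x)"
    using assms p by (intro vle_translate) auto
  moreover have "ppart x \<oplus> (z \<ominus> ppart x) = z" "ppart x \<ominus> z \<oplus> (z \<ominus> ppart x) = \<zero>"
    using assms p by (simp_all add: a_minus_def a_ac r_neg r_neg1 r_neg2)
  ultimately show ?thesis by simp
qed

text \<open>Both \<open>y\<close> and \<open>\<zero>\<close> lie below
  \<open>y \<oplus> ppart (\<ominus> y)\<close>.\<close>

lemma ppart_diff_le:
  assumes y: "y \<in> carrier E"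
  shows "ppart y \<ominus> y \<preceq> ppart (\<ominus> y)"
proof -
  note p = ppart[of "\<ominus> y"]
  have "ppart y \<preceq> y \<oplus> ppart (\<ominus> y)"
  proof (rule ppart(4)[OF y])
    have "y \<oplus> \<zero> \<preceq> y \<oplus> ppart (\<ominus> y)" using y p by (intro vle_add_mono vle_refl) auto
    then show "y \<preceq> y \<oplus> ppart (\<ominus> y)" using y by simp
    have "y \<oplus> \<ominus> y \<preceq> y \<oplus> ppart (\<ominus> y)" using y p by (intro vle_add_mono vle_refl) auto
    then show "\<zero> \<preceq> y \<oplus> ppart (\<ominus> y)" using y by (simp add: r_neg)
  qed (use y ppart(1) in auto)
  then have "ppart y \<oplus> \<ominus> y \<preceq> y \<oplus> ppart (\<ominus> y) \<oplus> \<ominus> y"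
    using y ppart(1) by (intro vle_translate) auto
  moreover have "y \<oplus> ppart (\<ominus> y) \<oplus> \<ominus> y = ppart (\<ominus> y)"
    using y ppart(1)[of "\<ominus> y"] by (simp add: a_ac r_neg2)
  ultimately show ?thesis by (simp add: a_minus_def)
qed

text \<open>Translation by \<open>y\<close> carries the join of \<open>x \<ominus> y\<close> and
  \<open>\<zero>\<close> to that of \<open>x\<close> and \<open>y\<close>. With the companion for
  meets, an additive map preserves the lattice operations as soon as it preserves positive
  parts.\<close>

lemma join_eq_ppart:
  assumes "x \<in> carrier E" "y \<in> carrier E"
  shows "x \<squnion>\<^bsub>order_of E\<^esub> y = y \<oplus> ppart (x \<ominus> y)"
proof (rule order.join_eqI)
  let ?p = "ppart (x \<ominus> y)"
  have d: "x \<ominus> y \<in> carrier E" using assms by simp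
  note p = ppart[OF d]
  have "y \<oplus> (x \<ominus> y) \<preceq> y \<oplus> ?p" using assms p by (intro vle_add_mono vle_refl) auto
  moreover have "y \<oplus> (x \<ominus> y) = x" using assms by (simp add: add_diff_cancel)
  moreover have "y \<oplus> \<zero> \<preceq> y \<oplus> ?p" using assms p by (intro vle_add_mono vle_refl) auto
  moreover have "y \<oplus> ?p \<preceq> z" if z: "z \<in> carrier E" "x \<preceq> z" "y \<preceq> z" for z
  proof -
    have "?p \<preceq> z \<ominus> y"
    proof (rule p(4))
      show "x \<ominus> y \<preceq> z \<ominus> y" using vle_translate[of x z "\<ominus> y"] z assms by (simp add: a_minus_def)
      show "\<zero> \<preceq> z \<ominus> y" using z assms vle_iff_diff by blast
    qed (use z assms in auto)
    then have "y \<oplus> ?p \<preceq> y \<oplus> (z \<ominus> y)" using z p assms by (intro vle_add_mono vle_refl) auto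
    moreover have "y \<oplus> (z \<ominus> y) = z" using z assms by (simp add: add_diff_cancel)
    ultimately show ?thesis by simp
  qed
  ultimately show "x \<sqsubseteq>\<^bsub>order_of E\<^esub> y \<oplus> ?p" "y \<sqsubseteq>\<^bsub>order_of E\<^esub> y \<oplus> ?p"
    "z \<in> carrier (order_of E) \<Longrightarrow> x \<sqsubseteq>\<^bsub>order_of E\<^esub> z \<Longrightarrow> y \<sqsubseteq>\<^bsub>order_of E\<^esub> z \<Longrightarrow> y \<oplus> ?p \<sqsubseteq>\<^bsub>order_of E\<^esub> z" for z
    using assms by (simp_all add: order_of_def)
  show "y \<oplus> ?p \<in> carrier (order_of E)"
    using assms p by (simp add: order_of_def)
qed (use assms in \<open>simp_all add: order_of_def\<close>)

lemma meet_eq_ppart: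
  assumes "x \<in> carrier E" "y \<in> carrier E"
  shows "x \<sqinter>\<^bsub>order_of E\<^esub> y = x \<ominus> ppart (x \<ominus> y)"
proof (rule order.meet_eqI)
  let ?p = "ppart (x \<ominus> y)"
  have d: "x \<ominus> y \<in> carrier E" using assms by simp
  note p = ppart[OF d]
  have "\<ominus> ?p \<preceq> \<ominus> (x \<ominus> y)" "\<ominus> ?p \<preceq> \<zero>"
    using p assms vle_translate[of "x \<ominus> y" ?p "\<ominus> ?p \<ominus> (x \<ominus> y)"] vle_translate[of \<zero> ?p "\<ominus> ?p"]
    by (simp_all add: a_minus_def a_ac r_neg r_neg1 r_neg2 minus_add)
  then have "x \<oplus> \<ominus> ?p \<preceq> x \<oplus> \<ominus> (x \<ominus> y)" "x \<oplus> \<ominus> ?p \<preceq> x \<oplus> \<zero>"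
    using assms p d by (auto intro!: vle_add_mono vle_refl simp del: r_zero)
  moreover have "x \<oplus> \<ominus> (x \<ominus> y) = y"
    using assms by (simp add: a_minus_def minus_add r_neg2)
  ultimately have le: "x \<ominus> ?p \<preceq> y" "x \<ominus> ?p \<preceq> x"
    using assms by (simp_all add: a_minus_def[of _ x ?p])
  have "z \<preceq> x \<ominus> ?p" if z: "z \<in> carrier E" "z \<preceq> x" "z \<preceq> y" for z
  proof -
    have "?p \<preceq> x \<ominus> z"
    proof (rule p(4))
      have "x \<oplus> \<ominus> y \<preceq> x \<oplus> \<ominus> z"
        using z assms by (intro vle_add_mono vle_refl vle_minus) auto
      then show "x \<ominus> y \<preceq> x \<ominus> z" by (simp add: a_minus_def)
      show "\<zero> \<preceq> x \<ominus> z" using z assms vle_iff_diff by blast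
    qed (use z assms in auto)
    then have "?p \<oplus> (z \<ominus> ?p) \<preceq> x \<ominus> z \<oplus> (z \<ominus> ?p)" using z p assms by (intro vle_translate) auto
    then show ?thesis using z assms p by (simp add: a_minus_def a_ac r_neg r_neg1 r_neg2)
  qed
  with le show "x \<ominus> ?p \<sqsubseteq>\<^bsub>order_of E\<^esub> x" "x \<ominus> ?p \<sqsubseteq>\<^bsub>order_of E\<^esub> y"
    "z \<in> carrier (order_of E) \<Longrightarrow> z \<sqsubseteq>\<^bsub>order_of E\<^esub> x \<Longrightarrow> z \<sqsubseteq>\<^bsub>order_of E\<^esub> y \<Longrightarrow> z \<sqsubseteq>\<^bsub>order_of E\<^esub> x \<ominus> ?p" for z
    by (simp_all add: order_of_def)
  show "x \<ominus> ?p \<in> carrier (order_of E)"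
    using assms p by (simp add: order_of_def)
qed (use assms in \<open>simp_all add: order_of_def\<close>)

section \<open>The lattice of principal ideals\<close>

lemma Idc_partial_order: "partial_order (Idc E)"
  by unfold_locales (auto simp: Idc_def)

lemma Idc_simps:
  "carrier (Idc E) = principal_ideal E ` pos_cone E" "I \<sqsubseteq>\<^bsub>Idc E\<^esub> J \<longleftrightarrow> I \<subseteq> J"
  by (simp_all add: Idc_def)

lemma Idc_join:
  assumes a: "a \<in> pos_cone E" and b: "b \<in> pos_cone E"
  shows "principal_ideal E a \<squnion>\<^bsub>Idc E\<^esub> principal_ideal E b = principal_ideal E (a \<oplus> b)"
proof (rule partial_order.join_eqI[OF Idc_partial_order])
  have c: "a \<in> carrier E" "b \<in> carrier E" "\<zero> \<preceq> a" "\<zero> \<preceq> b" using a b by (auto simp: pos_cone_def)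
  have ab: "a \<oplus> \<zero> \<preceq> a \<oplus> b" "\<zero> \<oplus> b \<preceq> a \<oplus> b" "\<zero> \<oplus> \<zero> \<preceq> a \<oplus> b"
    using c by (auto intro!: vle_add_mono vle_refl simp del: l_zero r_zero)
  then have s: "a \<oplus> b \<in> pos_cone E" using c by (simp add: pos_cone_def)
  have one: "(0::'k) \<le> 1" using zero_le_square[of "1::'k"] by simp
  have "principal_ideal E a \<subseteq> principal_ideal E (a \<oplus> b)" "principal_ideal E b \<subseteq> principal_ideal E (a \<oplus> b)"
    unfolding principal_ideal_mono_iff[OF a s] principal_ideal_mono_iff[OF b s] using ab c one
    by (intro exI[of _ 1]; simp add: smult_one)+
  moreover have "principal_ideal E (a \<oplus> b) \<subseteq> principal_ideal E d"
    if d: "d \<in> pos_cone E" "principal_ideal E a \<subseteq> principal_ideal E d" "principal_ideal E b \<subseteq> principal_ideal E d" for d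
  proof -
    have dc: "d \<in> carrier E" using d by (auto simp: pos_cone_def)
    obtain e f where "0 \<le> e" "a \<preceq> e \<odot> d" "0 \<le> f" "b \<preceq> f \<odot> d"
      using principal_ideal_mono_iff[OF a d(1)] principal_ideal_mono_iff[OF b d(1)] d by blast
    then have "a \<oplus> b \<preceq> (e + f) \<odot> d" "0 \<le> e + f"
      using c dc by (auto simp: smult_l_distr smult_closed intro!: vle_add_mono)
    then show ?thesis using principal_ideal_mono_iff[OF s d(1)] by blast
  qed
  ultimately show "principal_ideal E a \<sqsubseteq>\<^bsub>Idc E\<^esub> principal_ideal E (a \<oplus> b)"
    "principal_ideal E b \<sqsubseteq>\<^bsub>Idc E\<^esub> principal_ideal E (a \<oplus> b)"
    "I \<in> carrier (Idc E) \<Longrightarrow> principal_ideal E a \<sqsubseteq>\<^bsub>Idc E\<^esub> I \<Longrightarrow> principal_ideal E b \<sqsubseteq>\<^bsub>Idc E\<^esub> I \<Longrightarrow>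
      principal_ideal E (a \<oplus> b) \<sqsubseteq>\<^bsub>Idc E\<^esub> I" for I
    unfolding Idc_simps by blast+
  show "principal_ideal E (a \<oplus> b) \<in> carrier (Idc E)"
    unfolding Idc_simps using s by blast
qed (use a b in \<open>simp_all add: Idc_simps\<close>)

lemma zero_pos_cone: "\<zero> \<in> pos_cone E"
  by (simp add: pos_cone_def vle_refl)

lemma principal_ideal_zero_subset: "a \<in> pos_cone E \<Longrightarrow> principal_ideal E \<zero> \<subseteq> principal_ideal E a"
  unfolding principal_ideal_mono_iff[OF zero_pos_cone]
  by (rule exI[of _ 0]) (simp add: pos_cone_def smult_zero_left vle_refl)

lemma Idc_bottom: "\<bottom>\<^bsub>Idc E\<^esub> = principal_ideal E \<zero>"
  by (rule partial_order.bottom_eqI[OF Idc_partial_order])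
    (use zero_pos_cone principal_ideal_zero_subset in \<open>auto simp: least_def Idc_def\<close>)

lemma Idc_meet_disjoint:
  assumes a: "a \<in> pos_cone E" and b: "b \<in> pos_cone E"
    and ab: "\<And>z. z \<in> carrier E \<Longrightarrow> z \<preceq> a \<Longrightarrow> z \<preceq> b \<Longrightarrow> z \<preceq> \<zero>"
  shows "principal_ideal E a \<sqinter>\<^bsub>Idc E\<^esub> principal_ideal E b = principal_ideal E \<zero>"
proof (rule partial_order.meet_eqI[OF Idc_partial_order])
  have c: "a \<in> carrier E" "b \<in> carrier E" "\<zero> \<preceq> a" "\<zero> \<preceq> b" using a b by (auto simp: pos_cone_def)
  have "principal_ideal E d \<subseteq> principal_ideal E \<zero>"
    if d: "d \<in> pos_cone E" "principal_ideal E d \<subseteq> principal_ideal E a" "principal_ideal E d \<subseteq> principal_ideal E b" for d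
  proof -
    have dc: "d \<in> carrier E" using d by (auto simp: pos_cone_def)
    obtain e f where ef: "0 \<le> e" "d \<preceq> e \<odot> a" "0 \<le> f" "d \<preceq> f \<odot> b"
      using principal_ideal_mono_iff[OF d(1) a] principal_ideal_mono_iff[OF d(1) b] d by blast
    have one: "(0::'k) < 1" using zero_le_square[of "1::'k"] by (simp add: order_less_le)
    \<comment> \<open>A common scalar, made invertible by the summand \<open>1\<close> even if
      \<open>e = f = 0\<close>. Scaling \<open>d\<close> down by it brings \<open>d\<close> below
      both \<open>a\<close> and \<open>b\<close>, where disjointness applies.\<close>
    define g where "g = e + f + 1"
    have g: "0 < g" "e \<le> g" "f \<le> g" 
      using ef one unfolding g_def by (auto simp: add_nonneg_pos add_increasing2 add_increasing less_imp_le)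
    have ig: "0 \<le> inverse g"
      using inverse_pos[of g] g by simp
    have "d \<preceq> g \<odot> a" "d \<preceq> g \<odot> b"
      using vle_trans[OF ef(2) smult_mono_left[of e g a]] vle_trans[OF ef(4) smult_mono_left[of f g b]] g c dc
      by (simp_all add: smult_closed)
    then have "inverse g \<odot> d \<preceq> inverse g \<odot> (g \<odot> a)" "inverse g \<odot> d \<preceq> inverse g \<odot> (g \<odot> b)"
      using ig c dc by (auto intro!: smult_mono smult_closed)
    then have "inverse g \<odot> d \<preceq> \<zero>"
      using g c dc by (intro ab) (simp_all add: smult_assoc[symmetric] smult_one smult_closed)
    then have "g \<odot> (inverse g \<odot> d) \<preceq> g \<odot> \<zero>"
      using g dc by (intro smult_mono) (auto intro: smult_closed)
    then have "d \<preceq> 0 \<odot> \<zero>"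
      using g dc by (simp add: smult_assoc[symmetric] smult_one smult_zero_right)
    then show ?thesis using principal_ideal_mono_iff[OF d(1) zero_pos_cone] by blast
  qed
  then show "I \<in> carrier (Idc E) \<Longrightarrow> I \<sqsubseteq>\<^bsub>Idc E\<^esub> principal_ideal E a \<Longrightarrow> I \<sqsubseteq>\<^bsub>Idc E\<^esub> principal_ideal E b \<Longrightarrow>
      I \<sqsubseteq>\<^bsub>Idc E\<^esub> principal_ideal E \<zero>" for I
    unfolding Idc_simps by blast
qed (use a b zero_pos_cone principal_ideal_zero_subset in \<open>simp_all add: Idc_simps\<close>)

end

section \<open>The measure induced by \<open>\<phi>\<close> on \<open>E\<close>\<close>

locale closed_zero_hom = vector_lattice E + target: distributive_zero_lattice L
  for E :: "('k::{division_ring, linordered_ring_strict}, 'e, 'm) ordered_module_scheme" (structure)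
    and L :: "('l, 'n) gorder_scheme" +
  fixes \<phi> :: "'e set \<Rightarrow> 'l"
  assumes target_normal: "completely_normal L"
    and hom: "zero_lattice_hom (Idc E) L \<phi>"
    and closed: "closed_map (Idc E) L \<phi>"
begin

definition pos_meas :: "'e \<Rightarrow> 'l set set" where
  "pos_meas a = prime_filters_of L (\<phi> (principal_ideal E a))"

text \<open>The ideal of the positive part stands for the places where \<open>x\<close> is positive;
  where \<open>x\<close> is negative is recorded by \<open>meas (\<ominus> x)\<close>.\<close>

definition meas :: "'e \<Rightarrow> 'l set set" where
  "meas x = pos_meas (ppart x)"

lemma \<phi>_carrier: "a \<in> pos_cone E \<Longrightarrow> \<phi> (principal_ideal E a) \<in> carrier L"
  using hom unfolding zero_lattice_hom_def lattice_hom_def Idc_simps by blast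

lemma principal_ideal_carrier: "a \<in> pos_cone E \<Longrightarrow> principal_ideal E a \<in> carrier (Idc E)"
  by (simp add: Idc_simps)

lemma \<phi>_join:
  "I \<in> carrier (Idc E) \<Longrightarrow> J \<in> carrier (Idc E) \<Longrightarrow> \<phi> (I \<squnion>\<^bsub>Idc E\<^esub> J) = \<phi> I \<squnion>\<^bsub>L\<^esub> \<phi> J"
  and \<phi>_meet:
  "I \<in> carrier (Idc E) \<Longrightarrow> J \<in> carrier (Idc E) \<Longrightarrow> \<phi> (I \<sqinter>\<^bsub>Idc E\<^esub> J) = \<phi> I \<sqinter>\<^bsub>L\<^esub> \<phi> J"
  and \<phi>_zero: "\<phi> (principal_ideal E \<zero>) = \<bottom>\<^bsub>L\<^esub>"
  using hom unfolding zero_lattice_hom_def lattice_hom_def Idc_bottom by blast+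

lemma pos_meas_add:
  assumes "a \<in> pos_cone E" "b \<in> pos_cone E"
  shows "pos_meas (a \<oplus> b) = pos_meas a \<union> pos_meas b"
  unfolding pos_meas_def
  by (simp add: Idc_join[OF assms, symmetric] \<phi>_join principal_ideal_carrier assms
      target.prime_filters_of_join \<phi>_carrier)

lemma pos_meas_mono_ideal:
  assumes a: "a \<in> pos_cone E" "b \<in> pos_cone E" "principal_ideal E a \<subseteq> principal_ideal E b"
  shows "pos_meas a \<subseteq> pos_meas b"
proof -
  have "principal_ideal E a \<squnion>\<^bsub>Idc E\<^esub> principal_ideal E b = principal_ideal E b"
    using a by (intro partial_order.join_eqI[OF Idc_partial_order]) (simp_all add: Idc_simps)
  then have "\<phi> (principal_ideal E b) = \<phi> (principal_ideal E a) \<squnion>\<^bsub>L\<^esub> \<phi> (principal_ideal E b)"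
    using \<phi>_join[of "principal_ideal E a" "principal_ideal E b"] a principal_ideal_carrier by simp
  then show ?thesis
    unfolding pos_meas_def using target.prime_filters_of_join[OF \<phi>_carrier \<phi>_carrier, OF a(1,2)] by auto
qed

lemma pos_meas_mono:
  assumes a: "a \<in> pos_cone E" "b \<in> pos_cone E" "0 \<le> c" "a \<preceq> c \<odot> b"
  shows "pos_meas a \<subseteq> pos_meas b"
  using assms principal_ideal_mono_iff[OF a(1,2)] by (intro pos_meas_mono_ideal) blast+

lemma pos_meas_mono':
  assumes a: "a \<in> pos_cone E" "b \<in> pos_cone E" "a \<preceq> b"
  shows "pos_meas a \<subseteq> pos_meas b"
  using pos_meas_mono[OF a(1,2), of 1] a one_pos[where ?'k='k]
  by (auto simp: smult_one pos_cone_def less_imp_le)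

lemma pos_meas_zero: "pos_meas \<zero> = {}"
  by (simp add: pos_meas_def \<phi>_zero target.prime_filters_of_bottom)

lemma pos_meas_disjoint:
  assumes a: "a \<in> pos_cone E" and b: "b \<in> pos_cone E"
    and ab: "\<And>z. z \<in> carrier E \<Longrightarrow> z \<preceq> a \<Longrightarrow> z \<preceq> b \<Longrightarrow> z \<preceq> \<zero>"
  shows "pos_meas a \<inter> pos_meas b = {}"
  unfolding pos_meas_def
  by (simp add: target.prime_filters_of_meet[symmetric] \<phi>_carrier a b \<phi>_meet[symmetric]
      principal_ideal_carrier Idc_meet_disjoint[OF a b ab] \<phi>_zero target.prime_filters_of_bottom)

lemma meas_nonneg: "x \<in> pos_cone E \<Longrightarrow> meas x = pos_meas x"
  by (simp add: meas_def ppart_nonneg pos_cone_def)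

lemma meas_nonpos: "x \<in> carrier E \<Longrightarrow> x \<preceq> \<zero> \<Longrightarrow> meas x = {}"
  by (simp add: meas_def ppart_nonpos pos_meas_zero)

lemma meas_Lat: "x \<in> carrier E \<Longrightarrow> meas x \<in> prime_filters_of L ` carrier L"
  by (auto simp: meas_def pos_meas_def intro: \<phi>_carrier ppart_pos_cone)

lemma pos_cone_add: "a \<in> pos_cone E \<Longrightarrow> b \<in> pos_cone E \<Longrightarrow> a \<oplus> b \<in> pos_cone E"
  using vle_add_mono[of \<zero> a \<zero> b] by (simp add: pos_cone_def)

lemma pos_cone_smult: "a \<in> pos_cone E \<Longrightarrow> 0 \<le> c \<Longrightarrow> c \<odot> a \<in> pos_cone E"
  by (simp add: pos_cone_def smult_closed smult_nonneg)

lemma meas_add: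
  assumes "x \<in> carrier E" "y \<in> carrier E"
  shows "meas (x \<oplus> y) \<subseteq> meas x \<union> meas y"
  unfolding meas_def
  using pos_meas_mono'[OF ppart_pos_cone pos_cone_add[OF ppart_pos_cone ppart_pos_cone] ppart_add]
    pos_meas_add[OF ppart_pos_cone ppart_pos_cone] assms by simp

lemma meas_smult:
  assumes "x \<in> carrier E" "0 \<le> c"
  shows "meas (c \<odot> x) \<subseteq> meas x"
  unfolding meas_def
  using pos_meas_mono[OF ppart_pos_cone ppart_pos_cone assms(2) ppart_smult] assms smult_closed by simp

lemma meas_disjoint: "x \<in> carrier E \<Longrightarrow> meas x \<inter> meas (\<ominus> x) = {}"
  unfolding meas_def by (intro pos_meas_disjoint ppart_pos_cone ppart_disjoint) auto

lemma meas_mono: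
  assumes "x \<in> carrier E" "y \<in> pos_cone E" "x \<preceq> y"
  shows "meas x \<subseteq> pos_meas y"
  unfolding meas_def using assms
  by (intro pos_meas_mono' ppart_pos_cone ppart(4)) (auto simp: pos_cone_def)

text \<open>The Stone map turns the inclusion into an inequality in \<open>L\<close>, and closedness
  lifts it to \<open>ppart x \<preceq> c \<odot> (ppart y \<oplus> w)\<close> with \<open>w\<close>
  measured inside \<open>X\<close>. Subtracting \<open>c \<odot> y\<close> leaves, up to the factor
  \<open>c\<close>, the negative part of \<open>y\<close>, which is null on \<open>meas y\<close>,
  and \<open>w\<close>.\<close>

lemma meas_closed:
  assumes x: "x \<in> carrier E" and y: "y \<in> carrier E" and X: "X \<in> prime_filters_of L ` carrier L"
    and sub: "meas x \<subseteq> meas y \<union> X"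
  shows "\<exists>c\<ge>0. meas (x \<ominus> c \<odot> y) \<inter> meas y \<subseteq> X"
proof -
  obtain l where l: "l \<in> carrier L" "X = prime_filters_of L l" using X by blast
  note px = ppart_pos_cone[OF x] and py = ppart_pos_cone[OF y]
  have le: "\<phi> (principal_ideal E (ppart x)) \<sqsubseteq>\<^bsub>L\<^esub> \<phi> (principal_ideal E (ppart y)) \<squnion>\<^bsub>L\<^esub> l"
    using sub l \<phi>_carrier[OF px] \<phi>_carrier[OF py]
    by (simp add: meas_def pos_meas_def target.prime_filters_of_join[symmetric]
        target.prime_filters_of_subset_iff)
  obtain U where U: "U \<in> carrier (Idc E)"
    "principal_ideal E (ppart x) \<sqsubseteq>\<^bsub>Idc E\<^esub> principal_ideal E (ppart y) \<squnion>\<^bsub>Idc E\<^esub> U" "\<phi> U \<sqsubseteq>\<^bsub>L\<^esub> l"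
    using closed[unfolded closed_map_def, rule_format, OF principal_ideal_carrier[OF px]
        principal_ideal_carrier[OF py] l(1) le] by blast
  obtain w where w: "w \<in> pos_cone E" "U = principal_ideal E w" using U(1) by (auto simp: Idc_simps)
  have wX: "pos_meas w \<subseteq> X"
    using U(3) l w target.prime_filters_of_subset_iff[OF \<phi>_carrier[OF w(1)] l(1)] by (simp add: pos_meas_def)
  have "principal_ideal E (ppart x) \<subseteq> principal_ideal E (ppart y \<oplus> w)"
    using U(2) Idc_join[OF py w(1)] w(2) by (simp add: Idc_simps)
  then obtain c where c: "0 \<le> c" "ppart x \<preceq> c \<odot> (ppart y \<oplus> w)"
    using principal_ideal_mono_iff[OF px pos_cone_add[OF py w(1)]] by blast
  \<comment> \<open>The negative part of \<open>y\<close>, bounded by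
    \<open>ppart (\<ominus> y)\<close> and therefore measured off \<open>meas y\<close>.\<close>
  define v where "v = ppart y \<ominus> y"
  have car: "ppart x \<in> carrier E" "ppart y \<in> carrier E" "w \<in> carrier E" "v \<in> carrier E"
    using px py w(1) y by (auto simp: pos_cone_def v_def)
  have v: "v \<in> pos_cone E"
    using ppart(3)[OF y] vle_iff_diff[of y "ppart y"] y car by (simp add: pos_cone_def v_def)
  have "v \<preceq> ppart (\<ominus> y)"
    unfolding v_def by (rule ppart_diff_le[OF y])
  then have vm: "pos_meas v \<subseteq> meas (\<ominus> y)"
    unfolding meas_def using v y by (intro pos_meas_mono' ppart_pos_cone) auto
  have "x \<ominus> c \<odot> y \<preceq> c \<odot> (v \<oplus> w)"
  proof -
    have "x \<preceq> c \<odot> (ppart y \<oplus> w)"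
      using vle_trans[OF ppart(3)[OF x] c(2)] x car by (simp add: smult_closed)
    then have "x \<oplus> \<ominus> (c \<odot> y) \<preceq> c \<odot> (ppart y \<oplus> w) \<oplus> \<ominus> (c \<odot> y)"
      using x y car by (intro vle_translate) (auto intro: smult_closed)
    moreover have "c \<odot> (ppart y \<oplus> w) \<oplus> \<ominus> (c \<odot> y) = c \<odot> (v \<oplus> w)"
    proof -
      have "v \<oplus> w = (ppart y \<oplus> w) \<ominus> y"
        using car y unfolding v_def by (simp add: a_minus_def a_ac)
      then show ?thesis using car y by (simp add: smult_diff_right) (simp add: a_minus_def)
    qed
    ultimately show ?thesis by (simp add: a_minus_def)
  qed
  then have "meas (x \<ominus> c \<odot> y) \<subseteq> pos_meas (c \<odot> (v \<oplus> w))"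
    using x y v w c by (intro meas_mono pos_cone_smult pos_cone_add) (auto intro: smult_closed)
  also have "\<dots> \<subseteq> pos_meas (v \<oplus> w)"
    using v w c by (intro pos_meas_mono[OF _ _ c(1)] pos_cone_smult pos_cone_add vle_refl smult_closed) (auto simp: car)
  also have "\<dots> = pos_meas v \<union> pos_meas w"
    using v w by (intro pos_meas_add)
  finally have "meas (x \<ominus> c \<odot> y) \<inter> meas y \<subseteq> X"
    using vm wX meas_disjoint[OF y] by blast
  then show ?thesis using c(1) by blast
qed

end

section \<open>The vector lattice of a measured vector space\<close>

text \<open>Read \<open>\<nu> (x - y) = {}\<close> as \<open>x \<le> y\<close>. The vector
  \<open>t\<close> of \<open>\<nu>_positive_part\<close> is above \<open>0\<close> and
  \<open>x\<close>, and at no point strictly above both.\<close>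

locale measured_vector_space = left_vector_space scale
  for scale :: "'k::{division_ring,linordered_ring_strict} \<Rightarrow> 'v::ab_group_add \<Rightarrow> 'v" (infixr \<open>\<cdot>\<close> 75) +
  fixes \<nu> :: "'v \<Rightarrow> 'p set"
  assumes countable_space: "countable (UNIV :: 'v set)"
    and \<nu>_add: "\<nu> (x + y) \<subseteq> \<nu> x \<union> \<nu> y"
    and \<nu>_scale: "0 < c \<Longrightarrow> \<nu> (c \<cdot> x) \<subseteq> \<nu> x"
    and \<nu>_disjoint: "\<nu> x \<inter> \<nu> (- x) = {}"
    and \<nu>_positive_part: "\<exists>t. \<nu> (- t) = {} \<and> \<nu> (x - t) = {} \<and> \<nu> t \<inter> \<nu> (t - x) = {}"
    and \<nu>_archimedean: "\<nu> (- a) = {} \<Longrightarrow> \<nu> (- b) = {} \<Longrightarrow> \<nu> a \<subseteq> \<nu> b \<Longrightarrow> \<exists>c\<ge>0. \<nu> (a - c \<cdot> b) = {}"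
begin

lemma \<nu>_zero: "\<nu> 0 = {}"
  using \<nu>_disjoint[of 0] by simp

lemma \<nu>_trans: "\<nu> (x - y) = {} \<Longrightarrow> \<nu> (y - z) = {} \<Longrightarrow> \<nu> (x - z) = {}"
  using \<nu>_add[of "x - y" "y - z"] by simp

lemma \<nu>_scale_nonneg: "0 \<le> c \<Longrightarrow> \<nu> (c \<cdot> x) \<subseteq> \<nu> x"
  using \<nu>_scale[of c x] \<nu>_zero by (cases "c = 0") (auto simp: order_le_less)

lemma \<nu>_mono: "\<nu> (x - y) = {} \<Longrightarrow> \<nu> x \<subseteq> \<nu> y"
  using \<nu>_add[of "x - y" y] by simp

definition kin :: "'v \<Rightarrow> 'v \<Rightarrow> bool" where
  "kin x y \<longleftrightarrow> \<nu> (x - y) = {} \<and> \<nu> (y - x) = {}"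

lemma kin_refl: "kin x x"
  by (simp add: kin_def \<nu>_zero)

lemma kin_sym: "kin x y \<Longrightarrow> kin y x"
  by (simp add: kin_def)

lemma kin_trans: "kin x y \<Longrightarrow> kin y z \<Longrightarrow> kin x z"
  using \<nu>_trans unfolding kin_def by blast

text \<open>A class is encoded as the number of a chosen representative. The choice is made from the
  predicate \<open>kin x\<close>, which is the same for all members of the class.\<close>

definition code :: "'v \<Rightarrow> nat" where
  "code x = to_nat_on UNIV (SOME y. kin x y)"

definition decode :: "nat \<Rightarrow> 'v" where
  "decode = from_nat_into UNIV"

lemma decode_code: "kin x (decode (code x))"
proof -
  have "decode (code x) = (SOME y. kin x y)"
    using countable_space by (simp add: decode_def code_def)
  then show ?thesis
    using someI[of "kin x" x] kin_refl by simp
qed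

lemma code_eq_iff: "code x = code y \<longleftrightarrow> kin x y"
proof
  show "kin x y" if "code x = code y"
    using decode_code[of x] decode_code[of y] that kin_sym kin_trans by metis
  assume "kin x y"
  then have "kin x = kin y"
    using kin_sym kin_trans by (intro ext) blast
  then show "code x = code y"
    by (simp add: code_def)
qed

lemma kin_add:
  assumes "kin x x'" "kin y y'"
  shows "kin (x + y) (x' + y')"
  using \<nu>_add[of "x - x'" "y - y'"] \<nu>_add[of "x' - x" "y' - y"] assms
  unfolding kin_def by (simp add: algebra_simps)

lemma kin_minus: "kin x x' \<Longrightarrow> kin (- x) (- x')"
  unfolding kin_def by simp

lemma kin_scale:
  assumes "kin x x'"
  shows "kin (c \<cdot> x) (c \<cdot> x')"
proof -
  have *: "kin (c \<cdot> x) (c \<cdot> x')" if "0 \<le> c" for c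
    using \<nu>_scale_nonneg[OF that, of "x - x'"] \<nu>_scale_nonneg[OF that, of "x' - x"] assms
    unfolding kin_def by (simp add: scale_diff_right)
  show ?thesis
    using *[of c] kin_minus[OF *[of "- c"]] by (cases "0 \<le> c") auto
qed

lemma kin_le:
  assumes "kin x x'" "kin y y'" "\<nu> (x - y) = {}"
  shows "\<nu> (x' - y') = {}"
  using \<nu>_trans[of x' x y] \<nu>_trans[of x' y y'] assms unfolding kin_def by simp

definition quotient :: "('k, nat) ordered_module" where
  "quotient = \<lparr>carrier = range code, mult = undefined, one = undefined, zero = code 0,
     add = (\<lambda>m n. code (decode m + decode n)), smult = (\<lambda>c n. code (c \<cdot> decode n)),
     vle = (\<lambda>m n. \<nu> (decode m - decode n) = {})\<rparr>"

lemma quotient_simps: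
  "carrier quotient = range code" "\<zero>\<^bsub>quotient\<^esub> = code 0"
  "code x \<oplus>\<^bsub>quotient\<^esub> code y = code (x + y)" "c \<odot>\<^bsub>quotient\<^esub> code x = code (c \<cdot> x)"
  "code x \<preceq>\<^bsub>quotient\<^esub> code y \<longleftrightarrow> \<nu> (x - y) = {}"
proof -
  show "code x \<oplus>\<^bsub>quotient\<^esub> code y = code (x + y)"
    unfolding quotient_def using code_eq_iff kin_add[OF decode_code decode_code] kin_sym by simp
  show "c \<odot>\<^bsub>quotient\<^esub> code x = code (c \<cdot> x)"
    unfolding quotient_def using code_eq_iff kin_scale[OF decode_code] kin_sym by simp
  show "code x \<preceq>\<^bsub>quotient\<^esub> code y \<longleftrightarrow> \<nu> (x - y) = {}"
    unfolding quotient_def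
    using kin_le[OF decode_code decode_code, of x y] kin_le[OF kin_sym[OF decode_code] kin_sym[OF decode_code], of x y]
    by auto
qed (simp_all add: quotient_def)

lemma quotient_order_simps:
  "carrier (order_of quotient) = range code" "m .=\<^bsub>order_of quotient\<^esub> n \<longleftrightarrow> m = n"
  "code x \<sqsubseteq>\<^bsub>order_of quotient\<^esub> code y \<longleftrightarrow> \<nu> (x - y) = {}"
  by (simp_all add: order_of_def quotient_simps)

lemma quotient_partial_order: "partial_order (order_of quotient)"
proof
  show "m .=\<^bsub>order_of quotient\<^esub> n" if mn: "m \<sqsubseteq>\<^bsub>order_of quotient\<^esub> n" "n \<sqsubseteq>\<^bsub>order_of quotient\<^esub> m"
      "m \<in> carrier (order_of quotient)" "n \<in> carrier (order_of quotient)" for m n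
  proof -
    obtain x y where xy: "m = code x" "n = code y"
      using mn(3,4) by (auto simp: quotient_order_simps)
    then have "kin x y"
      using mn(1,2) by (simp add: quotient_order_simps kin_def)
    then show ?thesis
      using xy code_eq_iff[of x y] by (simp add: quotient_order_simps)
  qed
  show "m \<sqsubseteq>\<^bsub>order_of quotient\<^esub> k" if mnk: "m \<sqsubseteq>\<^bsub>order_of quotient\<^esub> n" "n \<sqsubseteq>\<^bsub>order_of quotient\<^esub> k"
      "m \<in> carrier (order_of quotient)" "n \<in> carrier (order_of quotient)" "k \<in> carrier (order_of quotient)" for m n k
  proof -
    obtain x y z where "m = code x" "n = code y" "k = code z"
      using mnk(3-5) by (auto simp: quotient_order_simps)
    then show ?thesis
      using mnk(1,2) \<nu>_trans[of x y z] by (simp add: quotient_order_simps)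
  qed
  show "(.=\<^bsub>order_of quotient\<^esub>) = (=)"
    by (simp add: order_of_def)
qed (auto simp: quotient_order_simps \<nu>_zero)

text \<open>For an upper bound \<open>z\<close>, writing \<open>y + t - z\<close> as
  \<open>(y - z) + t\<close> and as \<open>(x - z) + (t - (x - y))\<close> confines its measure to
  both of the disjoint sets \<open>\<nu> t\<close> and \<open>\<nu> (t - (x - y))\<close>. Lower
  bounds are treated in the same way.\<close>

lemma positive_part_least:
  assumes "\<nu> (- t) = {}" "\<nu> (x - y - t) = {}" "\<nu> t \<inter> \<nu> (t - (x - y)) = {}"
  shows "least (order_of quotient) (code (y + t)) (Upper (order_of quotient) {code x, code y})"
    and "greatest (order_of quotient) (code (x - t)) (Lower (order_of quotient) {code x, code y})"
proof -
  have "\<nu> (y + t - z) = {}" if "\<nu> (x - z) = {}" "\<nu> (y - z) = {}" for z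
    using \<nu>_add[of "y - z" t] \<nu>_add[of "x - z" "t - (x - y)"] assms(3) that by (simp add: algebra_simps) blast
  then show "least (order_of quotient) (code (y + t)) (Upper (order_of quotient) {code x, code y})"
    unfolding least_def Upper_def quotient_order_simps using assms(1,2)
    by (auto simp: quotient_order_simps algebra_simps)
  have "\<nu> (z - (x - t)) = {}" if "\<nu> (z - x) = {}" "\<nu> (z - y) = {}" for z
    using \<nu>_add[of "z - x" t] \<nu>_add[of "z - y" "t - (x - y)"] assms(3) that by (simp add: algebra_simps) blast
  then show "greatest (order_of quotient) (code (x - t)) (Lower (order_of quotient) {code x, code y})"
    unfolding greatest_def Lower_def quotient_order_simps using assms(1,2)
    by (auto simp: quotient_order_simps algebra_simps)
qed

lemma quotient_vector_lattice: "vector_lattice quotient"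
proof -
  have "abelian_group quotient"
  proof (rule abelian_groupI)
    show "\<exists>m\<in>carrier quotient. m \<oplus>\<^bsub>quotient\<^esub> n = \<zero>\<^bsub>quotient\<^esub>" if n: "n \<in> carrier quotient" for n
    proof -
      obtain x where "n = code x" using n by (auto simp: quotient_simps)
      then show ?thesis by (intro bexI[of _ "code (- x)"]) (simp_all add: quotient_simps)
    qed
  qed (auto simp: quotient_simps ac_simps)
  then interpret abelian_group quotient .
  interpret partial_order "order_of quotient" by (rule quotient_partial_order)
  have *: "(\<exists>s. least (order_of quotient) s (Upper (order_of quotient) {m, n})) \<and>
      (\<exists>s. greatest (order_of quotient) s (Lower (order_of quotient) {m, n}))"
    if mn: "m \<in> carrier (order_of quotient)" "n \<in> carrier (order_of quotient)" for m n
  proof -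
    obtain x y where xy: "m = code x" "n = code y" using mn by (auto simp: quotient_order_simps)
    obtain t where "\<nu> (- t) = {}" "\<nu> (x - y - t) = {}" "\<nu> t \<inter> \<nu> (t - (x - y)) = {}"
      using \<nu>_positive_part by blast
    then show ?thesis using positive_part_least[of t x y] unfolding xy by blast
  qed
  interpret lattice "order_of quotient"
    by unfold_locales (use * in blast)+
  show ?thesis
  proof
    show "c \<odot>\<^bsub>quotient\<^esub> m \<in> carrier quotient" if "m \<in> carrier quotient" for c m
      using that by (auto simp: quotient_simps)
    show "(c + d) \<odot>\<^bsub>quotient\<^esub> m = c \<odot>\<^bsub>quotient\<^esub> m \<oplus>\<^bsub>quotient\<^esub> d \<odot>\<^bsub>quotient\<^esub> m" if "m \<in> carrier quotient" for c d m
      using that by (auto simp: quotient_simps scale_add_left)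
    show "c \<odot>\<^bsub>quotient\<^esub> (m \<oplus>\<^bsub>quotient\<^esub> n) = c \<odot>\<^bsub>quotient\<^esub> m \<oplus>\<^bsub>quotient\<^esub> c \<odot>\<^bsub>quotient\<^esub> n"
      if "m \<in> carrier quotient" "n \<in> carrier quotient" for c m n
      using that by (auto simp: quotient_simps scale_add_right)
    show "(c * d) \<odot>\<^bsub>quotient\<^esub> m = c \<odot>\<^bsub>quotient\<^esub> (d \<odot>\<^bsub>quotient\<^esub> m)" if "m \<in> carrier quotient" for c d m
      using that by (auto simp: quotient_simps scale_scale)
    show "1 \<odot>\<^bsub>quotient\<^esub> m = m" if "m \<in> carrier quotient" for m
      using that by (auto simp: quotient_simps)
    show "m \<oplus>\<^bsub>quotient\<^esub> k \<preceq>\<^bsub>quotient\<^esub> n \<oplus>\<^bsub>quotient\<^esub> k"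
      if "m \<in> carrier quotient" "n \<in> carrier quotient" "k \<in> carrier quotient" "m \<preceq>\<^bsub>quotient\<^esub> n" for m n k
      using that by (auto simp: quotient_simps)
    show "\<zero>\<^bsub>quotient\<^esub> \<preceq>\<^bsub>quotient\<^esub> c \<odot>\<^bsub>quotient\<^esub> m"
      if cm: "m \<in> carrier quotient" "0 \<le> c" "\<zero>\<^bsub>quotient\<^esub> \<preceq>\<^bsub>quotient\<^esub> m" for c m
    proof -
      obtain x where x: "m = code x" using cm(1) by (auto simp: quotient_simps)
      then have "\<nu> (- x) = {}" using cm(3) by (simp add: quotient_simps)
      then have "\<nu> (- (c \<cdot> x)) = {}" using \<nu>_scale_nonneg[OF cm(2), of "- x"] by simp
      then show ?thesis by (simp add: x quotient_simps)
    qed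
  qed
qed

lemma code_join:
  assumes "\<nu> (- t) = {}" "\<nu> (x - y - t) = {}" "\<nu> t \<inter> \<nu> (t - (x - y)) = {}"
  shows "code x \<squnion>\<^bsub>order_of quotient\<^esub> code y = code (y + t)"
    and "code x \<sqinter>\<^bsub>order_of quotient\<^esub> code y = code (x - t)"
proof -
  interpret partial_order "order_of quotient" by (rule quotient_partial_order)
  note l = positive_part_least(1)[OF assms] and g = positive_part_least(2)[OF assms]
  show "code x \<squnion>\<^bsub>order_of quotient\<^esub> code y = code (y + t)"
    unfolding join_def sup_def using l least_unique by (intro some_equality) blast+
  show "code x \<sqinter>\<^bsub>order_of quotient\<^esub> code y = code (x - t)"
    unfolding meet_def inf_def using g greatest_unique by (intro some_equality) blast+
qed

lemma pos_cone_quotient: "pos_cone quotient = code ` {a. \<nu> (- a) = {}}"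
  by (auto simp: pos_cone_def quotient_simps)

text \<open>A bound of \<open>a\<close> by a multiple of \<open>b\<close> gives the inclusion by
  monotonicity and homogeneity of \<open>\<nu>\<close>; the converse is the purpose of
  \<open>\<nu>_archimedean\<close>. So the ideal of \<open>a\<close> and the set
  \<open>\<nu> a\<close> determine each other.\<close>

lemma principal_ideal_quotient_subset_iff:
  assumes "\<nu> (- a) = {}" "\<nu> (- b) = {}"
  shows "principal_ideal quotient (code a) \<subseteq> principal_ideal quotient (code b) \<longleftrightarrow> \<nu> a \<subseteq> \<nu> b"
proof -
  interpret vector_lattice quotient by (rule quotient_vector_lattice)
  have "principal_ideal quotient (code a) \<subseteq> principal_ideal quotient (code b) \<longleftrightarrow> (\<exists>c\<ge>0. \<nu> (a - c \<cdot> b) = {})"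
    using principal_ideal_mono_iff[of "code a" "code b"] assms
    by (auto simp: pos_cone_quotient quotient_simps)
  also have "\<dots> \<longleftrightarrow> \<nu> a \<subseteq> \<nu> b"
  proof
    show "\<nu> a \<subseteq> \<nu> b" if "\<exists>c\<ge>0. \<nu> (a - c \<cdot> b) = {}"
    proof -
      obtain c where "0 \<le> c" "\<nu> (a - c \<cdot> b) = {}" using \<open>\<exists>c\<ge>0. \<nu> (a - c \<cdot> b) = {}\<close> by (elim exE conjE)
      then show ?thesis using \<nu>_mono[of a "c \<cdot> b"] \<nu>_scale_nonneg[of c b] by simp
    qed
  qed (rule \<nu>_archimedean[OF assms])
  finally show ?thesis .
qed

end

text \<open>\<open>K\<close> is only known to be partially ordered: preimages under \<open>g\<close>
  of joins and meets of \<open>L\<close> are joins and meets in \<open>K\<close>, because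
  \<open>g\<close> preserves and reflects the order.\<close>

lemma order_iso_lattice_iso:
  assumes K: "partial_order K" and L: "lattice L" and bij: "bij_betw g (carrier K) (carrier L)"
    and iff: "\<And>x y. x \<in> carrier K \<Longrightarrow> y \<in> carrier K \<Longrightarrow> x \<sqsubseteq>\<^bsub>K\<^esub> y \<longleftrightarrow> g x \<sqsubseteq>\<^bsub>L\<^esub> g y"
  shows "lattice_iso K L g"
proof -
  interpret L: lattice L by (rule L)
  have g: "g x \<in> carrier L" if "x \<in> carrier K" for x
    using bij that bij_betwE by blast
  have surj: "\<exists>x\<in>carrier K. g x = y" if "y \<in> carrier L" for y
    using bij that unfolding bij_betw_def by (metis imageE)
  have "g (x \<squnion>\<^bsub>K\<^esub> y) = g x \<squnion>\<^bsub>L\<^esub> g y \<and> g (x \<sqinter>\<^bsub>K\<^esub> y) = g x \<sqinter>\<^bsub>L\<^esub> g y"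
    if xy: "x \<in> carrier K" "y \<in> carrier K" for x y
  proof -
    obtain s where s: "s \<in> carrier K" "g s = g x \<squnion>\<^bsub>L\<^esub> g y"
      using surj[OF L.join_closed[OF g[OF xy(1)] g[OF xy(2)]]] by blast
    obtain i where i: "i \<in> carrier K" "g i = g x \<sqinter>\<^bsub>L\<^esub> g y"
      using surj[OF L.meet_closed[OF g[OF xy(1)] g[OF xy(2)]]] by blast
    have "x \<squnion>\<^bsub>K\<^esub> y = s"
      using xy s g iff L.join_left L.join_right L.join_le
      by (intro partial_order.join_eqI[OF K]) simp_all
    moreover have "x \<sqinter>\<^bsub>K\<^esub> y = i"
      using xy i g iff L.meet_left L.meet_right L.meet_le
      by (intro partial_order.meet_eqI[OF K]) simp_all
    ultimately show ?thesis using s i by simp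
  qed
  then show ?thesis
    unfolding lattice_iso_def lattice_hom_def using g bij by blast
qed

section \<open>Adjoining free generators\<close>

definition pm_scale :: "'k::division_ring \<Rightarrow> ('a \<Rightarrow>\<^sub>0 'k) \<Rightarrow> 'a \<Rightarrow>\<^sub>0 'k" where
  "pm_scale c x = Poly_Mapping.map ((*) c) x"

lemma lookup_pm_scale: "Poly_Mapping.lookup (pm_scale c x) i = c * Poly_Mapping.lookup x i"
  unfolding pm_scale_def by transfer (auto simp: when_def)

interpretation pm: left_vector_space
  "pm_scale :: 'k::{division_ring,linordered_ring_strict} \<Rightarrow> (nat \<Rightarrow>\<^sub>0 'k) \<Rightarrow> nat \<Rightarrow>\<^sub>0 'k"
  by unfold_locales
    (auto intro!: poly_mapping_eqI simp: lookup_pm_scale lookup_add distrib_left distrib_right mult.assoc)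

text \<open>A finitely supported function is determined by its graph over its support, a finite
  subset of a countable set.\<close>

lemma countable_poly_mapping:
  assumes "countable (UNIV :: 'k set)"
  shows "countable (UNIV :: (nat \<Rightarrow>\<^sub>0 'k::zero) set)"
proof (rule countable_image_inj_on)
  let ?g = "\<lambda>x :: nat \<Rightarrow>\<^sub>0 'k. (\<lambda>i. (i, Poly_Mapping.lookup x i)) ` Poly_Mapping.keys x"
  have "countable (UNIV :: (nat \<times> 'k) set)"
    using countable_SIGMA[of "UNIV :: nat set" "\<lambda>_. UNIV :: 'k set"] assms by simp
  then have "countable {A :: (nat \<times> 'k) set. finite A \<and> A \<subseteq> UNIV}"
    by (rule countable_Collect_finite_subset)
  then show "countable (range ?g)"
    by (rule countable_subset[rotated]) auto
  show "inj ?g"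
  proof (rule injI, rule poly_mapping_eqI)
    fix x y i assume eq: "?g x = ?g y"
    have *: "(i, Poly_Mapping.lookup z i) \<in> ?g z \<longleftrightarrow> Poly_Mapping.lookup z i \<noteq> 0" for z
      by (auto simp: in_keys_iff)
    have **: "(i, a) \<in> ?g z \<Longrightarrow> a = Poly_Mapping.lookup z i" for a z
      by auto
    show "Poly_Mapping.lookup x i = Poly_Mapping.lookup y i"
    proof (cases "Poly_Mapping.lookup x i = 0")
      case True
      then show ?thesis
        using *[of y] **[of "Poly_Mapping.lookup y i" x] unfolding eq[symmetric] by argo
    next
      case False
      then show ?thesis
        using *[of x] **[of "Poly_Mapping.lookup x i" y] unfolding eq by argo
    qed
  qed
qed

section \<open>Evaluation of finitely supported functions in \<open>E\<close>\<close>

context closed_zero_hom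
begin

text \<open>The even coordinates map onto \<open>E\<close>; the odd ones are the free generators.\<close>

definition gen :: "nat \<Rightarrow> 'e" where
  "gen i = from_nat_into (carrier E) (i div 2)"

lemma gen_closed: "gen i \<in> carrier E"
  unfolding gen_def by (rule from_nat_into) auto

text \<open>Odd coordinates are evaluated as well, but the measure is taken from \<open>ev\<close>
  on \<open>V0\<close> only.\<close>

definition ev :: "(nat \<Rightarrow>\<^sub>0 'k) \<Rightarrow> 'e" where
  "ev x = (\<Oplus>i\<in>Poly_Mapping.keys x. Poly_Mapping.lookup x i \<odot> gen i)"

lemma term_closed: "(\<lambda>i. c i \<odot> gen i) \<in> A \<rightarrow> carrier E"
  by (simp add: gen_closed smult_closed)

lemma ev_closed: "ev x \<in> carrier E"
  unfolding ev_def by (intro finsum_closed term_closed)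

lemma ev_superset:
  assumes "finite K" "Poly_Mapping.keys x \<subseteq> K"
  shows "ev x = (\<Oplus>i\<in>K. Poly_Mapping.lookup x i \<odot> gen i)"
  unfolding ev_def
  by (rule add.finprod_mono_neutral_cong_left[OF assms])
    (auto simp: in_keys_iff smult_zero_left gen_closed smult_closed)

lemma ev_add: "ev (x + y) = ev x \<oplus> ev y"
proof -
  let ?K = "Poly_Mapping.keys x \<union> Poly_Mapping.keys y"
  have K: "finite ?K" by simp
  have "ev (x + y) = (\<Oplus>i\<in>?K. Poly_Mapping.lookup x i \<odot> gen i \<oplus> Poly_Mapping.lookup y i \<odot> gen i)"
    using ev_superset[OF K, of "x + y"] keys_add[of x y]
    by (simp add: lookup_add smult_l_distr gen_closed)
  also have "\<dots> = (\<Oplus>i\<in>?K. Poly_Mapping.lookup x i \<odot> gen i) \<oplus> (\<Oplus>i\<in>?K. Poly_Mapping.lookup y i \<odot> gen i)"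
    by (intro finsum_addf term_closed)
  also have "\<dots> = ev x \<oplus> ev y"
    using ev_superset[OF K, of x] ev_superset[OF K, of y] by simp
  finally show ?thesis .
qed

lemma smult_finsum:
  "finite K \<Longrightarrow> f \<in> K \<rightarrow> carrier E \<Longrightarrow> c \<odot> (\<Oplus>i\<in>K. f i) = (\<Oplus>i\<in>K. c \<odot> f i)"
  by (induction K rule: finite_induct)
    (auto simp: smult_zero_right smult_r_distr smult_closed Pi_def)

lemma ev_scale: "ev (pm_scale c x) = c \<odot> ev x"
proof -
  have "Poly_Mapping.keys (pm_scale c x) \<subseteq> Poly_Mapping.keys x"
    by (auto simp: in_keys_iff lookup_pm_scale)
  then have "ev (pm_scale c x) = (\<Oplus>i\<in>Poly_Mapping.keys x. (c * Poly_Mapping.lookup x i) \<odot> gen i)"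
    using ev_superset[of "Poly_Mapping.keys x" "pm_scale c x"] by (simp add: lookup_pm_scale)
  then show ?thesis
    unfolding ev_def by (simp add: smult_finsum term_closed smult_assoc gen_closed)
qed

lemma ev_minus: "ev (- x) = \<ominus> ev x"
  using ev_scale[of "- 1" x] ev_add[of x "- x"] ev_scale[of 0 x] ev_closed
  by (simp add: smult_zero_left) (metis add.inv_equality a_comm)

lemma ev_diff: "ev (x - y) = ev x \<ominus> ev y"
  using ev_add[of x "- y"] by (simp add: ev_minus a_minus_def)

definition V0 :: "(nat \<Rightarrow>\<^sub>0 'k) set" where
  "V0 = {x. \<forall>i. odd i \<longrightarrow> Poly_Mapping.lookup x i = 0}"

lemma V0: "x \<in> V0 \<Longrightarrow> y \<in> V0 \<Longrightarrow> x + y \<in> V0" "x \<in> V0 \<Longrightarrow> pm_scale c x \<in> V0" "0 \<in> V0"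
  "x \<in> V0 \<Longrightarrow> y \<in> V0 \<Longrightarrow> x - y \<in> V0" "x \<in> V0 \<Longrightarrow> - x \<in> V0"
  by (simp_all add: V0_def lookup_add lookup_pm_scale lookup_minus)

lemma measured_extension_ev:
  "measured_extension pm_scale V0 (\<lambda>x. meas (ev x)) (prime_filters_of L ` carrier L)"
proof
  let ?Lat = "prime_filters_of L ` carrier L"
  show "\<exists>c\<ge>0. meas (ev (x - pm_scale c y)) \<inter> meas (ev y) \<subseteq> X"
    if "X \<in> ?Lat" "meas (ev x) \<subseteq> meas (ev y) \<union> X" for x y X
    using meas_closed[OF ev_closed ev_closed that] by (simp add: ev_diff ev_scale)
  show "{} \<in> ?Lat"
    using target.prime_filters_of_bottom target.bottom_closed by (metis image_eqI)
  show "A \<union> B \<in> ?Lat" "A \<inter> B \<in> ?Lat" if "A \<in> ?Lat" "B \<in> ?Lat" for A B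
    using that by (auto simp: target.prime_filters_of_join[symmetric] target.prime_filters_of_meet[symmetric])
  show "\<exists>X\<in>?Lat. \<exists>Y\<in>?Lat. A \<union> B = A \<union> Y \<and> A \<union> B = X \<union> B \<and> X \<inter> Y = {}"
    if AB: "A \<in> ?Lat" "B \<in> ?Lat" for A B
  proof -
    obtain a b where ab: "a \<in> carrier L" "b \<in> carrier L" "A = prime_filters_of L a" "B = prime_filters_of L b"
      using AB by blast
    obtain x y where xy: "x \<in> carrier L" "y \<in> carrier L" "a \<squnion>\<^bsub>L\<^esub> b = a \<squnion>\<^bsub>L\<^esub> y" "a \<squnion>\<^bsub>L\<^esub> b = x \<squnion>\<^bsub>L\<^esub> b"
      "x \<sqinter>\<^bsub>L\<^esub> y = \<bottom>\<^bsub>L\<^esub>"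
      using target_normal ab(1,2) unfolding completely_normal_def by blast
    have "A \<union> B = A \<union> prime_filters_of L y" "A \<union> B = prime_filters_of L x \<union> B"
      "prime_filters_of L x \<inter> prime_filters_of L y = {}"
      unfolding ab(3,4) using target.prime_filters_of_join target.prime_filters_of_meet
        target.prime_filters_of_bottom ab(1,2) xy by metis+
    then show ?thesis using xy(1,2) by blast
  qed
  show "\<exists>t f. pm.functional f \<and> f t = 1 \<and> (\<forall>x\<in>V0 \<union> G. f x = 0)" if G: "finite G" for G :: "(nat \<Rightarrow>\<^sub>0 'k) set"
  proof -
    have "finite (\<Union>(Poly_Mapping.keys ` G))" using G by simp
    then obtain n where n: "\<forall>i\<in>\<Union>(Poly_Mapping.keys ` G). i < n" using finite_nat_set_iff_bounded by blast
    \<comment> \<open>An odd coordinate beyond the supports of all vectors in \<open>G\<close>: its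
      unit vector is fresh, and the coordinate itself is the functional.\<close>
    let ?i = "2 * n + 1"
    have "?i \<notin> Poly_Mapping.keys x" if "x \<in> G" for x
      using n that by fastforce
    then have "Poly_Mapping.lookup x ?i = 0" if "x \<in> G" for x
      using that by (simp add: in_keys_iff)
    then show ?thesis
      by (intro exI[of _ "Poly_Mapping.single ?i 1"] exI[of _ "\<lambda>x. Poly_Mapping.lookup x ?i"])
        (auto simp: pm.functional_def lookup_add lookup_pm_scale V0_def)
  qed
qed (use meas_Lat meas_add meas_smult meas_disjoint ev_closed in
    \<open>auto simp: V0 ev_add ev_scale ev_minus less_imp_le\<close>)

text \<open>A section of \<open>ev\<close> with values in \<open>V0\<close> when \<open>E\<close> is
  countable. It is not linear; linearity is regained after \<open>code\<close>, which identifies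
  vectors of \<open>V0\<close> with equal evaluation.\<close>

definition lift :: "'e \<Rightarrow> nat \<Rightarrow>\<^sub>0 'k" where
  "lift e = Poly_Mapping.single (2 * to_nat_on (carrier E) e) 1"

lemma lift_V0: "lift e \<in> V0"
  by (auto simp: lift_def V0_def lookup_single when_def)

lemma ev_lift:
  assumes "countable (carrier E)" "e \<in> carrier E"
  shows "ev (lift e) = e"
  using assms by (simp add: ev_def lift_def gen_def smult_one)

section \<open>Assembly of the lattice, the homomorphism and the isomorphism\<close>

lemma representation:
  assumes "countable (UNIV :: 'k set)" and E: "countable (carrier E)" and "countable (carrier L)"
  shows "\<exists>(F :: ('k, nat) ordered_module) f \<iota>. vector_lattice F \<and> countable (carrier F) \<and>
    vector_lattice_hom E F f \<and> lattice_iso (Idc F) L \<iota> \<and>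
    (\<forall>I\<in>carrier (Idc E). \<phi> I = \<iota> (Idc_map E F f I))"
proof -
  let ?R = "prime_filters_of L"
  obtain \<nu> where \<nu>0: "\<And>x. x \<in> V0 \<Longrightarrow> \<nu> x = meas (ev x)" and \<nu>Lat: "\<And>x. \<nu> x \<in> ?R ` carrier L"
    and \<nu>: "\<And>x y. \<nu> (x + y) \<subseteq> \<nu> x \<union> \<nu> y" "\<And>c x. 0 < c \<Longrightarrow> \<nu> (pm_scale c x) \<subseteq> \<nu> x"
      "\<And>x. \<nu> x \<inter> \<nu> (- x) = {}"
      "\<And>x. \<exists>t. \<nu> (- t) = {} \<and> \<nu> (x - t) = {} \<and> \<nu> t \<inter> \<nu> (t - x) = {}"
    and real: "\<And>q. q \<in> ?R ` carrier L \<Longrightarrow> \<exists>t. \<nu> t = q \<and> \<nu> (- t) = {}"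
    and \<nu>_arch: "\<And>a b. \<nu> (- a) = {} \<Longrightarrow> \<nu> (- b) = {} \<Longrightarrow> \<nu> a \<subseteq> \<nu> b \<Longrightarrow> \<exists>c\<ge>0. \<nu> (a - pm_scale c b) = {}"
    by (rule measured_extension.total_extension[OF measured_extension_ev countable_poly_mapping[OF assms(1)]
          countable_image[OF assms(3)]], rule that)
  interpret Q: measured_vector_space pm_scale \<nu>
    by unfold_locales (fact countable_poly_mapping[OF assms(1)] \<nu> \<nu>_arch)+
  define F where "F = Q.quotient"
  have F: "vector_lattice F" unfolding F_def by (rule Q.quotient_vector_lattice)
  define f where "f e = Q.code (lift e)" for e
  \<comment> \<open>The difference of two such vectors evaluates to \<open>\<zero>\<close>, which
    has empty measure, so the quotient identifies them.\<close>
  have code_eq: "Q.code x = Q.code y" if "x \<in> V0" "y \<in> V0" "ev x = ev y" for x y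
  proof -
    have "\<nu> (x - y) = {} \<and> \<nu> (y - x) = {}"
      using that \<nu>0[OF V0(4)] ev_closed[of y] by (simp add: ev_diff a_minus_def r_neg meas_nonpos vle_refl)
    then show ?thesis by (simp add: Q.code_eq_iff Q.kin_def)
  qed
  note lift = lift_V0 ev_lift[OF E]
  have f_code: "f e = Q.code x" if "x \<in> V0" "ev x = e" for e x
    unfolding f_def using that ev_closed[of x] by (intro code_eq lift_V0) (auto simp: lift)
  have f_join: "f (x \<squnion>\<^bsub>order_of E\<^esub> y) = f x \<squnion>\<^bsub>order_of F\<^esub> f y"
    and f_meet: "f (x \<sqinter>\<^bsub>order_of E\<^esub> y) = f x \<sqinter>\<^bsub>order_of F\<^esub> f y"
    if xy: "x \<in> carrier E" "y \<in> carrier E" for x y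
  proof -
    \<comment> \<open>The lifted positive part of \<open>x \<ominus> y\<close> satisfies the three
      conditions that yield joins and meets in the quotient; they are verified in \<open>E\<close>,
      since \<open>\<nu>\<close> is \<open>meas\<close> after evaluation on
      \<open>V0\<close>.\<close>
    let ?w = "x \<ominus> y" and ?t = "lift (ppart (x \<ominus> y))"
    have w: "?w \<in> carrier E" using xy by simp
    note p = ppart[OF w]
    have 1: "\<nu> (- ?t) = {}"
      using p minus_nonpos[of "ppart ?w"] by (simp add: \<nu>0 V0 lift ev_minus meas_nonpos)
    have "?w \<ominus> ppart ?w \<preceq> \<zero>"
      using vle_translate[of ?w "ppart ?w" "\<ominus> ppart ?w"] p w by (simp add: a_minus_def r_neg)
    then have 2: "\<nu> (lift x - lift y - ?t) = {}"
      using p w xy by (simp add: \<nu>0 V0 lift ev_diff meas_nonpos)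
    \<comment> \<open>The negative part of \<open>?w\<close> is measured inside
      \<open>meas (\<ominus> ?w)\<close>, the positive part has the measure of \<open>?w\<close>,
      and these are disjoint.\<close>
    have "ppart ?w \<ominus> ?w \<in> pos_cone E"
      using p w vle_iff_diff by (simp add: pos_cone_def)
    then have "meas (ppart ?w \<ominus> ?w) \<subseteq> meas (\<ominus> ?w)"
      using ppart_diff_le[OF w] w pos_meas_mono'[OF _ ppart_pos_cone] by (simp add: meas_nonneg) (simp add: meas_def)
    moreover have "meas (ppart ?w) = meas ?w"
      using meas_nonneg[OF ppart_pos_cone[OF w]] by (simp add: meas_def)
    ultimately have "meas (ppart ?w) \<inter> meas (ppart ?w \<ominus> ?w) = {}"
      using meas_disjoint[OF w] by blast
    then have 3: "\<nu> ?t \<inter> \<nu> (?t - (lift x - lift y)) = {}"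
      using p xy by (simp add: \<nu>0 V0 lift ev_diff)
    have "f (x \<squnion>\<^bsub>order_of E\<^esub> y) = Q.code (lift y + ?t)"
      using xy p by (intro f_code V0 lift) (simp add: ev_add lift join_eq_ppart)
    then show "f (x \<squnion>\<^bsub>order_of E\<^esub> y) = f x \<squnion>\<^bsub>order_of F\<^esub> f y"
      unfolding f_def F_def by (simp only: Q.code_join(1)[OF 1 2 3])
    have "f (x \<sqinter>\<^bsub>order_of E\<^esub> y) = Q.code (lift x - ?t)"
      using xy p by (intro f_code V0 lift) (simp add: ev_diff lift meet_eq_ppart)
    then show "f (x \<sqinter>\<^bsub>order_of E\<^esub> y) = f x \<sqinter>\<^bsub>order_of F\<^esub> f y"
      unfolding f_def F_def by (simp only: Q.code_join(2)[OF 1 2 3])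
  qed
  have f: "vector_lattice_hom E F f"
    unfolding vector_lattice_hom_def lattice_hom_def
  proof (intro conjI ballI allI)
    show "f \<in> carrier E \<rightarrow> carrier F"
      by (simp add: f_def F_def Q.quotient_simps)
    show "f \<in> carrier (order_of E) \<rightarrow> carrier (order_of F)"
      by (simp add: f_def F_def order_of_def Q.quotient_simps)
    show "f (x \<oplus> y) = f x \<oplus>\<^bsub>F\<^esub> f y" if "x \<in> carrier E" "y \<in> carrier E" for x y
      using f_code[of "lift x + lift y" "x \<oplus> y"] that
      by (simp add: V0 lift ev_add) (simp add: f_def F_def Q.quotient_simps)
    show "f (c \<odot> x) = c \<odot>\<^bsub>F\<^esub> f x" if "x \<in> carrier E" for c x
      using f_code[of "pm_scale c (lift x)" "c \<odot> x"] that
      by (simp add: V0 lift ev_scale) (simp add: f_def F_def Q.quotient_simps)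
  qed (use f_join f_meet in \<open>auto simp: order_of_def\<close>)
  have inj: "inj_on ?R (carrier L)" by (rule target.inj_on_prime_filters_of)
  \<comment> \<open>The ideal of \<open>code a\<close> is sent to the element of \<open>L\<close>
    whose Stone set is \<open>\<nu> a\<close>. This is well defined since equal ideals have equal
    \<open>\<nu> a\<close> and the Stone map is injective.\<close>
  define \<iota> where "\<iota> I = (THE l. l \<in> carrier L \<and> (\<exists>a. \<nu> (- a) = {} \<and> I = principal_ideal F (Q.code a) \<and> ?R l = \<nu> a))" for I
  have \<iota>: "\<iota> (principal_ideal F (Q.code a)) = l" if a: "\<nu> (- a) = {}" and l: "l \<in> carrier L" "?R l = \<nu> a" for a l
    unfolding \<iota>_def
  proof (rule the_equality)
    fix l' assume l': "l' \<in> carrier L \<and> (\<exists>b. \<nu> (- b) = {} \<and>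
      principal_ideal F (Q.code a) = principal_ideal F (Q.code b) \<and> ?R l' = \<nu> b)"
    then obtain b where b: "\<nu> (- b) = {}" "principal_ideal F (Q.code a) = principal_ideal F (Q.code b)" "?R l' = \<nu> b"
      by blast
    then have "\<nu> a = \<nu> b"
      using Q.principal_ideal_quotient_subset_iff[OF a b(1)] Q.principal_ideal_quotient_subset_iff[OF b(1) a]
      unfolding F_def by blast
    then show "l' = l" using inj_onD[OF inj, of l' l] l l' b(3) by simp
  qed (use a l in blast)
  have Idc: "\<exists>a l. \<nu> (- a) = {} \<and> l \<in> carrier L \<and> ?R l = \<nu> a \<and> I = principal_ideal F (Q.code a)"
    if I: "I \<in> carrier (Idc F)" for I
  proof -
    obtain a where a: "\<nu> (- a) = {}" "I = principal_ideal F (Q.code a)"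
      using I by (auto simp: Idc_def F_def Q.pos_cone_quotient)
    moreover obtain l where "l \<in> carrier L" "?R l = \<nu> a" using \<nu>Lat[of a] by (metis imageE)
    ultimately show ?thesis by blast
  qed
  have Idc_in: "principal_ideal F (Q.code a) \<in> carrier (Idc F)" if "\<nu> (- a) = {}" for a
    using that by (auto simp: Idc_def F_def Q.pos_cone_quotient)
  have iff: "I \<sqsubseteq>\<^bsub>Idc F\<^esub> J \<longleftrightarrow> \<iota> I \<sqsubseteq>\<^bsub>L\<^esub> \<iota> J" if IJ: "I \<in> carrier (Idc F)" "J \<in> carrier (Idc F)" for I J
  proof -
    obtain a l where a: "\<nu> (- a) = {}" "l \<in> carrier L" "?R l = \<nu> a" "I = principal_ideal F (Q.code a)"
      using Idc[OF IJ(1)] by blast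
    obtain b m where b: "\<nu> (- b) = {}" "m \<in> carrier L" "?R m = \<nu> b" "J = principal_ideal F (Q.code b)"
      using Idc[OF IJ(2)] by blast
    have "I \<sqsubseteq>\<^bsub>Idc F\<^esub> J \<longleftrightarrow> \<nu> a \<subseteq> \<nu> b"
      using Q.principal_ideal_quotient_subset_iff[OF a(1) b(1)] by (simp add: Idc_def a(4) b(4) F_def)
    also have "\<dots> \<longleftrightarrow> l \<sqsubseteq>\<^bsub>L\<^esub> m"
      using target.prime_filters_of_subset_iff[OF a(2) b(2)] a(3) b(3) by simp
    finally show ?thesis
      using \<iota>[OF a(1-3)] \<iota>[OF b(1-3)] a(4) b(4) by simp
  qed
  have \<iota>_carrier: "\<iota> I \<in> carrier L" if "I \<in> carrier (Idc F)" for I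
    using Idc[OF that] \<iota> by blast
  have "bij_betw \<iota> (carrier (Idc F)) (carrier L)"
    unfolding bij_betw_def
  proof
    show "inj_on \<iota> (carrier (Idc F))"
    proof (rule inj_onI)
      fix I J assume IJ: "I \<in> carrier (Idc F)" "J \<in> carrier (Idc F)" and eq: "\<iota> I = \<iota> J"
      have "\<iota> J \<sqsubseteq>\<^bsub>L\<^esub> \<iota> J" using \<iota>_carrier[OF IJ(2)] by simp
      then have "I \<sqsubseteq>\<^bsub>Idc F\<^esub> J" "J \<sqsubseteq>\<^bsub>Idc F\<^esub> I" using iff IJ eq by simp_all
      then show "I = J" by (simp add: Idc_def)
    qed
    have "l \<in> \<iota> ` carrier (Idc F)" if l: "l \<in> carrier L" for l
    proof -
      \<comment> \<open>Every element of \<open>L\<close> was realized as the measure of some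
        nonnegative vector.\<close>
      obtain t where t: "\<nu> t = ?R l" "\<nu> (- t) = {}" using real[of "?R l"] l by blast
      then have "\<iota> (principal_ideal F (Q.code t)) = l" using \<iota> l by simp
      then show ?thesis using Idc_in[OF t(2)] by blast
    qed
    then show "\<iota> ` carrier (Idc F) = carrier L" using \<iota>_carrier by blast
  qed
  then have iso: "lattice_iso (Idc F) L \<iota>"
    by (intro order_iso_lattice_iso vector_lattice.Idc_partial_order F target.lattice_axioms iff)
  have "\<phi> I = \<iota> (Idc_map E F f I)" if I: "I \<in> carrier (Idc E)" for I
  proof -
    obtain x where x: "x \<in> pos_cone E" "I = principal_ideal E x" using I by (auto simp: Idc_simps)
    then have xE: "x \<in> carrier E" "\<zero> \<preceq> x" by (auto simp: pos_cone_def)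
    have "Idc_map E F f I = principal_ideal F (Q.code (lift x))"
      using Idc_map_principal_ideal[OF vector_lattice_axioms F f x(1)] x(2) by (simp add: f_def)
    moreover have "\<nu> (- lift x) = {}"
      using xE minus_nonpos[of x] by (simp add: \<nu>0 V0 lift ev_minus meas_nonpos)
    \<comment> \<open>For nonnegative \<open>x\<close> both sides are
      \<open>pos_meas x\<close>.\<close>
    moreover have "?R (\<phi> I) = \<nu> (lift x)"
      using xE meas_nonneg[OF x(1)] by (simp add: \<nu>0 lift x(2) pos_meas_def)
    ultimately show ?thesis using \<iota> \<phi>_carrier[OF x(1)] x(2) by simp
  qed
  moreover have "countable (carrier F)" by simp
  ultimately show ?thesis using F f iso by blast
qed

end

theorem theorem8p3:
  fixes E :: "('k::{division_ring, linordered_ring_strict}, 'e) ordered_module"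
    and L :: "'l gorder"
    and \<phi> :: "'e set \<Rightarrow> 'l"
  assumes "countable (UNIV :: 'k set)"
    and "vector_lattice E" and "countable (carrier E)"
    and "distributive_zero_lattice L" and "completely_normal L" and "countable (carrier L)"
    and "zero_lattice_hom (Idc E) L \<phi>" and "closed_map (Idc E) L \<phi>"
  shows "\<exists>(F :: ('k, nat) ordered_module) f \<iota>.
           vector_lattice F \<and> countable (carrier F) \<and>
           vector_lattice_hom E F f \<and>
           lattice_iso (Idc F) L \<iota> \<and>
           (\<forall>I\<in>carrier (Idc E). \<phi> I = \<iota> (Idc_map E F f I))"
proof -
  have "closed_zero_hom E L \<phi>"
    using assms by (intro closed_zero_hom.intro closed_zero_hom_axioms.intro)
  then show ?thesis
    using assms by (intro closed_zero_hom.representation)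
qed

end
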